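(* Let $A$ be a symmetric $\mathcal{O}$-algebra such that $K\otimes_{\mathcal{O}}A$ is separable. Suppose that $z_A=\pi^n1_A$ for some choice of a symmetrising form of $A$ and some positive integer $n$, where $z_A$ is the relative projective element with respect to that form. Let $U$ and $V$ be $A$-lattices. The map sending $(\alpha,\beta)\in\mathrm{Hom}_A(U,V)\times\mathrm{Hom}_A(V,U)$ to $\mathrm{tr}_U(\beta\circ\alpha)$ induces a non-degenerate pairing $$\underline{\mathrm{Hom}}_A(U,V)\times\underline{\mathrm{Hom}}_A(V,U)\to\mathcal{O}/\pi^n\mathcal{O}.$$
   Context: Let $p$ be a prime. $\mathcal{O}$ is a complete discrete valuation ring with maximal ideal $J(\mathcal{O})=\pi\mathcal{O}$, residue field $k$ of characteristic $p$, and field of fractions $K$ of characteristic $0$. An $\mathcal{O}$-algebra $A$ is symmetric if it is isomorphic to its $\mathcal{O}$-dual $A^*=\mathrm{Hom}_{\mathcal{O}}(A,\mathcal{O})$ as an $A$-$A$-bimodule (so $A$ is free of finite rank over $\mathcal{O}$). The image $s\in A^*$ of $1_A$ under a bimodule isomorphism $A\cong A^*$ is called a symmetrising form. Given a symmetrising form $s$ and an $\mathcal{O}$-basis $X$ of $A$ with dual basis $X^\vee=\{x^\vee : x\in X\}$ (that is, $s(xx^\vee)=1$ and $s(xy^\vee)=0$ for $x\ne y$ in $X$), the relative projective element of $A$ with respect to $s$ is $z_A=\sum_{x\in X}xx^\vee\in Z(A)$; it is independent of $X$. An $A$-lattice is a left unital $A$-module which is free of finite rank over $\mathcal{O}$;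 $\mathrm{tr}_U$ is the linear trace on $\mathrm{End}_{\mathcal{O}}(U)$. For finitely generated $A$-modules $U,V$, let $\mathrm{Hom}_A^{\mathrm{pr}}(U,V)$ be the set of $A$-homomorphisms $U\to V$ which factor through a relatively $\mathcal{O}$-projective $A$-module (a direct summand of $A\otimes_{\mathcal{O}}W$ for some $\mathcal{O}$-module $W$), and let $\underline{\mathrm{Hom}}_A(U,V)=\mathrm{Hom}_A(U,V)/\mathrm{Hom}_A^{\mathrm{pr}}(U,V)$. *)

theory Defs
  imports "HOL-Computational_Algebra.Primes" "HOL-Algebra.Ring_Divisibility" "HOL-Algebra.Module"
begin

section \<open>Coefficient rings\<close>

locale complete_dvr = principal_domain R for R (structure) +
  fixes \<pi>
  assumes not_field: "\<not> field R"
    and unique_maximal: "\<exists>!J. maximalideal J R"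
    and uniformizer_closed: "\<pi> \<in> carrier R"
    and uniformizer: "maximalideal (PIdl \<pi>) R"
    and complete:
      "\<And>f :: nat \<Rightarrow> 'a. \<lbrakk>\<And>i. f i \<in> carrier R;
          \<And>m::nat. \<exists>N. \<forall>i\<ge>N. \<forall>j\<ge>N. f i \<ominus> f j \<in> PIdl (\<pi> [^] m)\<rbrakk>
        \<Longrightarrow> \<exists>l\<in>carrier R. \<forall>m::nat. \<exists>N. \<forall>i\<ge>N. f i \<ominus> l \<in> PIdl (\<pi> [^] m)"

definition has_characteristic :: "('r, 'e) ring_scheme \<Rightarrow> nat \<Rightarrow> bool" where
  "has_characteristic R c \<longleftrightarrow> (\<forall>m::nat. [m] \<cdot>\<^bsub>R\<^esub> \<one>\<^bsub>R\<^esub> = \<zero>\<^bsub>R\<^esub> \<longleftrightarrow> c dvd m)"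

definition fraction_field :: "'r ring \<Rightarrow> 'k ring \<Rightarrow> ('r \<Rightarrow> 'k) \<Rightarrow> bool" where
  "fraction_field R K \<iota> \<longleftrightarrow> field K \<and> \<iota> \<in> ring_hom R K \<and> inj_on \<iota> (carrier R) \<and>
     (\<forall>x\<in>carrier K. \<exists>a\<in>carrier R. \<exists>b\<in>carrier R - {\<zero>\<^bsub>R\<^esub>}. x = \<iota> a \<otimes>\<^bsub>K\<^esub> inv\<^bsub>K\<^esub> (\<iota> b))"

section \<open>Modules\<close>

text \<open>
  Modules are records of the library type \<^typ>\<open>('r, 'm) module\<close>; the ring multiplication and unit
  slots are only meaningful for algebras and are left \<^term>\<open>undefined\<close> otherwise.
  The library locale \<^locale>\<open>module\<close> requires a commutative scalar ring, hence the following.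
\<close>

locale left_module = A?: ring A + M?: abelian_group M
  for A :: "('a, 'e) ring_scheme" (structure) and M :: "('a, 'm, 'c) module_scheme" (structure) +
  assumes smult_closed:
      "\<lbrakk>a \<in> carrier A; x \<in> carrier M\<rbrakk> \<Longrightarrow> a \<odot>\<^bsub>M\<^esub> x \<in> carrier M"
    and smult_l_distr:
      "\<lbrakk>a \<in> carrier A; b \<in> carrier A; x \<in> carrier M\<rbrakk> \<Longrightarrow>
        (a \<oplus>\<^bsub>A\<^esub> b) \<odot>\<^bsub>M\<^esub> x = a \<odot>\<^bsub>M\<^esub> x \<oplus>\<^bsub>M\<^esub> b \<odot>\<^bsub>M\<^esub> x"
    and smult_r_distr:
      "\<lbrakk>a \<in> carrier A; x \<in> carrier M; y \<in> carrier M\<rbrakk> \<Longrightarrow>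
        a \<odot>\<^bsub>M\<^esub> (x \<oplus>\<^bsub>M\<^esub> y) = a \<odot>\<^bsub>M\<^esub> x \<oplus>\<^bsub>M\<^esub> a \<odot>\<^bsub>M\<^esub> y"
    and smult_assoc1:
      "\<lbrakk>a \<in> carrier A; b \<in> carrier A; x \<in> carrier M\<rbrakk> \<Longrightarrow>
        (a \<otimes>\<^bsub>A\<^esub> b) \<odot>\<^bsub>M\<^esub> x = a \<odot>\<^bsub>M\<^esub> (b \<odot>\<^bsub>M\<^esub> x)"
    and smult_one:
      "x \<in> carrier M \<Longrightarrow> \<one>\<^bsub>A\<^esub> \<odot>\<^bsub>M\<^esub> x = x"

text \<open>
  Homomorphisms are extensional functions on the carrier, so that equality of homomorphisms is
  equality of functions. With a commutative ring as scalar ring this is the set of its linear maps.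
\<close>

definition module_homs ::
    "('a, 'e) ring_scheme \<Rightarrow> ('a, 'u, 'c) module_scheme \<Rightarrow> ('a, 'v, 'd) module_scheme \<Rightarrow> ('u \<Rightarrow> 'v) set"
  where
  "module_homs A U V = {f \<in> carrier U \<rightarrow>\<^sub>E carrier V.
     (\<forall>x\<in>carrier U. \<forall>y\<in>carrier U. f (x \<oplus>\<^bsub>U\<^esub> y) = f x \<oplus>\<^bsub>V\<^esub> f y) \<and>
     (\<forall>a\<in>carrier A. \<forall>x\<in>carrier U. f (a \<odot>\<^bsub>U\<^esub> x) = a \<odot>\<^bsub>V\<^esub> f x)}"

definition regular_module :: "('r, 'e) ring_scheme \<Rightarrow> ('r, 'r) module" where
  "regular_module R = \<lparr>carrier = carrier R, mult = mult R, one = \<one>\<^bsub>R\<^esub>,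
     zero = \<zero>\<^bsub>R\<^esub>, add = add R, smult = mult R\<rparr>"

definition quotient_module :: "('r, 'm, 'e) module_scheme \<Rightarrow> 'm set \<Rightarrow> ('r, 'm set) module" where
  "quotient_module M N = \<lparr>carrier = a_rcosets\<^bsub>M\<^esub> N, mult = undefined, one = undefined,
     zero = N, add = set_add M, smult = (\<lambda>r C. \<Union>x\<in>C. N +>\<^bsub>M\<^esub> (r \<odot>\<^bsub>M\<^esub> x))\<rparr>"

subsection \<open>Bases and traces\<close>

definition is_basis :: "('r, 'e) ring_scheme \<Rightarrow> ('r, 'm, 'c) module_scheme \<Rightarrow> 'm set \<Rightarrow> bool" where
  "is_basis R M X \<longleftrightarrow> finite X \<and> X \<subseteq> carrier M \<and>
     (\<forall>m\<in>carrier M. \<exists>!c. c \<in> X \<rightarrow>\<^sub>E carrier R \<and> m = (\<Oplus>\<^bsub>M\<^esub>x\<in>X. c x \<odot>\<^bsub>M\<^esub> x))"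

definition free_finite_rank :: "('r, 'e) ring_scheme \<Rightarrow> ('r, 'm, 'c) module_scheme \<Rightarrow> bool" where
  "free_finite_rank R M \<longleftrightarrow> (\<exists>X. is_basis R M X)"

definition coords ::
    "('r, 'e) ring_scheme \<Rightarrow> ('r, 'm, 'c) module_scheme \<Rightarrow> 'm set \<Rightarrow> 'm \<Rightarrow> 'm \<Rightarrow> 'r" where
  "coords R M X m = (THE c. c \<in> X \<rightarrow>\<^sub>E carrier R \<and> m = (\<Oplus>\<^bsub>M\<^esub>x\<in>X. c x \<odot>\<^bsub>M\<^esub> x))"

definition linear_trace ::
    "('r, 'e) ring_scheme \<Rightarrow> ('r, 'm, 'c) module_scheme \<Rightarrow> ('m \<Rightarrow> 'm) \<Rightarrow> 'r" where
  "linear_trace R M f = (let X = (SOME X. is_basis R M X) in \<Oplus>\<^bsub>R\<^esub>x\<in>X. coords R M X (f x) x)"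

subsection \<open>Tensor products\<close>

definition free_module :: "('r, 'e) ring_scheme \<Rightarrow> 'i set \<Rightarrow> ('r, 'i \<Rightarrow> 'r) module" where
  "free_module R I = \<lparr>
     carrier = {f. (\<forall>i\<in>I. f i \<in> carrier R) \<and> (\<forall>i. i \<notin> I \<longrightarrow> f i = \<zero>\<^bsub>R\<^esub>) \<and> finite {i. f i \<noteq> \<zero>\<^bsub>R\<^esub>}},
     mult = undefined, one = undefined, zero = (\<lambda>_. \<zero>\<^bsub>R\<^esub>),
     add = (\<lambda>f g i. f i \<oplus>\<^bsub>R\<^esub> g i), smult = (\<lambda>r f i. r \<otimes>\<^bsub>R\<^esub> f i)\<rparr>"

definition unit_vec :: "('r, 'e) ring_scheme \<Rightarrow> 'i \<Rightarrow> 'i \<Rightarrow> 'r" where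
  "unit_vec R i = (\<lambda>j. if j = i then \<one>\<^bsub>R\<^esub> else \<zero>\<^bsub>R\<^esub>)"

definition tensor_relators ::
    "('r, 'e) ring_scheme \<Rightarrow> ('r, 'm, 'c) module_scheme \<Rightarrow> ('r, 'n, 'd) module_scheme
      \<Rightarrow> ('m \<times> 'n \<Rightarrow> 'r) set" where
  "tensor_relators R M N = (let F = free_module R (carrier M \<times> carrier N); e = unit_vec R in
     {e (x \<oplus>\<^bsub>M\<^esub> x', y) \<ominus>\<^bsub>F\<^esub> (e (x, y) \<oplus>\<^bsub>F\<^esub> e (x', y)) | x x' y.
        x \<in> carrier M \<and> x' \<in> carrier M \<and> y \<in> carrier N} \<union>
     {e (x, y \<oplus>\<^bsub>N\<^esub> y') \<ominus>\<^bsub>F\<^esub> (e (x, y) \<oplus>\<^bsub>F\<^esub> e (x, y')) | x y y'.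
        x \<in> carrier M \<and> y \<in> carrier N \<and> y' \<in> carrier N} \<union>
     {e (r \<odot>\<^bsub>M\<^esub> x, y) \<ominus>\<^bsub>F\<^esub> (r \<odot>\<^bsub>F\<^esub> e (x, y)) | r x y.
        r \<in> carrier R \<and> x \<in> carrier M \<and> y \<in> carrier N} \<union>
     {e (x, r \<odot>\<^bsub>N\<^esub> y) \<ominus>\<^bsub>F\<^esub> (r \<odot>\<^bsub>F\<^esub> e (x, y)) | r x y.
        r \<in> carrier R \<and> x \<in> carrier M \<and> y \<in> carrier N})"

definition tensor_kernel ::
    "('r, 'e) ring_scheme \<Rightarrow> ('r, 'm, 'c) module_scheme \<Rightarrow> ('r, 'n, 'd) module_scheme
      \<Rightarrow> ('m \<times> 'n \<Rightarrow> 'r) set" where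
  "tensor_kernel R M N = \<Inter>{H. submodule H R (free_module R (carrier M \<times> carrier N)) \<and>
     tensor_relators R M N \<subseteq> H}"

definition tensor ::
    "('r, 'e) ring_scheme \<Rightarrow> ('r, 'm, 'c) module_scheme \<Rightarrow> ('r, 'n, 'd) module_scheme
      \<Rightarrow> ('r, ('m \<times> 'n \<Rightarrow> 'r) set) module" where
  "tensor R M N = quotient_module (free_module R (carrier M \<times> carrier N)) (tensor_kernel R M N)"

definition pure_tensor ::
    "('r, 'e) ring_scheme \<Rightarrow> ('r, 'm, 'c) module_scheme \<Rightarrow> ('r, 'n, 'd) module_scheme
      \<Rightarrow> 'm \<Rightarrow> 'n \<Rightarrow> ('m \<times> 'n \<Rightarrow> 'r) set" where
  "pure_tensor R M N x y =
     tensor_kernel R M N +>\<^bsub>free_module R (carrier M \<times> carrier N)\<^esub> unit_vec R (x, y)"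

text \<open>
  For a bilinear map \<open>b\<close> into \<open>P\<close>, the linear map from the tensor product into \<open>P\<close> sending each
  pure tensor of \<open>x\<close> and \<open>y\<close> to \<open>b x y\<close>. Elements of the tensor product are cosets of formal linear
  combinations, and the value does not depend on the chosen representative when \<open>b\<close> is bilinear.
\<close>

definition tensor_lift ::
    "('r, 'e) ring_scheme \<Rightarrow> ('r, 'p, 'c) module_scheme \<Rightarrow> ('m \<Rightarrow> 'n \<Rightarrow> 'p)
      \<Rightarrow> ('m \<times> 'n \<Rightarrow> 'r) set \<Rightarrow> 'p" where
  "tensor_lift R P b t = (let f = (SOME f. f \<in> t) in
     \<Oplus>\<^bsub>P\<^esub>i\<in>{i. f i \<noteq> \<zero>\<^bsub>R\<^esub>}. f i \<odot>\<^bsub>P\<^esub> b (fst i) (snd i))"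

definition bilinear_map ::
    "('r, 'e) ring_scheme \<Rightarrow> ('r, 'm, 'c) module_scheme \<Rightarrow> ('r, 'n, 'd) module_scheme
      \<Rightarrow> ('r, 'p, 'f) module_scheme \<Rightarrow> ('m \<Rightarrow> 'n \<Rightarrow> 'p) \<Rightarrow> bool" where
  "bilinear_map R M N P b \<longleftrightarrow>
     (\<forall>x\<in>carrier M. \<forall>y\<in>carrier N. b x y \<in> carrier P) \<and>
     (\<forall>x\<in>carrier M. \<forall>x'\<in>carrier M. \<forall>y\<in>carrier N. b (x \<oplus>\<^bsub>M\<^esub> x') y = b x y \<oplus>\<^bsub>P\<^esub> b x' y) \<and>
     (\<forall>x\<in>carrier M. \<forall>y\<in>carrier N. \<forall>y'\<in>carrier N. b x (y \<oplus>\<^bsub>N\<^esub> y') = b x y \<oplus>\<^bsub>P\<^esub> b x y') \<and>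
     (\<forall>r\<in>carrier R. \<forall>x\<in>carrier M. \<forall>y\<in>carrier N. b (r \<odot>\<^bsub>M\<^esub> x) y = r \<odot>\<^bsub>P\<^esub> b x y) \<and>
     (\<forall>r\<in>carrier R. \<forall>x\<in>carrier M. \<forall>y\<in>carrier N. b x (r \<odot>\<^bsub>N\<^esub> y) = r \<odot>\<^bsub>P\<^esub> b x y)"

definition nondegenerate ::
    "('r, 'm, 'c) module_scheme \<Rightarrow> ('r, 'n, 'd) module_scheme
      \<Rightarrow> ('r, 'p, 'f) module_scheme \<Rightarrow> ('m \<Rightarrow> 'n \<Rightarrow> 'p) \<Rightarrow> bool" where
  "nondegenerate M N P b \<longleftrightarrow>
     (\<forall>x\<in>carrier M. (\<forall>y\<in>carrier N. b x y = \<zero>\<^bsub>P\<^esub>) \<longrightarrow> x = \<zero>\<^bsub>M\<^esub>) \<and>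
     (\<forall>y\<in>carrier N. (\<forall>x\<in>carrier M. b x y = \<zero>\<^bsub>P\<^esub>) \<longrightarrow> y = \<zero>\<^bsub>N\<^esub>)"

section \<open>Algebras\<close>

text \<open>The library locale \<^locale>\<open>algebra\<close> is restricted to commutative algebras.\<close>

locale assoc_algebra = module R A + A?: ring A for R (structure) and A (structure) +
  assumes smult_mult_left:
      "\<lbrakk>r \<in> carrier R; x \<in> carrier A; y \<in> carrier A\<rbrakk> \<Longrightarrow>
        (r \<odot>\<^bsub>A\<^esub> x) \<otimes>\<^bsub>A\<^esub> y = r \<odot>\<^bsub>A\<^esub> (x \<otimes>\<^bsub>A\<^esub> y)"
    and smult_mult_right:
      "\<lbrakk>r \<in> carrier R; x \<in> carrier A; y \<in> carrier A\<rbrakk> \<Longrightarrow>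
        x \<otimes>\<^bsub>A\<^esub> (r \<odot>\<^bsub>A\<^esub> y) = r \<odot>\<^bsub>A\<^esub> (x \<otimes>\<^bsub>A\<^esub> y)"

definition algebra_dual :: "'r ring \<Rightarrow> ('r, 'a) module \<Rightarrow> ('a \<Rightarrow> 'r) set" where
  "algebra_dual R A = module_homs R A (regular_module R)"

text \<open>The bimodule structure on the dual is \<open>(a \<cdot> s \<cdot> b) x = s (b x a)\<close>.\<close>

definition dual_bimodule_isos :: "'r ring \<Rightarrow> ('r, 'a) module \<Rightarrow> ('a \<Rightarrow> 'a \<Rightarrow> 'r) set" where
  "dual_bimodule_isos R A = {\<Phi>. bij_betw \<Phi> (carrier A) (algebra_dual R A) \<and>
     (\<forall>x\<in>carrier A. \<forall>y\<in>carrier A. \<forall>c\<in>carrier A.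
        \<Phi> (x \<oplus>\<^bsub>A\<^esub> y) c = \<Phi> x c \<oplus>\<^bsub>R\<^esub> \<Phi> y c) \<and>
     (\<forall>a\<in>carrier A. \<forall>x\<in>carrier A. \<forall>b\<in>carrier A. \<forall>c\<in>carrier A.
        \<Phi> (a \<otimes>\<^bsub>A\<^esub> x \<otimes>\<^bsub>A\<^esub> b) c = \<Phi> x (b \<otimes>\<^bsub>A\<^esub> c \<otimes>\<^bsub>A\<^esub> a))}"

definition symmetric_algebra :: "'r ring \<Rightarrow> ('r, 'a) module \<Rightarrow> bool" where
  "symmetric_algebra R A \<longleftrightarrow>
     assoc_algebra R A \<and> free_finite_rank R A \<and> dual_bimodule_isos R A \<noteq> {}"

definition symmetrising_form :: "'r ring \<Rightarrow> ('r, 'a) module \<Rightarrow> ('a \<Rightarrow> 'r) \<Rightarrow> bool" where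
  "symmetrising_form R A s \<longleftrightarrow> (\<exists>\<Phi>\<in>dual_bimodule_isos R A. s = \<Phi> \<one>\<^bsub>A\<^esub>)"

text \<open>
  \<open>z\<close> is the relative projective element with respect to \<open>s\<close>; it is unique because it does not
  depend on the basis \<open>X\<close>, and \<open>d\<close> maps each basis element to its dual basis element.
\<close>

definition is_relative_projective_element ::
    "'r ring \<Rightarrow> ('r, 'a) module \<Rightarrow> ('a \<Rightarrow> 'r) \<Rightarrow> 'a \<Rightarrow> bool" where
  "is_relative_projective_element R A s z \<longleftrightarrow> (\<exists>X d. is_basis R A X \<and> d \<in> X \<rightarrow> carrier A \<and>
     (\<forall>x\<in>X. \<forall>y\<in>X. s (x \<otimes>\<^bsub>A\<^esub> d y) = (if x = y then \<one>\<^bsub>R\<^esub> else \<zero>\<^bsub>R\<^esub>)) \<and>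
     z = (\<Oplus>\<^bsub>A\<^esub>x\<in>X. x \<otimes>\<^bsub>A\<^esub> d x))"

subsection \<open>Extension of scalars and separability\<close>

definition field_as_module :: "'k ring \<Rightarrow> ('r \<Rightarrow> 'k) \<Rightarrow> ('r, 'k) module" where
  "field_as_module K \<iota> = \<lparr>carrier = carrier K, mult = mult K, one = \<one>\<^bsub>K\<^esub>,
     zero = \<zero>\<^bsub>K\<^esub>, add = add K, smult = (\<lambda>r x. \<iota> r \<otimes>\<^bsub>K\<^esub> x)\<rparr>"

definition scalar_extension ::
    "'r ring \<Rightarrow> 'k ring \<Rightarrow> ('r \<Rightarrow> 'k) \<Rightarrow> ('r, 'a) module \<Rightarrow> ('k, ('k \<times> 'a \<Rightarrow> 'r) set) module" where
  "scalar_extension R K \<iota> A = (let K' = field_as_module K \<iota>; T = tensor R K' A; t = pure_tensor R K' A in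
     \<lparr>carrier = carrier T,
      mult = (\<lambda>u v. tensor_lift R T (\<lambda>c a. tensor_lift R T (\<lambda>d b. t (c \<otimes>\<^bsub>K\<^esub> d) (a \<otimes>\<^bsub>A\<^esub> b)) v) u),
      one = t \<one>\<^bsub>K\<^esub> \<one>\<^bsub>A\<^esub>, zero = \<zero>\<^bsub>T\<^esub>, add = add T,
      smult = (\<lambda>c u. tensor_lift R T (\<lambda>d a. t (c \<otimes>\<^bsub>K\<^esub> d) a) u)\<rparr>)"

text \<open>
  An algebra \<open>B\<close> over \<open>K\<close> is separable if multiplication, as a map from the tensor square of \<open>B\<close>
  to \<open>B\<close>, is split surjective as a homomorphism of bimodules; \<open>\<sigma>\<close> is the bimodule section.
\<close>

definition separable_algebra :: "'k ring \<Rightarrow> ('k, 'b) module \<Rightarrow> bool" where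
  "separable_algebra K B \<longleftrightarrow> assoc_algebra K B \<and>
     (let T = tensor K B B; t = pure_tensor K B B in
      \<exists>\<sigma> \<in> carrier B \<rightarrow> carrier T.
        (\<forall>x\<in>carrier B. \<forall>y\<in>carrier B. \<sigma> (x \<oplus>\<^bsub>B\<^esub> y) = \<sigma> x \<oplus>\<^bsub>T\<^esub> \<sigma> y) \<and>
        (\<forall>b\<in>carrier B. \<forall>x\<in>carrier B.
           \<sigma> (b \<otimes>\<^bsub>B\<^esub> x) = tensor_lift K T (\<lambda>u v. t (b \<otimes>\<^bsub>B\<^esub> u) v) (\<sigma> x) \<and>
           \<sigma> (x \<otimes>\<^bsub>B\<^esub> b) = tensor_lift K T (\<lambda>u v. t u (v \<otimes>\<^bsub>B\<^esub> b)) (\<sigma> x)) \<and>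
        (\<forall>x\<in>carrier B. tensor_lift K B (\<lambda>u v. u \<otimes>\<^bsub>B\<^esub> v) (\<sigma> x) = x))"

section \<open>Lattices and the stable category\<close>

definition restrict_scalars :: "('r, 'a) module \<Rightarrow> ('a, 'u) module \<Rightarrow> ('r, 'u) module" where
  "restrict_scalars A U = \<lparr>carrier = carrier U, mult = mult U, one = one U,
     zero = \<zero>\<^bsub>U\<^esub>, add = add U, smult = (\<lambda>r u. (r \<odot>\<^bsub>A\<^esub> \<one>\<^bsub>A\<^esub>) \<odot>\<^bsub>U\<^esub> u)\<rparr>"

definition lattice_over :: "'r ring \<Rightarrow> ('r, 'a) module \<Rightarrow> ('a, 'u) module \<Rightarrow> bool" where
  "lattice_over R A U \<longleftrightarrow> left_module A U \<and> free_finite_rank R (restrict_scalars A U)"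

definition hom_module ::
    "('r, 'a) module \<Rightarrow> ('a, 'u) module \<Rightarrow> ('a, 'v) module \<Rightarrow> ('r, 'u \<Rightarrow> 'v) module" where
  "hom_module A U V = \<lparr>carrier = module_homs A U V, mult = undefined, one = undefined,
     zero = (\<lambda>u\<in>carrier U. \<zero>\<^bsub>V\<^esub>),
     add = (\<lambda>f g. \<lambda>u\<in>carrier U. f u \<oplus>\<^bsub>V\<^esub> g u),
     smult = (\<lambda>r f. \<lambda>u\<in>carrier U. (r \<odot>\<^bsub>A\<^esub> \<one>\<^bsub>A\<^esub>) \<odot>\<^bsub>V\<^esub> f u)\<rparr>"

definition induced_module ::
    "'r ring \<Rightarrow> ('r, 'a) module \<Rightarrow> ('r, 'w) module \<Rightarrow> ('a, ('a \<times> 'w \<Rightarrow> 'r) set) module" where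
  "induced_module R A W = (let T = tensor R A W in
     \<lparr>carrier = carrier T, mult = undefined, one = undefined, zero = \<zero>\<^bsub>T\<^esub>, add = add T,
      smult = (\<lambda>a u. tensor_lift R T (\<lambda>b w. pure_tensor R A W (a \<otimes>\<^bsub>A\<^esub> b) w) u)\<rparr>)"

definition direct_summand ::
    "('a, 'e) ring_scheme \<Rightarrow> 'm set \<Rightarrow> ('a, 'm, 'c) module_scheme \<Rightarrow> bool" where
  "direct_summand A P M \<longleftrightarrow> submodule P A M \<and>
     (\<exists>Q. submodule Q A M \<and> P \<inter> Q = {\<zero>\<^bsub>M\<^esub>} \<and> P <+>\<^bsub>M\<^esub> Q = carrier M)"

text \<open>
  Homomorphisms factoring through a direct summand of the module induced from some \<open>W\<close>.
  HOL cannot quantify over types inside a formula, so the type \<open>'w\<close> of the elements of \<open>W\<close> is a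
  parameter; \<open>W\<close> ranges over all modules whose carrier is a subset of that type.
\<close>

definition projective_homs ::
    "'w itself \<Rightarrow> 'r ring \<Rightarrow> ('r, 'a) module \<Rightarrow> ('a, 'u) module \<Rightarrow> ('a, 'v) module \<Rightarrow> ('u \<Rightarrow> 'v) set"
  where
  "projective_homs _ R A U V = {f \<in> module_homs A U V.
     \<exists>(W :: ('r, 'w) module) P g h. module R W \<and>
       direct_summand A P (induced_module R A W) \<and>
       g \<in> module_homs A U (induced_module R A W\<lparr>carrier := P\<rparr>) \<and>
       h \<in> module_homs A (induced_module R A W\<lparr>carrier := P\<rparr>) V \<and>
       f = compose (carrier U) h g}"

definition stable_hom_module ::
    "'w itself \<Rightarrow> 'r ring \<Rightarrow> ('r, 'a) module \<Rightarrow> ('a, 'u) module \<Rightarrow> ('a, 'v) module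
      \<Rightarrow> ('r, ('u \<Rightarrow> 'v) set) module" where
  "stable_hom_module w R A U V = quotient_module (hom_module A U V) (projective_homs w R A U V)"

definition stable_class ::
    "'w itself \<Rightarrow> 'r ring \<Rightarrow> ('r, 'a) module \<Rightarrow> ('a, 'u) module \<Rightarrow> ('a, 'v) module
      \<Rightarrow> ('u \<Rightarrow> 'v) \<Rightarrow> ('u \<Rightarrow> 'v) set" where
  "stable_class w R A U V f = projective_homs w R A U V +>\<^bsub>hom_module A U V\<^esub> f"

end

theory Submission
  imports Defs
begin

text \<open>
  Let \<open>X\<close> be a basis of \<open>A\<close> with dual basis \<open>d\<close>. An \<open>\<O>\<close>-linear map \<open>\<tau>\<close> between two lattices has a
  relative trace \<open>Tr \<tau> = \<Sum> d x \<circ> \<tau> \<circ> x\<close>, which is \<open>A\<close>-linear. Three facts about it carry the proof.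

  \<^item> The homomorphisms that factor through a relatively projective module are exactly the relative
    traces (Higman's criterion; lemmas \<open>rel_trace_if_projective\<close> and \<open>projective_if_rel_trace\<close>). The
    identity of \<open>A \<otimes> W\<close> is the relative trace of \<open>a \<otimes> w \<mapsto> s a 1 \<otimes> w\<close>, and relative traces are
    stable under composition with homomorphisms, so everything that factors through a summand of
    \<open>A \<otimes> W\<close> is a relative trace. Conversely \<open>Tr \<tau>\<close> factors through \<open>A \<otimes> V\<close>.

  \<^item> On an endomorphism \<open>\<rho>\<close> of \<open>U\<close>, cyclicity of the linear trace gives
    \<open>tr (Tr \<rho>) = \<Sum> tr (\<rho> \<circ> x (d x)) = \<pi>\<^sup>n tr \<rho>\<close>, because \<open>\<Sum> x (d x)\<close> is the relative projective
    element (lemma \<open>linear_trace_rel_trace\<close>). Since \<open>\<beta> \<circ> Tr \<tau> = Tr (\<beta> \<circ> \<tau>)\<close>, the pairing with a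
    projective homomorphism vanishes modulo \<open>\<pi>\<^sup>n\<close>, so the pairing on stable homomorphisms is well
    defined.

  \<^item> A submodule of a free module over \<open>\<O>\<close> that contains every vector of which it contains a nonzero
    multiple has the property that its linear functionals are combinations of the ambient
    coordinates (lemma \<open>functional_eq_combination_of_coordinates\<close>). The homomorphisms of
    \<open>A\<close>-modules form such a submodule of all linear maps.

  For non-degeneracy, let \<open>\<alpha>\<close> be such that \<open>\<pi>\<^sup>n\<close> divides \<open>tr (\<beta> \<circ> \<alpha>)\<close> for all \<open>\<beta>\<close>. The functional
  \<open>\<beta> \<mapsto> tr (\<beta> \<circ> \<alpha>) / \<pi>\<^sup>n\<close> on homomorphisms is, by the third fact, of the form \<open>\<beta> \<mapsto> tr (\<beta> \<circ> \<tau>)\<close> with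
  \<open>\<tau>\<close> an \<open>\<O>\<close>-linear map (lemma \<open>functional_on_homs_eq_trace\<close>). Hence \<open>tr (\<beta> \<circ> \<alpha>) = \<pi>\<^sup>n tr (\<beta> \<circ> \<tau>) = tr (\<beta> \<circ> Tr \<tau>)\<close> for all \<open>\<beta>\<close>. Taking
  for \<open>\<beta>\<close> the relative trace of a map \<open>\<sigma>\<close> of rank one, the outer terms become \<open>\<pi>\<^sup>n tr (\<sigma> \<circ> \<alpha>)\<close> and
  \<open>\<pi>\<^sup>n tr (\<sigma> \<circ> Tr \<tau>)\<close>, which are multiples by \<open>\<pi>\<^sup>n\<close> of arbitrary coordinates of values of \<open>\<alpha>\<close> and
  \<open>Tr \<tau>\<close>. So \<open>\<alpha> = Tr \<tau>\<close> is projective (lemma \<open>rel_trace_if_traces_divisible\<close>). The other argument of the pairing is treated by exchanging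
  \<open>U\<close> and \<open>V\<close>, since \<open>tr (\<beta> \<circ> \<alpha>) = tr (\<alpha> \<circ> \<beta>)\<close>.
\<close>

section \<open>Linear maps\<close>

lemma left_module_if_module:
  assumes "module R M"
  shows "left_module R M"
proof -
  interpret M: module R M by fact
  show ?thesis
    by unfold_locales (auto simp: M.smult_l_distr M.smult_r_distr M.smult_assoc1)
qed

lemma module_if_left_module:
  assumes "cring R" "left_module R M"
  shows "module R M"
proof -
  interpret R: cring R by fact
  interpret M: left_module R M by fact
  show ?thesis
    by (rule moduleI)
      (simp_all add: R.is_cring M.abelian_group_axioms M.smult_closed M.smult_l_distr
        M.smult_r_distr M.smult_assoc1 M.smult_one)
qed

text \<open>
  Unlike the elements of \<^const>\<open>module_homs\<close>, linear maps here may take any values outside the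
  carrier, so that they compose and add as plain functions. The locale includes that source and
  target are modules.
\<close>

locale linear_map = M: left_module R M + N: left_module R N
  for R :: "('r, 'e) ring_scheme" and M :: "('r, 'm, 'c) module_scheme"
    and N :: "('r, 'n, 'd) module_scheme" +
  fixes f :: "'m \<Rightarrow> 'n"
  assumes closed: "x \<in> carrier M \<Longrightarrow> f x \<in> carrier N"
    and map_add: "\<lbrakk>x \<in> carrier M; y \<in> carrier M\<rbrakk> \<Longrightarrow> f (x \<oplus>\<^bsub>M\<^esub> y) = f x \<oplus>\<^bsub>N\<^esub> f y"
    and map_smult: "\<lbrakk>r \<in> carrier R; x \<in> carrier M\<rbrakk> \<Longrightarrow> f (r \<odot>\<^bsub>M\<^esub> x) = r \<odot>\<^bsub>N\<^esub> f x"

lemma additive_zero: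
  assumes "abelian_group M" "abelian_group N"
    and "\<And>x. x \<in> carrier M \<Longrightarrow> f x \<in> carrier N"
    and "\<And>x y. \<lbrakk>x \<in> carrier M; y \<in> carrier M\<rbrakk> \<Longrightarrow> f (x \<oplus>\<^bsub>M\<^esub> y) = f x \<oplus>\<^bsub>N\<^esub> f y"
  shows "f \<zero>\<^bsub>M\<^esub> = \<zero>\<^bsub>N\<^esub>"
proof -
  interpret M: abelian_group M by fact
  interpret N: abelian_group N by fact
  have "f \<zero>\<^bsub>M\<^esub> \<oplus>\<^bsub>N\<^esub> f \<zero>\<^bsub>M\<^esub> = f \<zero>\<^bsub>M\<^esub>"
    using assms(4)[of "\<zero>\<^bsub>M\<^esub>" "\<zero>\<^bsub>M\<^esub>"] by simp
  then show ?thesis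
    using assms(3)[of "\<zero>\<^bsub>M\<^esub>"] N.add.l_cancel_one by simp
qed

lemma additive_finsum:
  assumes "abelian_group M" "abelian_group N"
    and closed: "\<And>x. x \<in> carrier M \<Longrightarrow> f x \<in> carrier N"
    and add: "\<And>x y. \<lbrakk>x \<in> carrier M; y \<in> carrier M\<rbrakk> \<Longrightarrow> f (x \<oplus>\<^bsub>M\<^esub> y) = f x \<oplus>\<^bsub>N\<^esub> f y"
    and "g \<in> I \<rightarrow> carrier M"
  shows "f (\<Oplus>\<^bsub>M\<^esub>i\<in>I. g i) = (\<Oplus>\<^bsub>N\<^esub>i\<in>I. f (g i))"
proof -
  interpret M: abelian_group M by fact
  interpret N: abelian_group N by fact
  note zero = additive_zero[of M N f, OF assms(1-4)]
  show ?thesis using assms(5)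
  proof (induct I rule: infinite_finite_induct)
    case (infinite I)
    then show ?case by (simp add: zero M.finsum_infinite N.finsum_infinite)
  next
    case empty
    then show ?case by (simp add: zero)
  next
    case (insert i I)
    then have "(\<lambda>i. f (g i)) \<in> I \<rightarrow> carrier N" "g \<in> I \<rightarrow> carrier M" by (auto intro: closed)
    then show ?case using insert
      by (simp add: M.finsum_insert N.finsum_insert add closed)
  qed
qed

lemma (in left_module) finsum_smult:
  assumes "a \<in> carrier A" "g \<in> I \<rightarrow> carrier M"
  shows "a \<odot>\<^bsub>M\<^esub> (\<Oplus>\<^bsub>M\<^esub>i\<in>I. g i) = (\<Oplus>\<^bsub>M\<^esub>i\<in>I. a \<odot>\<^bsub>M\<^esub> g i)"
  using assms
  by (intro additive_finsum[OF M.abelian_group_axioms M.abelian_group_axioms,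
        where f = "\<lambda>x. a \<odot>\<^bsub>M\<^esub> x"]) (auto simp: smult_closed smult_r_distr)

lemma (in left_module) smult_finsum:
  assumes "x \<in> carrier M" "g \<in> I \<rightarrow> carrier A"
  shows "(\<Oplus>\<^bsub>A\<^esub>i\<in>I. g i) \<odot>\<^bsub>M\<^esub> x = (\<Oplus>\<^bsub>M\<^esub>i\<in>I. g i \<odot>\<^bsub>M\<^esub> x)"
  using assms
  by (intro additive_finsum[OF A.abelian_group_axioms M.abelian_group_axioms,
        where f = "\<lambda>a. a \<odot>\<^bsub>M\<^esub> x"])
    (auto simp: smult_closed smult_l_distr)

context linear_map
begin

lemma map_zero: "f \<zero>\<^bsub>M\<^esub> = \<zero>\<^bsub>N\<^esub>"
  using M.M.abelian_group_axioms N.M.abelian_group_axioms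
  by (rule additive_zero) (auto simp: closed map_add)

lemma map_minus: "x \<in> carrier M \<Longrightarrow> f (\<ominus>\<^bsub>M\<^esub> x) = \<ominus>\<^bsub>N\<^esub> f x"
  using map_add[of "\<ominus>\<^bsub>M\<^esub> x" x] closed[of x] closed[of "\<ominus>\<^bsub>M\<^esub> x"] map_zero
  by (simp add: M.M.l_neg N.M.minus_equality)

lemma map_diff: "\<lbrakk>x \<in> carrier M; y \<in> carrier M\<rbrakk> \<Longrightarrow> f (x \<ominus>\<^bsub>M\<^esub> y) = f x \<ominus>\<^bsub>N\<^esub> f y"
  by (simp add: M.M.minus_eq N.M.minus_eq map_add map_minus)

lemma map_finsum: "g \<in> I \<rightarrow> carrier M \<Longrightarrow> f (\<Oplus>\<^bsub>M\<^esub>i\<in>I. g i) = (\<Oplus>\<^bsub>N\<^esub>i\<in>I. f (g i))"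
  by (rule additive_finsum[OF M.M.abelian_group_axioms N.M.abelian_group_axioms, where f = f])
    (simp_all add: closed map_add)

end

lemma linear_mapI:
  assumes "left_module R M" "left_module R N"
    and "\<And>x. x \<in> carrier M \<Longrightarrow> f x \<in> carrier N"
    and "\<And>x y. \<lbrakk>x \<in> carrier M; y \<in> carrier M\<rbrakk> \<Longrightarrow> f (x \<oplus>\<^bsub>M\<^esub> y) = f x \<oplus>\<^bsub>N\<^esub> f y"
    and "\<And>r x. \<lbrakk>r \<in> carrier R; x \<in> carrier M\<rbrakk> \<Longrightarrow> f (r \<odot>\<^bsub>M\<^esub> x) = r \<odot>\<^bsub>N\<^esub> f x"
  shows "linear_map R M N f"
  using assms by (simp add: linear_map_def linear_map_axioms_def)

lemma linear_map_cong:
  assumes "linear_map R M N f" and eq: "\<And>x. x \<in> carrier M \<Longrightarrow> f x = g x"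
  shows "linear_map R M N g"
proof -
  interpret f: linear_map R M N f by fact
  show ?thesis
  proof (rule linear_mapI[OF f.M.left_module_axioms f.N.left_module_axioms])
    fix x assume x: "x \<in> carrier M"
    show "g x \<in> carrier N" using eq[OF x] f.closed[OF x] by simp
    show "g (x \<oplus>\<^bsub>M\<^esub> y) = g x \<oplus>\<^bsub>N\<^esub> g y" if y: "y \<in> carrier M" for y
      using eq[OF x] eq[OF y] eq[of "x \<oplus>\<^bsub>M\<^esub> y"] x y f.map_add[OF x y] by simp
    show "g (r \<odot>\<^bsub>M\<^esub> x) = r \<odot>\<^bsub>N\<^esub> g x" if r: "r \<in> carrier R" for r
      using eq[OF x] eq[OF f.M.smult_closed[OF r x]] f.map_smult[OF r x] by simp
  qed
qed

lemma linear_map_comp: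
  assumes "linear_map R M N f" "linear_map R N P g"
  shows "linear_map R M P (\<lambda>x. g (f x))"
proof -
  interpret f: linear_map R M N f by fact
  interpret g: linear_map R N P g by fact
  show ?thesis
    by (rule linear_mapI)
      (auto simp: f.M.left_module_axioms g.N.left_module_axioms f.closed g.closed f.map_add g.map_add
        f.map_smult g.map_smult)
qed

lemma linear_map_id:
  assumes "left_module R M"
  shows "linear_map R M M (\<lambda>x. x)"
  using assms by (rule linear_mapI[OF _ assms]) simp_all

lemma linear_map_finsum:
  assumes M: "left_module R M" and N: "left_module R N"
    and lin: "\<And>i. i \<in> I \<Longrightarrow> linear_map R M N (f i)"
  shows "linear_map R M N (\<lambda>x. \<Oplus>\<^bsub>N\<^esub>i\<in>I. f i x)"
proof -
  interpret N: left_module R N by fact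
  have cl: "f i x \<in> carrier N" if "i \<in> I" "x \<in> carrier M" for i x
    using linear_map.closed[OF lin] that by blast
  have "(\<Oplus>\<^bsub>N\<^esub>i\<in>I. f i (x \<oplus>\<^bsub>M\<^esub> y)) = (\<Oplus>\<^bsub>N\<^esub>i\<in>I. f i x) \<oplus>\<^bsub>N\<^esub> (\<Oplus>\<^bsub>N\<^esub>i\<in>I. f i y)"
    if "x \<in> carrier M" "y \<in> carrier M" for x y
  proof -
    have "(\<Oplus>\<^bsub>N\<^esub>i\<in>I. f i (x \<oplus>\<^bsub>M\<^esub> y)) = (\<Oplus>\<^bsub>N\<^esub>i\<in>I. f i x \<oplus>\<^bsub>N\<^esub> f i y)"
      using that cl by (intro N.M.finsum_cong') (auto simp: linear_map.map_add[OF lin])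
    then show ?thesis using that cl by (simp add: N.M.finsum_addf Pi_def)
  qed
  moreover have "(\<Oplus>\<^bsub>N\<^esub>i\<in>I. f i (r \<odot>\<^bsub>M\<^esub> x)) = r \<odot>\<^bsub>N\<^esub> (\<Oplus>\<^bsub>N\<^esub>i\<in>I. f i x)"
    if "r \<in> carrier R" "x \<in> carrier M" for r x
  proof -
    have "(\<Oplus>\<^bsub>N\<^esub>i\<in>I. f i (r \<odot>\<^bsub>M\<^esub> x)) = (\<Oplus>\<^bsub>N\<^esub>i\<in>I. r \<odot>\<^bsub>N\<^esub> f i x)"
      using that cl by (intro N.M.finsum_cong') (auto simp: linear_map.map_smult[OF lin] N.smult_closed)
    then show ?thesis using that cl by (simp add: N.finsum_smult Pi_def)
  qed
  ultimately show ?thesis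
    using M N cl by (intro linear_mapI) (auto intro!: N.M.finsum_closed)
qed

lemma linear_map_smult:
  assumes "cring R" "linear_map R M N f" "r \<in> carrier R"
  shows "linear_map R M N (\<lambda>x. r \<odot>\<^bsub>N\<^esub> f x)"
proof -
  interpret R: cring R by fact
  interpret f: linear_map R M N f by fact
  show ?thesis using assms(3)
    by (intro linear_mapI)
      (auto simp: f.M.left_module_axioms f.N.left_module_axioms f.closed f.map_add f.map_smult
        f.N.smult_closed f.N.smult_r_distr f.N.smult_assoc1[symmetric] R.m_comm)
qed

lemma module_homs_iff:
  assumes "left_module R M" "left_module R N"
  shows "f \<in> module_homs R M N \<longleftrightarrow> linear_map R M N f \<and> f \<in> extensional (carrier M)"
  using assms
  by (auto simp: module_homs_def linear_map_def linear_map_axioms_def PiE_def Pi_def)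

lemma module_homs_restrict:
  assumes "linear_map R M N f"
  shows "restrict f (carrier M) \<in> module_homs R M N"
proof -
  interpret f: linear_map R M N f by fact
  show ?thesis
    using f.M.left_module_axioms f.N.left_module_axioms assms
    by (auto simp: module_homs_iff intro: linear_map_cong[OF assms])
qed

lemma regular_module_simps [simp]:
  "carrier (regular_module R) = carrier R" "add (regular_module R) = add R"
  "zero (regular_module R) = \<zero>\<^bsub>R\<^esub>" "smult (regular_module R) = mult R"
  by (simp_all add: regular_module_def)

text \<open>
  Sums depend only on the additive structure, so they may be computed in any record that shares it.
\<close>

lemma finsum_cong_record:
  assumes "carrier M = carrier N" "add M = add N" "zero M = zero N"
  shows "finsum M = finsum N"
  using assms by (intro ext) (simp add: finsum_def finprod_def)

lemma regular_module_finsum [simp]: "finsum (regular_module R) = finsum R"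
  by (rule finsum_cong_record) simp_all

lemma regular_module_a_inv [simp]: "a_inv (regular_module R) = a_inv R"
  by (intro ext) (simp add: a_inv_def m_inv_def)

lemma regular_module_a_minus [simp]: "a_minus (regular_module R) = a_minus R"
  by (intro ext) (simp add: a_minus_def)

lemma regular_module_coset [simp]: "a_r_coset (regular_module R) = a_r_coset R"
  by (intro ext) (simp add: a_r_coset_def')

lemma abelian_group_cong_record:
  assumes "abelian_group M" and "carrier M = carrier N" "add M = add N" "zero M = zero N"
  shows "abelian_group N"
proof -
  interpret M: abelian_group M by fact
  show ?thesis
    by (rule abelian_groupI)
      (auto simp: assms(2-)[symmetric] M.a_ac intro: M.l_neg)
qed

lemma module_regular:
  assumes "cring R"
  shows "module R (regular_module R)"
proof -
  interpret R: cring R by fact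
  have "abelian_group (regular_module R)"
    using R.abelian_group_axioms by (rule abelian_group_cong_record) simp_all
  then show ?thesis
    by (intro moduleI) (auto simp: R.is_cring R.l_distr R.r_distr R.m_assoc)
qed

section \<open>Quotient modules\<close>

context module
begin

lemma abelian_subgroup_submodule:
  assumes "submodule H R M"
  shows "abelian_subgroup H M"
  using assms M.abelian_group_axioms
  by (intro abelian_subgroupI3 additive_subgroup.intro) (simp add: submodule_def)

lemma coset_eq_iff:
  assumes "submodule H R M" "x \<in> carrier M" "y \<in> carrier M"
  shows "H +>\<^bsub>M\<^esub> x = H +>\<^bsub>M\<^esub> y \<longleftrightarrow> x \<ominus>\<^bsub>M\<^esub> y \<in> H"
proof -
  interpret H: abelian_subgroup H M by (rule abelian_subgroup_submodule) fact
  have "H +>\<^bsub>M\<^esub> x = H +>\<^bsub>M\<^esub> y \<longleftrightarrow> x \<in> H +>\<^bsub>M\<^esub> y"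
    using assms(2,3) H.a_rcos_self H.a_repr_independence' by blast
  then show ?thesis using assms(2,3) by (simp add: H.a_rcos_module M.minus_eq)
qed

lemma (in module) submoduleI_nonempty:
  assumes "H \<subseteq> carrier M" "H \<noteq> {}"
    and "\<And>x y. \<lbrakk>x \<in> H; y \<in> H\<rbrakk> \<Longrightarrow> x \<oplus>\<^bsub>M\<^esub> y \<in> H"
    and smult: "\<And>r x. \<lbrakk>r \<in> carrier R; x \<in> H\<rbrakk> \<Longrightarrow> r \<odot>\<^bsub>M\<^esub> x \<in> H"
  shows "submodule H R M"
proof (rule submoduleI)
  obtain x where x: "x \<in> H" using assms(2) by blast
  then show "\<zero>\<^bsub>M\<^esub> \<in> H" using smult[OF R.zero_closed x] assms(1) by auto
  show "\<ominus>\<^bsub>M\<^esub> y \<in> H" if "y \<in> H" for y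
    using smult[of "\<ominus> \<one>" y] that assms(1) by (auto simp: smult_l_minus)
qed (use assms in auto)

lemma quotient_module_simps:
  shows "carrier (quotient_module M H) = (\<lambda>x. H +>\<^bsub>M\<^esub> x) ` carrier M"
    and "zero (quotient_module M H) = H"
  by (auto simp: quotient_module_def A_RCOSETS_def')

lemma quotient_module_add:
  assumes "submodule H R M" "x \<in> carrier M" "y \<in> carrier M"
  shows "(H +>\<^bsub>M\<^esub> x) \<oplus>\<^bsub>quotient_module M H\<^esub> (H +>\<^bsub>M\<^esub> y) = H +>\<^bsub>M\<^esub> (x \<oplus>\<^bsub>M\<^esub> y)"
proof -
  interpret H: abelian_subgroup H M by (rule abelian_subgroup_submodule) fact
  show ?thesis using assms by (simp add: quotient_module_def H.a_rcos_sum)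
qed

lemma quotient_module_smult:
  assumes H: "submodule H R M" and r: "r \<in> carrier R" and x: "x \<in> carrier M"
  shows "r \<odot>\<^bsub>quotient_module M H\<^esub> (H +>\<^bsub>M\<^esub> x) = H +>\<^bsub>M\<^esub> (r \<odot>\<^bsub>M\<^esub> x)"
proof -
  interpret H: abelian_subgroup H M by (rule abelian_subgroup_submodule) fact
  have eq: "H +>\<^bsub>M\<^esub> (r \<odot>\<^bsub>M\<^esub> y) = H +>\<^bsub>M\<^esub> (r \<odot>\<^bsub>M\<^esub> x)" if "y \<in> H +>\<^bsub>M\<^esub> x" for y
  proof -
    have y: "y \<in> carrier M" using that x H.a_subset H.a_elemrcos_carrier by blast
    have "H +>\<^bsub>M\<^esub> y = H +>\<^bsub>M\<^esub> x" using that x H.a_repr_independence' by simp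
    then have "y \<ominus>\<^bsub>M\<^esub> x \<in> H" using H x y coset_eq_iff by blast
    then have "r \<odot>\<^bsub>M\<^esub> (y \<ominus>\<^bsub>M\<^esub> x) \<in> H" using H r submoduleE(4) by blast
    then have "r \<odot>\<^bsub>M\<^esub> y \<ominus>\<^bsub>M\<^esub> r \<odot>\<^bsub>M\<^esub> x \<in> H"
      using r x y by (simp add: M.minus_eq smult_r_distr smult_r_minus)
    then show ?thesis using H r x y by (simp add: coset_eq_iff)
  qed
  have "(\<Union>y\<in>H +>\<^bsub>M\<^esub> x. H +>\<^bsub>M\<^esub> (r \<odot>\<^bsub>M\<^esub> y)) = (\<Union>y\<in>H +>\<^bsub>M\<^esub> x. H +>\<^bsub>M\<^esub> (r \<odot>\<^bsub>M\<^esub> x))"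
    using eq by (intro SUP_cong refl)
  moreover have "x \<in> H +>\<^bsub>M\<^esub> x" using x by (rule H.a_rcos_self)
  ultimately have "(\<Union>y\<in>H +>\<^bsub>M\<^esub> x. H +>\<^bsub>M\<^esub> (r \<odot>\<^bsub>M\<^esub> y)) = H +>\<^bsub>M\<^esub> (r \<odot>\<^bsub>M\<^esub> x)"
    by blast
  then show ?thesis by (simp add: quotient_module_def)
qed

lemma module_quotient:
  assumes H: "submodule H R M"
  shows "module R (quotient_module M H)"
proof -
  interpret H: abelian_subgroup H M by (rule abelian_subgroup_submodule) fact
  note simps = quotient_module_simps quotient_module_add[OF H] quotient_module_smult[OF H]
  have zero: "H = H +>\<^bsub>M\<^esub> \<zero>\<^bsub>M\<^esub>" using H.a_subset by simp
  have "abelian_group (quotient_module M H)"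
  proof (rule abelian_groupI)
    show "\<zero>\<^bsub>quotient_module M H\<^esub> \<in> carrier (quotient_module M H)"
      using zero by (auto simp: simps)
    show "\<exists>y\<in>carrier (quotient_module M H). y \<oplus>\<^bsub>quotient_module M H\<^esub> x = \<zero>\<^bsub>quotient_module M H\<^esub>"
      if "x \<in> carrier (quotient_module M H)" for x
    proof -
      from that obtain m where m: "m \<in> carrier M" "x = H +>\<^bsub>M\<^esub> m" by (auto simp: simps)
      then have "(H +>\<^bsub>M\<^esub> (\<ominus>\<^bsub>M\<^esub> m)) \<oplus>\<^bsub>quotient_module M H\<^esub> x = H"
        using H.a_subset by (simp add: simps M.l_neg)
      with m show ?thesis by (auto simp: simps)
    qed
    show "\<zero>\<^bsub>quotient_module M H\<^esub> \<oplus>\<^bsub>quotient_module M H\<^esub> x = x"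
      if "x \<in> carrier (quotient_module M H)" for x
    proof -
      from that obtain m where m: "m \<in> carrier M" "x = H +>\<^bsub>M\<^esub> m" by (auto simp: simps)
      then show ?thesis using quotient_module_add[OF H, of "\<zero>\<^bsub>M\<^esub>" m] zero by (simp add: simps)
    qed
  qed (auto simp: simps M.a_ac)
  then show ?thesis
    by (intro moduleI; (unfold quotient_module_simps(1), elim imageE)?)
      (simp_all add: quotient_module_add[OF H] quotient_module_smult[OF H] R.is_cring
        smult_l_distr smult_r_distr smult_assoc1)
qed

lemma linear_map_coset:
  assumes H: "submodule H R M"
  shows "linear_map R M (quotient_module M H) (\<lambda>x. H +>\<^bsub>M\<^esub> x)"
  by (rule linear_mapI[OF left_module_if_module[OF module_axioms]
        left_module_if_module[OF module_quotient[OF H]]])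
    (simp_all add: quotient_module_simps(1) quotient_module_add[OF H] quotient_module_smult[OF H])

end

lemma submodule_ideal:
  assumes "cring R" "ideal I R"
  shows "submodule I R (regular_module R)"
proof -
  interpret R: cring R by fact
  interpret I: ideal I R by fact
  interpret M: module R "regular_module R" using assms(1) by (rule module_regular)
  show ?thesis
  proof (rule M.submoduleI_nonempty)
    show "I \<noteq> {}" using I.zero_closed by blast
  qed (auto intro: I.a_closed I.I_l_closed)
qed

lemma (in abelian_group) diff_eq_zero_iff:
  assumes "x \<in> carrier G" "y \<in> carrier G"
  shows "x \<ominus> y = \<zero> \<longleftrightarrow> x = y"
  using assms by (metis add.inv_solve_right' l_zero minus_eq r_neg zero_closed)

lemma (in module) submodule_zero_closed:
  assumes "submodule H R M"
  shows "\<zero>\<^bsub>M\<^esub> \<in> H"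
proof -
  interpret H: abelian_subgroup H M by (rule abelian_subgroup_submodule) fact
  show ?thesis by (rule H.zero_closed)
qed

section \<open>Tensor products\<close>

lemma free_module_simps:
  "carrier (free_module R I) =
     {f. (\<forall>i\<in>I. f i \<in> carrier R) \<and> (\<forall>i. i \<notin> I \<longrightarrow> f i = \<zero>\<^bsub>R\<^esub>) \<and> finite {i. f i \<noteq> \<zero>\<^bsub>R\<^esub>}}"
  "zero (free_module R I) = (\<lambda>_. \<zero>\<^bsub>R\<^esub>)"
  "f \<oplus>\<^bsub>free_module R I\<^esub> g = (\<lambda>i. f i \<oplus>\<^bsub>R\<^esub> g i)"
  "r \<odot>\<^bsub>free_module R I\<^esub> f = (\<lambda>i. r \<otimes>\<^bsub>R\<^esub> f i)"
  by (simp_all add: free_module_def)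

lemma free_moduleD:
  assumes "cring R" "f \<in> carrier (free_module R I)"
  shows "f i \<in> carrier R" "f i \<noteq> \<zero>\<^bsub>R\<^esub> \<Longrightarrow> i \<in> I" "finite {i. f i \<noteq> \<zero>\<^bsub>R\<^esub>}"
proof -
  interpret R: cring R by fact
  show "f i \<in> carrier R" using assms(2) by (cases "i \<in> I") (auto simp: free_module_simps)
  show "f i \<noteq> \<zero>\<^bsub>R\<^esub> \<Longrightarrow> i \<in> I" "finite {i. f i \<noteq> \<zero>\<^bsub>R\<^esub>}"
    using assms(2) by (auto simp: free_module_simps)
qed

lemma module_free:
  assumes "cring R"
  shows "module R (free_module R I)"
proof -
  interpret R: cring R by fact
  note D = free_moduleD[OF assms]
  have add: "(\<lambda>i. f i \<oplus>\<^bsub>R\<^esub> g i) \<in> carrier (free_module R I)"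
    if f: "f \<in> carrier (free_module R I)" and g: "g \<in> carrier (free_module R I)" for f g
  proof -
    have "{i. f i \<oplus>\<^bsub>R\<^esub> g i \<noteq> \<zero>\<^bsub>R\<^esub>} \<subseteq> {i. f i \<noteq> \<zero>\<^bsub>R\<^esub>} \<union> {i. g i \<noteq> \<zero>\<^bsub>R\<^esub>}" by auto
    then have "finite {i. f i \<oplus>\<^bsub>R\<^esub> g i \<noteq> \<zero>\<^bsub>R\<^esub>}"
      using D(3)[OF f] D(3)[OF g] finite_subset by blast
    then show ?thesis using f g by (auto simp: free_module_simps)
  qed
  have smult: "(\<lambda>i. r \<otimes>\<^bsub>R\<^esub> f i) \<in> carrier (free_module R I)"
    if r: "r \<in> carrier R" and f: "f \<in> carrier (free_module R I)" for r f
  proof -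
    have "{i. r \<otimes>\<^bsub>R\<^esub> f i \<noteq> \<zero>\<^bsub>R\<^esub>} \<subseteq> {i. f i \<noteq> \<zero>\<^bsub>R\<^esub>}" using r by auto
    then have "finite {i. r \<otimes>\<^bsub>R\<^esub> f i \<noteq> \<zero>\<^bsub>R\<^esub>}"
      using D(3)[OF f] finite_subset by blast
    then show ?thesis using r f by (auto simp: free_module_simps)
  qed
  have "abelian_group (free_module R I)"
  proof (rule abelian_groupI)
    fix f assume f: "f \<in> carrier (free_module R I)"
    have "(\<lambda>i. \<ominus>\<^bsub>R\<^esub> \<one>\<^bsub>R\<^esub> \<otimes>\<^bsub>R\<^esub> f i) \<in> carrier (free_module R I)" using f smult by simp
    moreover have "(\<lambda>i. (\<ominus>\<^bsub>R\<^esub> \<one>\<^bsub>R\<^esub> \<otimes>\<^bsub>R\<^esub> f i) \<oplus>\<^bsub>R\<^esub> f i) = (\<lambda>_. \<zero>\<^bsub>R\<^esub>)"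
      using D(1)[OF f] by (auto simp: R.l_minus R.l_neg)
    ultimately show "\<exists>g\<in>carrier (free_module R I). g \<oplus>\<^bsub>free_module R I\<^esub> f = \<zero>\<^bsub>free_module R I\<^esub>"
      by (auto simp: free_module_simps(2-4))
  next
    show "\<zero>\<^bsub>free_module R I\<^esub> \<in> carrier (free_module R I)" by (simp add: free_module_simps)
  next
    fix f g h assume "f \<in> carrier (free_module R I)" "g \<in> carrier (free_module R I)"
      "h \<in> carrier (free_module R I)"
    then show "f \<oplus>\<^bsub>free_module R I\<^esub> g \<oplus>\<^bsub>free_module R I\<^esub> h =
        f \<oplus>\<^bsub>free_module R I\<^esub> (g \<oplus>\<^bsub>free_module R I\<^esub> h)"
      by (simp add: free_module_simps(2-4) D(1) R.a_assoc)
  next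
    fix f g assume "f \<in> carrier (free_module R I)" "g \<in> carrier (free_module R I)"
    then show "f \<oplus>\<^bsub>free_module R I\<^esub> g = g \<oplus>\<^bsub>free_module R I\<^esub> f"
      by (simp add: free_module_simps(2-4) D(1) R.a_comm)
  next
    fix f assume "f \<in> carrier (free_module R I)"
    then show "\<zero>\<^bsub>free_module R I\<^esub> \<oplus>\<^bsub>free_module R I\<^esub> f = f"
      by (simp add: free_module_simps(2-4) D(1))
  qed (simp add: free_module_simps(2-4) add)
  then show ?thesis
    by (rule moduleI[OF assms])
      (simp_all add: free_module_simps(2-4) smult D(1) R.l_distr R.r_distr R.m_assoc)
qed

lemma unit_vec_closed:
  assumes "cring R" "i \<in> I"
  shows "unit_vec R i \<in> carrier (free_module R I)"
proof -
  interpret R: cring R by fact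
  have "{j. unit_vec R i j \<noteq> \<zero>\<^bsub>R\<^esub>} \<subseteq> {i}" by (auto simp: unit_vec_def)
  then have "finite {j. unit_vec R i j \<noteq> \<zero>\<^bsub>R\<^esub>}" using finite_subset by blast
  then show ?thesis using assms(2) by (auto simp: free_module_simps unit_vec_def)
qed

text \<open>
  The linear extension of \<open>b\<close> from the unit vectors to the free module on them.
\<close>

definition free_lift ::
    "('r, 'e) ring_scheme \<Rightarrow> ('r, 'p, 'c) module_scheme \<Rightarrow> ('i \<Rightarrow> 'p) \<Rightarrow> ('i \<Rightarrow> 'r) \<Rightarrow> 'p" where
  "free_lift R P b f = (\<Oplus>\<^bsub>P\<^esub>i\<in>{i. f i \<noteq> \<zero>\<^bsub>R\<^esub>}. f i \<odot>\<^bsub>P\<^esub> b i)"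

text \<open>
  The support of a vector changes under addition and scaling; summing over a common finite superset
  of supports makes these operations comparable.
\<close>

lemma (in module) free_lift_superset:
  assumes f: "f \<in> carrier (free_module R I)" and b: "b \<in> I \<rightarrow> carrier M"
    and S: "finite S" "{i. f i \<noteq> \<zero>} \<subseteq> S" "S \<subseteq> I"
  shows "free_lift R M b f = (\<Oplus>\<^bsub>M\<^esub>i\<in>S. f i \<odot>\<^bsub>M\<^esub> b i)"
  unfolding free_lift_def
proof (rule M.add.finprod_mono_neutral_cong_left[OF S(1,2)])
  have b': "b i \<in> carrier M" if "i \<in> S" for i using that b S(3) by auto
  show "f i \<odot>\<^bsub>M\<^esub> b i = \<zero>\<^bsub>M\<^esub>" if "i \<in> S - {i. f i \<noteq> \<zero>}" for i
    using that b' by simp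
  show "(\<lambda>i. f i \<odot>\<^bsub>M\<^esub> b i) \<in> S \<rightarrow> carrier M"
    using b' free_moduleD(1)[OF R.is_cring f] by auto
qed simp

lemma (in module) linear_map_free_lift:
  assumes b: "b \<in> I \<rightarrow> carrier M"
  shows "linear_map R (free_module R I) M (free_lift R M b)"
proof (rule linear_mapI)
  note D = free_moduleD[OF R.is_cring]
  interpret F: module R "free_module R I" using R.is_cring by (rule module_free)
  show "left_module R (free_module R I)" "left_module R M"
    using F.module_axioms module_axioms by (auto intro: left_module_if_module)
  fix f assume f: "f \<in> carrier (free_module R I)"
  have cl: "(\<lambda>i. f i \<odot>\<^bsub>M\<^esub> b i) \<in> I \<rightarrow> carrier M" if "f \<in> carrier (free_module R I)" for f
    using b D(1)[OF that] by auto
  show "free_lift R M b f \<in> carrier M"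
    unfolding free_lift_def using b D[OF f] by (intro M.finsum_closed) auto
  show "free_lift R M b (f \<oplus>\<^bsub>free_module R I\<^esub> g) = free_lift R M b f \<oplus>\<^bsub>M\<^esub> free_lift R M b g"
    if g: "g \<in> carrier (free_module R I)" for g
  proof -
    let ?S = "{i. f i \<noteq> \<zero>} \<union> {i. g i \<noteq> \<zero>}"
    have S: "finite ?S" "?S \<subseteq> I" using D[OF f] D[OF g] by auto
    have fg: "(\<lambda>i. f i \<oplus> g i) \<in> carrier (free_module R I)"
      using F.M.a_closed[OF f g] by (simp add: free_module_simps(2-4))
    have sub: "{i. f i \<oplus> g i \<noteq> \<zero>} \<subseteq> ?S" by auto
    have "(\<Oplus>\<^bsub>M\<^esub>i\<in>?S. (f i \<oplus> g i) \<odot>\<^bsub>M\<^esub> b i) = (\<Oplus>\<^bsub>M\<^esub>i\<in>?S. f i \<odot>\<^bsub>M\<^esub> b i \<oplus>\<^bsub>M\<^esub> g i \<odot>\<^bsub>M\<^esub> b i)"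
      using S(2) subsetD[OF S(2), THEN funcset_mem[OF b]] D(1)[OF f] D(1)[OF g]
      by (intro M.finsum_cong') (auto simp: smult_l_distr)
    also have "\<dots> = (\<Oplus>\<^bsub>M\<^esub>i\<in>?S. f i \<odot>\<^bsub>M\<^esub> b i) \<oplus>\<^bsub>M\<^esub> (\<Oplus>\<^bsub>M\<^esub>i\<in>?S. g i \<odot>\<^bsub>M\<^esub> b i)"
      using S(2) cl[OF f] cl[OF g] by (intro M.finsum_addf) auto
    finally show ?thesis
      using S sub f g fg by (simp add: free_module_simps(2-4) free_lift_superset[OF _ b S(1) _ S(2)])
  qed
  show "free_lift R M b (r \<odot>\<^bsub>free_module R I\<^esub> f) = r \<odot>\<^bsub>M\<^esub> free_lift R M b f"
    if r: "r \<in> carrier R" for r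
  proof -
    let ?S = "{i. f i \<noteq> \<zero>}"
    have S: "finite ?S" "?S \<subseteq> I" using D[OF f] by auto
    have rf: "(\<lambda>i. r \<otimes> f i) \<in> carrier (free_module R I)"
      using F.smult_closed[OF r f] by (simp add: free_module_simps(2-4))
    have sub: "{i. r \<otimes> f i \<noteq> \<zero>} \<subseteq> ?S" using r by auto
    have "(\<Oplus>\<^bsub>M\<^esub>i\<in>?S. (r \<otimes> f i) \<odot>\<^bsub>M\<^esub> b i) = (\<Oplus>\<^bsub>M\<^esub>i\<in>?S. r \<odot>\<^bsub>M\<^esub> (f i \<odot>\<^bsub>M\<^esub> b i))"
      using S(2) subsetD[OF S(2), THEN funcset_mem[OF b]] D(1)[OF f] r
      by (intro M.finsum_cong') (auto simp: smult_assoc1)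
    also have "\<dots> = r \<odot>\<^bsub>M\<^esub> (\<Oplus>\<^bsub>M\<^esub>i\<in>?S. f i \<odot>\<^bsub>M\<^esub> b i)"
      using S cl[OF f] r by (intro finsum_smult_ldistr[symmetric]) auto
    finally show ?thesis
      using S sub f rf by (simp add: free_module_simps(2-4) free_lift_superset[OF _ b S(1) _ S(2)])
  qed
qed

lemma (in module) free_lift_unit_vec:
  assumes b: "b \<in> I \<rightarrow> carrier M" and i: "i \<in> I"
  shows "free_lift R M b (unit_vec R i) = b i"
proof -
  have "free_lift R M b (unit_vec R i) = (\<Oplus>\<^bsub>M\<^esub>j\<in>{i}. unit_vec R i j \<odot>\<^bsub>M\<^esub> b j)"
    using i by (intro free_lift_superset[OF unit_vec_closed[OF R.is_cring i] b])
      (auto simp: unit_vec_def)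
  also have "\<dots> = b i"
    using funcset_mem[OF b i] by (simp add: unit_vec_def)
  finally show ?thesis .
qed

lemma free_module_span:
  assumes R: "cring R" and H: "submodule H R (free_module R I)"
    and unit: "\<And>i. i \<in> I \<Longrightarrow> unit_vec R i \<in> H"
  shows "carrier (free_module R I) \<subseteq> H"
proof
  interpret R: cring R by fact
  interpret F: module R "free_module R I" using R by (rule module_free)
  note D = free_moduleD[OF R] and HE = F.submoduleE[OF H]
  have "f \<in> H" if "finite S" "f \<in> carrier (free_module R I)" "{i. f i \<noteq> \<zero>\<^bsub>R\<^esub>} \<subseteq> S" for S f
    using that
  proof (induct S arbitrary: f)
    case empty
    then have "f = \<zero>\<^bsub>free_module R I\<^esub>" by (auto simp: free_module_simps)
    then show ?case using F.submodule_zero_closed[OF H] by simp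
  next
    case (insert i S)
    show ?case
    proof (cases "i \<in> I")
      case False
      then have "f i = \<zero>\<^bsub>R\<^esub>" using D(2)[OF insert(4)] by blast
      then show ?thesis using insert by (intro insert(3)) auto
    next
      case True
      let ?g = "f(i := \<zero>\<^bsub>R\<^esub>)"
      have "{j. ?g j \<noteq> \<zero>\<^bsub>R\<^esub>} \<subseteq> {j. f j \<noteq> \<zero>\<^bsub>R\<^esub>}" by auto
      then have fin: "finite {j. ?g j \<noteq> \<zero>\<^bsub>R\<^esub>}" using D(3)[OF insert(4)] finite_subset by blast
      then have "?g \<in> carrier (free_module R I)"
        using insert(4) fin unfolding free_module_simps(1) by auto
      moreover have "{j. ?g j \<noteq> \<zero>\<^bsub>R\<^esub>} \<subseteq> S" using insert(5) by auto
      ultimately have "?g \<in> H" by (rule insert(3))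
      moreover have "f i \<odot>\<^bsub>free_module R I\<^esub> unit_vec R i \<in> H"
        using D(1)[OF insert(4)] unit[OF True] by (rule HE(4))
      ultimately have "?g \<oplus>\<^bsub>free_module R I\<^esub> (f i \<odot>\<^bsub>free_module R I\<^esub> unit_vec R i) \<in> H"
        by (rule HE(5))
      also have "?g \<oplus>\<^bsub>free_module R I\<^esub> (f i \<odot>\<^bsub>free_module R I\<^esub> unit_vec R i) = f"
        using D(1)[OF insert(4)] by (auto simp: free_module_simps(2-4) unit_vec_def)
      finally show ?thesis .
    qed
  qed
  then show "f \<in> H" if "f \<in> carrier (free_module R I)" for f
    using that D(3)[OF that] by blast
qed

lemma (in linear_map) submodule_vimage:
  assumes R: "cring R" and K: "submodule K R N"
  shows "submodule {x \<in> carrier M. f x \<in> K} R M"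
proof -
  interpret M': module R M using R M.left_module_axioms by (rule module_if_left_module)
  interpret N': module R N using R N.left_module_axioms by (rule module_if_left_module)
  note K = N'.submodule_zero_closed[OF K] N'.submoduleE[OF K]
  show ?thesis
    by (intro M'.submoduleI) (auto simp: map_zero map_minus map_add map_smult K)
qed

lemma (in module) submodule_zero: "submodule {\<zero>\<^bsub>M\<^esub>} R M"
  by (rule submoduleI) auto

locale tensor_product = M: module R M + N: module R N
  for R :: "('r, 'e) ring_scheme" and M :: "('r, 'm, 'c) module_scheme"
    and N :: "('r, 'n, 'd) module_scheme"
begin

abbreviation F where "F \<equiv> free_module R (carrier M \<times> carrier N)"
abbreviation T where "T \<equiv> tensor R M N"
abbreviation \<kappa> where "\<kappa> \<equiv> tensor_kernel R M N"

sublocale F: module R F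
  using M.R.is_cring by (rule module_free)

lemma unit_vec_F: "\<lbrakk>x \<in> carrier M; y \<in> carrier N\<rbrakk> \<Longrightarrow> unit_vec R (x, y) \<in> carrier F"
  using M.R.is_cring by (simp add: unit_vec_closed)

lemma relators_closed: "tensor_relators R M N \<subseteq> carrier F"
  unfolding tensor_relators_def Let_def
  by (auto intro!: F.M.minus_closed F.M.a_closed F.smult_closed unit_vec_F simp del: F.M.minus_closed)

lemma submodule_kernel: "submodule \<kappa> R F"
proof -
  define \<H> where "\<H> = {H. submodule H R F \<and> tensor_relators R M N \<subseteq> H}"
  have F: "carrier F \<in> \<H>" using relators_closed F.carrier_is_submodule by (simp add: \<H>_def)
  have sub: "submodule H R F" if "H \<in> \<H>" for H using that by (simp add: \<H>_def)
  note E = F.submoduleE[OF sub]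
  note zero = F.submodule_zero_closed[OF sub]
  have "submodule (\<Inter>\<H>) R F"
    using F E(1)[OF F] by (intro F.submoduleI) (blast intro: E(3-5) zero)+
  then show ?thesis by (simp add: tensor_kernel_def \<H>_def)
qed

lemma relators_kernel: "tensor_relators R M N \<subseteq> \<kappa>"
  by (auto simp: tensor_kernel_def)

lemma module_tensor: "module R T"
  unfolding tensor_def by (rule F.module_quotient[OF submodule_kernel])

sublocale T: module R T
  by (rule module_tensor)

lemma linear_map_coset_T: "linear_map R F T (\<lambda>f. \<kappa> +>\<^bsub>F\<^esub> f)"
  unfolding tensor_def by (rule F.linear_map_coset[OF submodule_kernel])

lemma pure_bilinear: "bilinear_map R M N T (pure_tensor R M N)"
proof -
  interpret q: linear_map R F T "\<lambda>f. \<kappa> +>\<^bsub>F\<^esub> f" by (rule linear_map_coset_T)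
  note coset = F.coset_eq_iff[OF submodule_kernel, THEN iffD2]
  note u = unit_vec_F
  have rel: "\<kappa> +>\<^bsub>F\<^esub> v = \<kappa> +>\<^bsub>F\<^esub> w"
    if "v \<ominus>\<^bsub>F\<^esub> w \<in> tensor_relators R M N" "v \<in> carrier F" "w \<in> carrier F" for v w
    using that relators_kernel by (intro coset) auto
  show ?thesis
    unfolding bilinear_map_def
  proof (intro conjI ballI)
    show "pure_tensor R M N x y \<in> carrier T" if "x \<in> carrier M" "y \<in> carrier N" for x y
      using q.closed[OF u[OF that]] by (simp add: pure_tensor_def)
    show "pure_tensor R M N (x \<oplus>\<^bsub>M\<^esub> x') y = pure_tensor R M N x y \<oplus>\<^bsub>T\<^esub> pure_tensor R M N x' y"
      if "x \<in> carrier M" "x' \<in> carrier M" "y \<in> carrier N" for x x' y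
      unfolding pure_tensor_def using that
      by (subst q.map_add[symmetric]; (intro rel)?)
        (auto simp: tensor_relators_def Let_def u intro!: u)
    show "pure_tensor R M N x (y \<oplus>\<^bsub>N\<^esub> y') = pure_tensor R M N x y \<oplus>\<^bsub>T\<^esub> pure_tensor R M N x y'"
      if "x \<in> carrier M" "y \<in> carrier N" "y' \<in> carrier N" for x y y'
      unfolding pure_tensor_def using that
      by (subst q.map_add[symmetric]; (intro rel)?)
        (auto simp: tensor_relators_def Let_def u intro!: u)
    show "pure_tensor R M N (r \<odot>\<^bsub>M\<^esub> x) y = r \<odot>\<^bsub>T\<^esub> pure_tensor R M N x y"
      if "r \<in> carrier R" "x \<in> carrier M" "y \<in> carrier N" for r x y
      unfolding pure_tensor_def using that
      by (subst q.map_smult[symmetric]; (intro rel)?)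
        (auto simp: tensor_relators_def Let_def u intro!: u)
    show "pure_tensor R M N x (r \<odot>\<^bsub>N\<^esub> y) = r \<odot>\<^bsub>T\<^esub> pure_tensor R M N x y"
      if "r \<in> carrier R" "x \<in> carrier M" "y \<in> carrier N" for r x y
      unfolding pure_tensor_def using that
      by (subst q.map_smult[symmetric]; (intro rel)?)
        (auto simp: tensor_relators_def Let_def u intro!: u)
  qed
qed

text \<open>
  The vectors of the free module on whose cosets the two maps agree form a submodule containing all
  unit vectors.
\<close>

lemma tensor_ext:
  assumes f: "linear_map R T P f" and g: "linear_map R T P g"
    and eq: "\<And>x y. \<lbrakk>x \<in> carrier M; y \<in> carrier N\<rbrakk> \<Longrightarrow>
      f (pure_tensor R M N x y) = g (pure_tensor R M N x y)"
    and t: "t \<in> carrier T"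
  shows "f t = g t"
proof -
  interpret q: linear_map R F T "\<lambda>f. \<kappa> +>\<^bsub>F\<^esub> f" by (rule linear_map_coset_T)
  interpret f: linear_map R T P f by fact
  interpret g: linear_map R T P g by fact
  let ?H = "{v \<in> carrier F. f (\<kappa> +>\<^bsub>F\<^esub> v) = g (\<kappa> +>\<^bsub>F\<^esub> v)}"
  have "submodule ?H R F"
    by (rule F.submoduleI)
      (auto simp: q.closed q.map_add q.map_smult q.map_minus q.map_zero f.map_add g.map_add
        f.map_minus g.map_minus f.map_zero g.map_zero f.map_smult g.map_smult)
  moreover have "unit_vec R i \<in> ?H" if "i \<in> carrier M \<times> carrier N" for i
    using that eq unit_vec_F by (auto simp: pure_tensor_def)
  ultimately have "carrier F \<subseteq> ?H" by (rule free_module_span[OF M.R.is_cring])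
  moreover obtain v where "v \<in> carrier F" "t = \<kappa> +>\<^bsub>F\<^esub> v"
    using t unfolding tensor_def F.quotient_module_simps by blast
  ultimately show ?thesis by auto
qed

text \<open>
  The linear extension of a bilinear map kills the relators, hence the submodule that they generate,
  so its value does not depend on the representative that \<^const>\<open>tensor_lift\<close> selects.
\<close>

lemma tensor_lift_coset:
  assumes P: "module R P" and b: "bilinear_map R M N P b" and v: "v \<in> carrier F"
  shows "tensor_lift R P b (\<kappa> +>\<^bsub>F\<^esub> v) = free_lift R P (\<lambda>i. b (fst i) (snd i)) v"
proof -
  interpret P: module R P by fact
  interpret \<kappa>: abelian_subgroup \<kappa> F by (rule F.abelian_subgroup_submodule[OF submodule_kernel])
  let ?b = "\<lambda>i. b (fst i) (snd i)"
  have b': "?b \<in> carrier M \<times> carrier N \<rightarrow> carrier P"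
    using b by (auto simp: bilinear_map_def)
  interpret L: linear_map R F P "free_lift R P ?b" by (rule P.linear_map_free_lift[OF b'])
  have L: "free_lift R P ?b (unit_vec R (x, y)) = b x y" if "x \<in> carrier M" "y \<in> carrier N" for x y
    using P.free_lift_unit_vec[OF b', of "(x, y)"] that by simp
  have bP: "b x y \<in> carrier P" if "x \<in> carrier M" "y \<in> carrier N" for x y
    using that b by (auto simp: bilinear_map_def)
  let ?H = "{v \<in> carrier F. free_lift R P ?b v \<in> {\<zero>\<^bsub>P\<^esub>}}"
  have H: "submodule ?H R F"
    using M.R.is_cring P.submodule_zero by (rule L.submodule_vimage)
  note simps = F.M.minus_closed unit_vec_F L.map_diff L.map_add L.map_smult L bP P.M.r_neg P.M.minus_eq
  have "tensor_relators R M N \<subseteq> ?H"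
    unfolding tensor_relators_def Let_def
    using b by (auto simp: simps bilinear_map_def)
  with H have ker: "\<kappa> \<subseteq> ?H" by (auto simp: tensor_kernel_def)
  have "free_lift R P ?b w = free_lift R P ?b v" if w: "w \<in> \<kappa> +>\<^bsub>F\<^esub> v" for w
  proof -
    have wF: "w \<in> carrier F" using w v \<kappa>.a_elemrcos_carrier by blast
    have "w \<ominus>\<^bsub>F\<^esub> v \<in> \<kappa>"
      using \<kappa>.a_rcos_module_imp[OF v w] by (simp add: F.M.minus_eq)
    then have "free_lift R P ?b w \<ominus>\<^bsub>P\<^esub> free_lift R P ?b v = \<zero>\<^bsub>P\<^esub>"
      using ker wF v by (auto simp: L.map_diff)
    then show ?thesis using L.closed wF v P.M.diff_eq_zero_iff by simp
  qed
  moreover have "(SOME w. w \<in> \<kappa> +>\<^bsub>F\<^esub> v) \<in> \<kappa> +>\<^bsub>F\<^esub> v"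
    by (rule someI[where P = "\<lambda>w. w \<in> \<kappa> +>\<^bsub>F\<^esub> v"]) (rule \<kappa>.a_rcos_self[OF v])
  ultimately show ?thesis by (simp add: tensor_lift_def free_lift_def Let_def)
qed

lemma tensor_lift_pure:
  assumes P: "module R P" and b: "bilinear_map R M N P b" and "x \<in> carrier M" "y \<in> carrier N"
  shows "tensor_lift R P b (pure_tensor R M N x y) = b x y"
proof -
  have b': "(\<lambda>i. b (fst i) (snd i)) \<in> carrier M \<times> carrier N \<rightarrow> carrier P"
    using b by (auto simp: bilinear_map_def)
  have "tensor_lift R P b (pure_tensor R M N x y) =
      free_lift R P (\<lambda>i. b (fst i) (snd i)) (unit_vec R (x, y))"
    unfolding pure_tensor_def using assms by (intro tensor_lift_coset unit_vec_F)
  also have "\<dots> = b x y"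
    using module.free_lift_unit_vec[OF P b', of "(x, y)"] assms(3,4) by simp
  finally show ?thesis .
qed

lemma tensor_lift_linear:
  assumes P: "module R P" and b: "bilinear_map R M N P b"
  shows "linear_map R T P (tensor_lift R P b)"
proof -
  interpret P: module R P by fact
  interpret q: linear_map R F T "\<lambda>f. \<kappa> +>\<^bsub>F\<^esub> f" by (rule linear_map_coset_T)
  let ?b = "\<lambda>i. b (fst i) (snd i)"
  have b': "?b \<in> carrier M \<times> carrier N \<rightarrow> carrier P"
    using b by (auto simp: bilinear_map_def)
  interpret L: linear_map R F P "free_lift R P ?b" by (rule P.linear_map_free_lift[OF b'])
  note lift = tensor_lift_coset[OF P b]
  have rep: "\<exists>v\<in>carrier F. t = \<kappa> +>\<^bsub>F\<^esub> v" if "t \<in> carrier T" for t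
    using that unfolding tensor_def F.quotient_module_simps by blast
  show ?thesis
  proof (rule linear_mapI)
    show "left_module R T" "left_module R P"
      using T.module_axioms P by (auto intro: left_module_if_module)
    fix t assume "t \<in> carrier T"
    then obtain v where v: "v \<in> carrier F" "t = \<kappa> +>\<^bsub>F\<^esub> v" using rep by blast
    show "tensor_lift R P b t \<in> carrier P" using v by (simp add: lift L.closed)
    show "tensor_lift R P b (r \<odot>\<^bsub>T\<^esub> t) = r \<odot>\<^bsub>P\<^esub> tensor_lift R P b t" if "r \<in> carrier R" for r
      using v that by (simp add: lift L.map_smult q.map_smult[symmetric])
    show "tensor_lift R P b (t \<oplus>\<^bsub>T\<^esub> t') = tensor_lift R P b t \<oplus>\<^bsub>P\<^esub> tensor_lift R P b t'"
      if "t' \<in> carrier T" for t'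
    proof -
      obtain v' where v': "v' \<in> carrier F" "t' = \<kappa> +>\<^bsub>F\<^esub> v'" using rep \<open>t' \<in> carrier T\<close> by blast
      show ?thesis using v v' by (simp add: lift L.map_add q.map_add[symmetric])
    qed
  qed
qed

end

section \<open>Bases and traces\<close>

lemma (in module) coords_basis:
  assumes "is_basis R M X" "m \<in> carrier M"
  shows "coords R M X m \<in> X \<rightarrow>\<^sub>E carrier R"
    and "(\<Oplus>\<^bsub>M\<^esub>x\<in>X. coords R M X m x \<odot>\<^bsub>M\<^esub> x) = m"
proof -
  have "\<exists>!c. c \<in> X \<rightarrow>\<^sub>E carrier R \<and> m = (\<Oplus>\<^bsub>M\<^esub>x\<in>X. c x \<odot>\<^bsub>M\<^esub> x)"
    using assms by (simp add: is_basis_def)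
  from theI'[OF this]
  show "coords R M X m \<in> X \<rightarrow>\<^sub>E carrier R" "(\<Oplus>\<^bsub>M\<^esub>x\<in>X. coords R M X m x \<odot>\<^bsub>M\<^esub> x) = m"
    by (simp_all add: coords_def)
qed

lemma (in module) coords_eqI:
  assumes X: "is_basis R M X" and m: "m \<in> carrier M"
    and c: "\<And>x. x \<in> X \<Longrightarrow> c x \<in> carrier R" and sum: "m = (\<Oplus>\<^bsub>M\<^esub>x\<in>X. c x \<odot>\<^bsub>M\<^esub> x)"
    and x: "x \<in> X"
  shows "coords R M X m x = c x"
proof -
  let ?P = "\<lambda>c. c \<in> X \<rightarrow>\<^sub>E carrier R \<and> m = (\<Oplus>\<^bsub>M\<^esub>x\<in>X. c x \<odot>\<^bsub>M\<^esub> x)"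
  have "finite X" "X \<subseteq> carrier M" using X by (auto simp: is_basis_def)
  then have "(\<Oplus>\<^bsub>M\<^esub>x\<in>X. restrict c X x \<odot>\<^bsub>M\<^esub> x) = (\<Oplus>\<^bsub>M\<^esub>x\<in>X. c x \<odot>\<^bsub>M\<^esub> x)"
    using c by (intro M.finsum_cong') auto
  then have "?P (restrict c X)" using c sum by auto
  moreover have "\<exists>!c. ?P c" using X m by (simp add: is_basis_def)
  ultimately have "coords R M X m = restrict c X"
    unfolding coords_def by (intro the1_equality)
  then show ?thesis using x by simp
qed

lemma (in module) linear_map_coords:
  assumes X: "is_basis R M X" and x: "x \<in> X"
  shows "linear_map R M (regular_module R) (\<lambda>m. coords R M X m x)"
proof -
  have fin: "finite X" "X \<subseteq> carrier M" using X by (auto simp: is_basis_def)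
  have cl: "coords R M X m y \<in> carrier R" if "m \<in> carrier M" "y \<in> X" for m y
    using coords_basis(1)[OF X that(1)] that(2) by auto
  have add: "coords R M X (m \<oplus>\<^bsub>M\<^esub> n) x = coords R M X m x \<oplus> coords R M X n x"
    if mn: "m \<in> carrier M" "n \<in> carrier M" for m n
  proof -
    have "(\<Oplus>\<^bsub>M\<^esub>y\<in>X. (coords R M X m y \<oplus> coords R M X n y) \<odot>\<^bsub>M\<^esub> y) =
        (\<Oplus>\<^bsub>M\<^esub>y\<in>X. coords R M X m y \<odot>\<^bsub>M\<^esub> y \<oplus>\<^bsub>M\<^esub> coords R M X n y \<odot>\<^bsub>M\<^esub> y)"
      using fin mn by (intro M.finsum_cong') (auto simp: smult_l_distr cl)
    also have "\<dots> = (\<Oplus>\<^bsub>M\<^esub>y\<in>X. coords R M X m y \<odot>\<^bsub>M\<^esub> y) \<oplus>\<^bsub>M\<^esub> (\<Oplus>\<^bsub>M\<^esub>y\<in>X. coords R M X n y \<odot>\<^bsub>M\<^esub> y)"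
      using fin mn cl by (intro M.finsum_addf) auto
    finally show ?thesis
      using mn x by (intro coords_eqI[OF X]) (auto simp: coords_basis(2)[OF X] cl)
  qed
  have smult: "coords R M X (r \<odot>\<^bsub>M\<^esub> m) x = r \<otimes> coords R M X m x"
    if r: "r \<in> carrier R" and m: "m \<in> carrier M" for r m
  proof -
    have "(\<Oplus>\<^bsub>M\<^esub>y\<in>X. (r \<otimes> coords R M X m y) \<odot>\<^bsub>M\<^esub> y) =
        (\<Oplus>\<^bsub>M\<^esub>y\<in>X. r \<odot>\<^bsub>M\<^esub> (coords R M X m y \<odot>\<^bsub>M\<^esub> y))"
      using fin r m by (intro M.finsum_cong') (auto simp: smult_assoc1 cl)
    also have "\<dots> = r \<odot>\<^bsub>M\<^esub> (\<Oplus>\<^bsub>M\<^esub>y\<in>X. coords R M X m y \<odot>\<^bsub>M\<^esub> y)"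
      using fin r m cl by (intro finsum_smult_ldistr[symmetric]) auto
    finally show ?thesis
      using r m x by (intro coords_eqI[OF X]) (auto simp: coords_basis(2)[OF X] cl)
  qed
  show ?thesis
    by (rule linear_mapI[OF left_module_if_module[OF module_axioms]
          left_module_if_module[OF module_regular[OF R.is_cring]]])
      (simp_all add: cl x add smult)
qed

lemma linear_map_expand:
  assumes R: "cring R" and f: "linear_map R M N f" and X: "is_basis R M X" and m: "m \<in> carrier M"
  shows "f m = (\<Oplus>\<^bsub>N\<^esub>x\<in>X. coords R M X m x \<odot>\<^bsub>N\<^esub> f x)"
proof -
  interpret f: linear_map R M N f by fact
  interpret M: module R M using R f.M.left_module_axioms by (rule module_if_left_module)
  have X': "X \<subseteq> carrier M" using X by (simp add: is_basis_def)
  have cl: "coords R M X m x \<in> carrier R" if "x \<in> X" for x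
    using M.coords_basis(1)[OF X m] that by auto
  have "f m = f (\<Oplus>\<^bsub>M\<^esub>x\<in>X. coords R M X m x \<odot>\<^bsub>M\<^esub> x)"
    by (simp only: M.coords_basis(2)[OF X m])
  also have "\<dots> = (\<Oplus>\<^bsub>N\<^esub>x\<in>X. f (coords R M X m x \<odot>\<^bsub>M\<^esub> x))"
    using X' cl by (intro f.map_finsum) auto
  also have "\<dots> = (\<Oplus>\<^bsub>N\<^esub>x\<in>X. coords R M X m x \<odot>\<^bsub>N\<^esub> f x)"
    using X' cl by (intro f.N.M.finsum_cong') (auto simp: f.map_smult f.closed f.N.smult_closed subset_iff)
  finally show ?thesis .
qed

lemma (in module) basis_torsion_free:
  assumes X: "is_basis R M X" and R: "domain R"
    and r: "r \<in> carrier R" "r \<noteq> \<zero>" and m: "m \<in> carrier M" "r \<odot>\<^bsub>M\<^esub> m = \<zero>\<^bsub>M\<^esub>"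
  shows "m = \<zero>\<^bsub>M\<^esub>"
proof -
  interpret R: domain R by fact
  have X': "finite X" "X \<subseteq> carrier M" using X by (auto simp: is_basis_def)
  have "coords R M X m x = \<zero>" if x: "x \<in> X" for x
  proof -
    interpret c: linear_map R M "regular_module R" "\<lambda>m. coords R M X m x"
      by (rule linear_map_coords[OF X x])
    have "r \<otimes> coords R M X m x = \<zero>" using c.map_smult[OF r(1) m(1)] m(2) c.map_zero by simp
    then show ?thesis using R.integral[OF _ r(1)] c.closed[OF m(1)] r(2) by auto
  qed
  then have "(\<Oplus>\<^bsub>M\<^esub>x\<in>X. coords R M X m x \<odot>\<^bsub>M\<^esub> x) = (\<Oplus>\<^bsub>M\<^esub>x\<in>X. \<zero>\<^bsub>M\<^esub>)"
    using X' by (intro M.finsum_cong') auto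
  then show ?thesis using coords_basis(2)[OF X m(1)] by simp
qed

lemma linear_map_rank_one:
  assumes R: "cring R" and f: "linear_map R M (regular_module R) f"
    and N: "left_module R N" and v: "v \<in> carrier N"
  shows "linear_map R M N (\<lambda>u. f u \<odot>\<^bsub>N\<^esub> v)"
proof -
  interpret f: linear_map R M "regular_module R" f by fact
  interpret N: left_module R N by fact
  have fc: "f u \<in> carrier R" if "u \<in> carrier M" for u using f.closed[OF that] by simp
  show ?thesis
    by (rule linear_mapI[OF f.M.left_module_axioms N])
      (simp_all add: fc v N.smult_closed f.map_add f.map_smult N.smult_l_distr N.smult_assoc1)
qed

text \<open>
  The defining basis of \<^const>\<open>linear_trace\<close> is an arbitrary choice; naming it once turns traces into
  finite sums of coordinates.
\<close>

lemma (in module) linear_trace_basis: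
  assumes "free_finite_rank R M"
  obtains X where "is_basis R M X" "X \<subseteq> carrier M" "finite X"
    and "\<And>f. linear_trace R M f = (\<Oplus>x\<in>X. coords R M X (f x) x)"
    and "\<And>m x. \<lbrakk>m \<in> carrier M; x \<in> X\<rbrakk> \<Longrightarrow> coords R M X m x \<in> carrier R"
proof
  let ?X = "SOME X. is_basis R M X"
  show X: "is_basis R M ?X"
    using assms unfolding free_finite_rank_def by (rule someI_ex)
  then show "?X \<subseteq> carrier M" "finite ?X" by (auto simp: is_basis_def)
  show "coords R M ?X m x \<in> carrier R" if "m \<in> carrier M" "x \<in> ?X" for m x
    using coords_basis(1)[OF X that(1)] that(2) by auto
qed (simp add: linear_trace_def Let_def)

context module
begin

lemma linear_trace_cong:
  assumes "free_finite_rank R M" and eq: "\<And>x. x \<in> carrier M \<Longrightarrow> f x = g x"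
    and g: "\<And>x. x \<in> carrier M \<Longrightarrow> g x \<in> carrier M"
  shows "linear_trace R M f = linear_trace R M g"
proof -
  from assms(1) obtain X where X: "is_basis R M X" and X': "X \<subseteq> carrier M" "finite X"
    and tr: "\<And>f. linear_trace R M f = (\<Oplus>x\<in>X. coords R M X (f x) x)"
    and cl: "\<And>m x. \<lbrakk>m \<in> carrier M; x \<in> X\<rbrakk> \<Longrightarrow> coords R M X m x \<in> carrier R"
    by (rule linear_trace_basis) blast
  show ?thesis
    unfolding tr using X' eq g cl by (intro R.finsum_cong') (auto simp: subset_iff)
qed

lemma linear_trace_closed:
  assumes "free_finite_rank R M" and f: "\<And>x. x \<in> carrier M \<Longrightarrow> f x \<in> carrier M"
  shows "linear_trace R M f \<in> carrier R"
proof -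
  from assms(1) obtain X where X: "is_basis R M X" and X': "X \<subseteq> carrier M" "finite X"
    and tr: "\<And>f. linear_trace R M f = (\<Oplus>x\<in>X. coords R M X (f x) x)"
    and cl: "\<And>m x. \<lbrakk>m \<in> carrier M; x \<in> X\<rbrakk> \<Longrightarrow> coords R M X m x \<in> carrier R"
    by (rule linear_trace_basis) blast
  show ?thesis
    unfolding tr using X' f cl by (intro R.finsum_closed) (auto simp: subset_iff)
qed

lemma linear_trace_add:
  assumes "free_finite_rank R M"
    and f: "\<And>x. x \<in> carrier M \<Longrightarrow> f x \<in> carrier M" and g: "\<And>x. x \<in> carrier M \<Longrightarrow> g x \<in> carrier M"
  shows "linear_trace R M (\<lambda>x. f x \<oplus>\<^bsub>M\<^esub> g x) = linear_trace R M f \<oplus> linear_trace R M g"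
proof -
  from assms(1) obtain X where X: "is_basis R M X" and X': "X \<subseteq> carrier M" "finite X"
    and tr: "\<And>f. linear_trace R M f = (\<Oplus>x\<in>X. coords R M X (f x) x)"
    and cl: "\<And>m x. \<lbrakk>m \<in> carrier M; x \<in> X\<rbrakk> \<Longrightarrow> coords R M X m x \<in> carrier R"
    by (rule linear_trace_basis) blast
  have "(\<Oplus>x\<in>X. coords R M X (f x \<oplus>\<^bsub>M\<^esub> g x) x) = (\<Oplus>x\<in>X. coords R M X (f x) x \<oplus> coords R M X (g x) x)"
    using X' f g cl linear_map.map_add[OF linear_map_coords[OF X]]
    by (intro R.finsum_cong') (auto simp: subset_iff)
  also have "\<dots> = (\<Oplus>x\<in>X. coords R M X (f x) x) \<oplus> (\<Oplus>x\<in>X. coords R M X (g x) x)"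
    using X' f g cl by (intro R.finsum_addf) (auto simp: subset_iff)
  finally show ?thesis by (simp add: tr)
qed

lemma linear_trace_smult:
  assumes "free_finite_rank R M" and r: "r \<in> carrier R"
    and f: "\<And>x. x \<in> carrier M \<Longrightarrow> f x \<in> carrier M"
  shows "linear_trace R M (\<lambda>x. r \<odot>\<^bsub>M\<^esub> f x) = r \<otimes> linear_trace R M f"
proof -
  from assms(1) obtain X where X: "is_basis R M X" and X': "X \<subseteq> carrier M" "finite X"
    and tr: "\<And>f. linear_trace R M f = (\<Oplus>x\<in>X. coords R M X (f x) x)"
    and cl: "\<And>m x. \<lbrakk>m \<in> carrier M; x \<in> X\<rbrakk> \<Longrightarrow> coords R M X m x \<in> carrier R"
    by (rule linear_trace_basis) blast
  have "(\<Oplus>x\<in>X. coords R M X (r \<odot>\<^bsub>M\<^esub> f x) x) = (\<Oplus>x\<in>X. r \<otimes> coords R M X (f x) x)"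
    using X' r f cl linear_map.map_smult[OF linear_map_coords[OF X]]
    by (intro R.finsum_cong') (auto simp: subset_iff)
  also have "\<dots> = r \<otimes> (\<Oplus>x\<in>X. coords R M X (f x) x)"
    using X' r f cl by (intro R.finsum_rdistr[symmetric]) (auto simp: subset_iff)
  finally show ?thesis by (simp add: tr)
qed

lemma linear_trace_finsum:
  assumes M: "free_finite_rank R M" and I: "finite I"
    and f: "\<And>i x. \<lbrakk>i \<in> I; x \<in> carrier M\<rbrakk> \<Longrightarrow> f i x \<in> carrier M"
  shows "linear_trace R M (\<lambda>x. \<Oplus>\<^bsub>M\<^esub>i\<in>I. f i x) = (\<Oplus>i\<in>I. linear_trace R M (f i))"
  using I f
proof (induct I)
  case empty
  have "linear_trace R M (\<lambda>x. \<zero>\<^bsub>M\<^esub>) = linear_trace R M (\<lambda>x. \<zero> \<odot>\<^bsub>M\<^esub> x)"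
    by (rule linear_trace_cong[OF M]) auto
  also have "\<dots> = \<zero>"
    using linear_trace_closed[OF M, of "\<lambda>x. x"] by (simp add: linear_trace_smult[OF M])
  finally show ?case by simp
next
  case (insert i I)
  have "linear_trace R M (\<lambda>x. \<Oplus>\<^bsub>M\<^esub>j\<in>insert i I. f j x) = linear_trace R M (\<lambda>x. f i x \<oplus>\<^bsub>M\<^esub> (\<Oplus>\<^bsub>M\<^esub>j\<in>I. f j x))"
    using insert by (intro linear_trace_cong[OF M] M.a_closed M.finsum_closed M.finsum_insert) auto
  also have "\<dots> = linear_trace R M (f i) \<oplus> (\<Oplus>j\<in>I. linear_trace R M (f j))"
    using insert by (subst linear_trace_add[OF M]) (auto intro!: M.finsum_closed)
  also have "\<dots> = (\<Oplus>j\<in>insert i I. linear_trace R M (f j))"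
    using insert by (intro R.finsum_insert[symmetric]) (auto intro!: linear_trace_closed[OF M])
  finally show ?case .
qed

text \<open>
  With \<open>u = \<Sum> c x x\<close>, the diagonal coefficients \<open>\<phi> x c x\<close> of the map add up to \<open>\<phi> u\<close>. Maps of this form
  are the test maps with which traces are evaluated and coordinates are recovered from traces.
\<close>

lemma linear_trace_rank_one:
  assumes M: "free_finite_rank R M" and \<phi>: "linear_map R M (regular_module R) \<phi>" and u: "u \<in> carrier M"
  shows "linear_trace R M (\<lambda>x. \<phi> x \<odot>\<^bsub>M\<^esub> u) = \<phi> u"
proof -
  interpret \<phi>: linear_map R M "regular_module R" \<phi> by fact
  from assms(1) obtain X where X: "is_basis R M X" and X': "X \<subseteq> carrier M" "finite X"
    and tr: "\<And>f. linear_trace R M f = (\<Oplus>x\<in>X. coords R M X (f x) x)"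
    and cl: "\<And>m x. \<lbrakk>m \<in> carrier M; x \<in> X\<rbrakk> \<Longrightarrow> coords R M X m x \<in> carrier R"
    by (rule linear_trace_basis) blast
  have \<phi>': "\<phi> x \<in> carrier R" if "x \<in> carrier M" for x using \<phi>.closed[OF that] by simp
  have "(\<Oplus>x\<in>X. coords R M X (\<phi> x \<odot>\<^bsub>M\<^esub> u) x) = (\<Oplus>x\<in>X. \<phi> (coords R M X u x \<odot>\<^bsub>M\<^esub> x))"
  proof (intro R.finsum_cong')
    fix x assume x: "x \<in> X"
    interpret c: linear_map R M "regular_module R" "\<lambda>m. coords R M X m x"
      by (rule linear_map_coords[OF X x])
    show "coords R M X (\<phi> x \<odot>\<^bsub>M\<^esub> u) x = \<phi> (coords R M X u x \<odot>\<^bsub>M\<^esub> x)"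
      using x X' u by (auto simp: c.map_smult \<phi>' \<phi>.map_smult cl R.m_comm subset_iff)
  qed (use X' u cl \<phi>' in auto)
  also have "\<dots> = \<phi> (\<Oplus>\<^bsub>M\<^esub>x\<in>X. coords R M X u x \<odot>\<^bsub>M\<^esub> x)"
    using X' u cl by (subst \<phi>.map_finsum) auto
  finally show ?thesis by (simp add: tr coords_basis(2)[OF X u])
qed

end

text \<open>
  Expanding \<open>f u\<close> in a basis of \<open>N\<close> writes \<open>g \<circ> f\<close> as a sum of maps of rank one, whose traces are the
  diagonal coefficients of \<open>f \<circ> g\<close>.
\<close>

lemma linear_trace_commute:
  assumes R: "cring R" and M: "free_finite_rank R M" and N: "free_finite_rank R N"
    and f: "linear_map R M N f" and g: "linear_map R N M g"
  shows "linear_trace R M (\<lambda>x. g (f x)) = linear_trace R N (\<lambda>y. f (g y))"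
proof -
  interpret f: linear_map R M N f by fact
  interpret g: linear_map R N M g by fact
  interpret M: module R M using R f.M.left_module_axioms by (rule module_if_left_module)
  interpret N: module R N using R f.N.left_module_axioms by (rule module_if_left_module)
  from N obtain X where X: "is_basis R N X" and X': "X \<subseteq> carrier N" "finite X"
    and tr: "\<And>f. linear_trace R N f = (\<Oplus>\<^bsub>R\<^esub>x\<in>X. coords R N X (f x) x)"
    and cl: "\<And>m x. \<lbrakk>m \<in> carrier N; x \<in> X\<rbrakk> \<Longrightarrow> coords R N X m x \<in> carrier R"
    by (rule N.linear_trace_basis) blast
  have "g (f u) = (\<Oplus>\<^bsub>M\<^esub>x\<in>X. coords R N X (f u) x \<odot>\<^bsub>M\<^esub> g x)" if u: "u \<in> carrier M" for u
    by (rule linear_map_expand[OF R g X f.closed[OF u]])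
  then have "linear_trace R M (\<lambda>u. g (f u)) =
      linear_trace R M (\<lambda>u. \<Oplus>\<^bsub>M\<^esub>x\<in>X. coords R N X (f u) x \<odot>\<^bsub>M\<^esub> g x)"
    using X' by (intro M.linear_trace_cong[OF M] f.M.M.finsum_closed) (auto simp: cl f.closed g.closed subset_iff)
  also have "\<dots> = (\<Oplus>\<^bsub>R\<^esub>x\<in>X. linear_trace R M (\<lambda>u. coords R N X (f u) x \<odot>\<^bsub>M\<^esub> g x))"
    using X' by (intro M.linear_trace_finsum[OF M]) (auto simp: cl f.closed g.closed subset_iff)
  also have "\<dots> = (\<Oplus>\<^bsub>R\<^esub>x\<in>X. coords R N X (f (g x)) x)"
  proof (rule f.M.A.finsum_cong')
    fix x assume x: "x \<in> X"
    show "linear_trace R M (\<lambda>u. coords R N X (f u) x \<odot>\<^bsub>M\<^esub> g x) = coords R N X (f (g x)) x"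
      using x X' by (intro M.linear_trace_rank_one[OF M] linear_map_comp[OF f N.linear_map_coords[OF X x]])
        (auto intro: g.closed)
  qed (use X' in \<open>auto simp: cl f.closed g.closed subset_iff\<close>)
  finally show ?thesis by (simp add: tr)
qed

section \<open>Extending functionals from pure sublattices\<close>

lemma (in cring) exists_member_dividing_family:
  assumes total: "\<And>a b. \<lbrakk>a \<in> carrier R; b \<in> carrier R\<rbrakk> \<Longrightarrow> a divides b \<or> b divides a"
    and "finite I" "I \<noteq> {}" and a: "\<And>i. i \<in> I \<Longrightarrow> a i \<in> carrier R"
  shows "\<exists>j\<in>I. \<forall>i\<in>I. a j divides a i"
  using assms(2,3) a
proof (induct I rule: finite_ne_induct)
  case (singleton i)
  then show ?case by simp
next
  case (insert i I)
  then obtain j where j: "j \<in> I" "\<And>k. k \<in> I \<Longrightarrow> a j divides a k" by auto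
  show ?case
  proof (cases "a j divides a i")
    case True
    with j show ?thesis by auto
  next
    case False
    then have "a i divides a j" using total insert(5) j(1) by blast
    then have "a i divides a k" if "k \<in> I" for k
      using j(2)[OF that] divides_trans insert(5) by blast
    then show ?thesis using insert(5) by auto
  qed
qed

text \<open>
  The proof splits off one coordinate at a time. As divisibility is total, some coordinate of a nonzero
  vector divides all its other coordinates; by purity the vector can be divided by it, which gives a vector \<open>y\<close> with one
  coordinate equal to \<open>1\<close>. The vectors whose coordinate at that place is \<open>0\<close> form a pure complement of
  \<open>y\<close> with one coordinate less, and the coefficient of the removed coordinate is then determined by the
  value at \<open>y\<close>.
\<close>

lemma (in module) functional_eq_combination_of_coordinates:
  assumes R: "domain R"
    and total: "\<And>a b. \<lbrakk>a \<in> carrier R; b \<in> carrier R\<rbrakk> \<Longrightarrow> a divides b \<or> b divides a"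
    and \<phi>: "linear_map R M (regular_module R) \<phi>"
    and "finite I" and e: "\<And>i. i \<in> I \<Longrightarrow> linear_map R M (regular_module R) (e i)"
    and S: "submodule S R M"
    and sep: "\<And>x. \<lbrakk>x \<in> S; \<And>i. i \<in> I \<Longrightarrow> e i x = \<zero>\<rbrakk> \<Longrightarrow> x = \<zero>\<^bsub>M\<^esub>"
    and pure: "\<And>r x. \<lbrakk>r \<in> carrier R; r \<noteq> \<zero>; x \<in> S; \<And>i. i \<in> I \<Longrightarrow> r divides e i x\<rbrakk> \<Longrightarrow>
      \<exists>y\<in>S. x = r \<odot>\<^bsub>M\<^esub> y"
  shows "\<exists>c\<in>I \<rightarrow> carrier R. \<forall>x\<in>S. \<phi> x = (\<Oplus>i\<in>I. c i \<otimes> e i x)"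
  using assms(4-)
proof (induct "card I" arbitrary: I S rule: less_induct)
  case less
  interpret R: domain R by fact
  interpret \<phi>: linear_map R M "regular_module R" \<phi> by fact
  note e = less.prems(2) and S = submoduleE[OF less.prems(3)] and sep = less.prems(4) and pure = less.prems(5)
  have ec: "e i x \<in> carrier R" if "i \<in> I" "x \<in> carrier M" for i x
    using linear_map.closed[OF e[OF that(1)] that(2)] by simp
  show ?case
  proof (cases "\<forall>x\<in>S. \<forall>i\<in>I. e i x = \<zero>")
    case True
    then have "x = \<zero>\<^bsub>M\<^esub>" if "x \<in> S" for x using sep that by blast
    then have "\<phi> x = (\<Oplus>i\<in>I. \<zero> \<otimes> e i x)" if "x \<in> S" for x
    proof -
      assume zero: "\<And>x. x \<in> S \<Longrightarrow> x = \<zero>\<^bsub>M\<^esub>"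
      have "(\<Oplus>i\<in>I. \<zero> \<otimes> e i x) = (\<Oplus>i\<in>I. \<zero>)"
        using that S(1) ec by (intro R.finsum_cong') auto
      then show ?thesis using zero[OF that] \<phi>.map_zero by simp
    qed
    then show ?thesis by (intro bexI[of _ "\<lambda>_. \<zero>"]) auto
  next
    case False
    then obtain x i where x: "x \<in> S" "i \<in> I" "e i x \<noteq> \<zero>" by blast
    have xM: "x \<in> carrier M" using x S(1) by blast
    obtain j where j: "j \<in> I" "\<And>i. i \<in> I \<Longrightarrow> e j x divides e i x"
      using R.exists_member_dividing_family[OF total less.prems(1), of "\<lambda>i. e i x"] ec xM x(2) by blast
    interpret ej: linear_map R M "regular_module R" "e j" by (rule e[OF j(1)])
    have ejx: "e j x \<in> carrier R" "e j x \<noteq> \<zero>"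
      using ec[OF j(1) xM] j(2)[OF x(2)] x(3) by (auto simp: factor_def)
    then obtain y where y: "y \<in> S" "x = e j x \<odot>\<^bsub>M\<^esub> y" using pure[OF _ _ x(1) j(2)] by blast
    have yM: "y \<in> carrier M" using y S(1) by blast
    have "e j x \<otimes> e j y = e j x \<otimes> \<one>"
      using ej.map_smult[OF ejx(1) yM] y(2) ejx(1) by simp
    then have ejy: "e j y = \<one>" using R.m_lcancel[OF ejx(2,1) ec[OF j(1) yM] R.one_closed] by blast
    define S' where "S' = {x \<in> S. e j x = \<zero>}"
    have S': "submodule S' R M"
      using S(1) submodule_zero_closed[OF less.prems(3)] ej.map_zero
      by (intro submoduleI)
        (auto simp: S'_def S(3-5) subset_iff ej.map_minus ej.map_add ej.map_smult)
    have "\<exists>c\<in>I - {j} \<rightarrow> carrier R. \<forall>x\<in>S'. \<phi> x = (\<Oplus>i\<in>I - {j}. c i \<otimes> e i x)"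
    proof (rule less.hyps)
      show "card (I - {j}) < card I" using less.prems(1) j(1) by (rule card_Diff1_less)
      show "finite (I - {j})" using less.prems(1) by simp
      show "linear_map R M (regular_module R) (e i)" if "i \<in> I - {j}" for i using that e by blast
      show "submodule S' R M" by (rule S')
      show "x = \<zero>\<^bsub>M\<^esub>" if "x \<in> S'" "\<And>i. i \<in> I - {j} \<Longrightarrow> e i x = \<zero>" for x
        using that by (intro sep) (auto simp: S'_def)
      show "\<exists>z\<in>S'. v = r \<odot>\<^bsub>M\<^esub> z"
        if r: "r \<in> carrier R" "r \<noteq> \<zero>" and v: "v \<in> S'" and dv: "\<And>i. i \<in> I - {j} \<Longrightarrow> r divides e i v" for r v
      proof -
        have "r divides e i v" if "i \<in> I" for i
        proof (cases "i = j")
          case True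
          then show ?thesis using v r(1) by (intro dividesI[of \<zero>]) (auto simp: S'_def)
        next
          case False
          then show ?thesis using dv that by blast
        qed
        then obtain z where z: "z \<in> S" "v = r \<odot>\<^bsub>M\<^esub> z" using pure[OF r, of v] v by (auto simp: S'_def)
        have zM: "z \<in> carrier M" using z S(1) by blast
        have "r \<otimes> e j z = \<zero>" using ej.map_smult[OF r(1) zM] v z by (auto simp: S'_def)
        then have "e j z = \<zero>" using R.integral[OF _ r(1) ec[OF j(1) zM]] r(2) by blast
        then show ?thesis using z by (auto simp: S'_def)
      qed
    qed
    then obtain c where c: "c \<in> I - {j} \<rightarrow> carrier R"
      "\<And>x. x \<in> S' \<Longrightarrow> \<phi> x = (\<Oplus>i\<in>I - {j}. c i \<otimes> e i x)" by blast
    define L where "L = (\<lambda>x. \<Oplus>i\<in>I - {j}. c i \<otimes> e i x)"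
    have reg: "left_module R (regular_module R)" "left_module R M"
      using module_regular[OF R.is_cring] module_axioms by (auto intro: left_module_if_module)
    have "linear_map R M (regular_module R) (\<lambda>x. c i \<otimes> e i x)" if "i \<in> I - {j}" for i
      using linear_map_smult[OF R.is_cring e, of i "c i"] that c(1) by auto
    then interpret L: linear_map R M "regular_module R" L
      unfolding L_def using linear_map_finsum[OF reg(2,1), of "I - {j}" "\<lambda>i x. c i \<otimes> e i x"] by simp
    define c' where "c' = c(j := \<phi> y \<ominus> L y)"
    have Ly: "L y \<in> carrier R" "\<phi> y \<in> carrier R" using L.closed[OF yM] \<phi>.closed[OF yM] by auto
    have c': "c' \<in> I \<rightarrow> carrier R" using c(1) Ly by (auto simp: c'_def)
    have c'e: "c' i \<otimes> e i v \<in> carrier R" if "i \<in> I" "v \<in> carrier M" for i v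
      using funcset_mem[OF c' that(1)] ec[OF that] by simp
    have "\<phi> v = (\<Oplus>i\<in>I. c' i \<otimes> e i v)" if v: "v \<in> S" for v
    proof -
      have vM: "v \<in> carrier M" using v S(1) by blast
      have cl: "e j v \<in> carrier R" "L v \<in> carrier R" "\<phi> v \<in> carrier R"
        using ec[OF j(1) vM] L.closed[OF vM] \<phi>.closed[OF vM] by auto
      \<comment> \<open>the component of \<open>v\<close> in the complement of \<open>y\<close>\<close>
      let ?w = "v \<oplus>\<^bsub>M\<^esub> (\<ominus> e j v) \<odot>\<^bsub>M\<^esub> y"
      have "?w \<in> S" using v y S(4,5) cl by simp
      moreover have "e j ?w = \<zero>"
        using vM yM cl ejy by (simp add: ej.map_add ej.map_smult R.r_neg)
      ultimately have "\<phi> ?w = L ?w" using c(2) by (simp add: S'_def L_def)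
      then have "\<phi> v \<oplus> (\<ominus> e j v) \<otimes> \<phi> y = L v \<oplus> (\<ominus> e j v) \<otimes> L y"
        using vM yM cl by (simp add: \<phi>.map_add \<phi>.map_smult L.map_add L.map_smult)
      moreover have "\<phi> v = (\<phi> v \<oplus> (\<ominus> e j v) \<otimes> \<phi> y) \<oplus> e j v \<otimes> \<phi> y"
        using cl Ly by algebra
      moreover have "(L v \<oplus> (\<ominus> e j v) \<otimes> L y) \<oplus> e j v \<otimes> \<phi> y = (\<phi> y \<ominus> L y) \<otimes> e j v \<oplus> L v"
        using cl Ly by algebra
      ultimately have "\<phi> v = (\<phi> y \<ominus> L y) \<otimes> e j v \<oplus> L v" by simp
      also have "L v = (\<Oplus>i\<in>I - {j}. c' i \<otimes> e i v)"
        unfolding L_def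
      proof (rule R.finsum_cong')
        show "(\<lambda>i. c' i \<otimes> e i v) \<in> I - {j} \<rightarrow> carrier R" using c'e vM by blast
      qed (auto simp: c'_def)
      also have "(\<phi> y \<ominus> L y) \<otimes> e j v \<oplus> \<dots> = (\<Oplus>i\<in>insert j (I - {j}). c' i \<otimes> e i v)"
      proof (subst R.finsum_insert)
        show "c' j \<otimes> e j v \<in> carrier R" using c'e[OF j(1) vM] .
        show "(\<lambda>i. c' i \<otimes> e i v) \<in> I - {j} \<rightarrow> carrier R" using c'e vM by blast
      qed (use less.prems(1) in \<open>auto simp: c'_def\<close>)
      also have "insert j (I - {j}) = I" using j(1) by blast
      finally show ?thesis .
    qed
    with c' show ?thesis by blast
  qed
qed

section \<open>Divisibility in a discrete valuation ring\<close>

context complete_dvr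
begin

text \<open>
  An irreducible divisor generates a maximal ideal, and there is only one.
\<close>

lemma mem_maximal_if_not_unit:
  assumes "a \<in> carrier R" "a \<notin> Units R"
  shows "a \<in> PIdl \<pi>"
proof (cases "a = \<zero>")
  case True
  interpret J: maximalideal "PIdl \<pi>" R by (rule uniformizer)
  show ?thesis using True J.zero_closed by simp
next
  case False
  then obtain q where q: "q \<in> carrier R" "ring_irreducible q" "q divides a"
    using exists_irreducible_divisor assms by blast
  have "PIdl q = PIdl \<pi>"
    using unique_maximal irreducible_imp_maximalideal[OF q(1,2)] uniformizer by blast
  moreover have "a \<in> PIdl q" using q assms by (auto simp: factor_def cgenideal_def m_comm)
  ultimately show ?thesis by simp
qed

text \<open>
  After division by a greatest common divisor, \<open>1\<close> is a combination of the two elements, so they do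
  not both lie in the only maximal ideal and one of them is a unit.
\<close>

lemma divides_total:
  assumes a: "a \<in> carrier R" and b: "b \<in> carrier R"
  shows "a divides b \<or> b divides a"
proof -
  interpret J: maximalideal "PIdl \<pi>" R by (rule uniformizer)
  have "ideal (PIdl a <+>\<^bsub>R\<^esub> PIdl b) R"
    using a b by (intro add_ideals cgenideal_ideal)
  then obtain g where g: "g \<in> carrier R" "PIdl a <+>\<^bsub>R\<^esub> PIdl b = PIdl g"
    using exists_gen by blast
  then have "g gcdof a b" using ideal_sum_iff_gcd[OF a b] by blast
  then have "g divides a" "g divides b" by (auto simp: isgcd_def)
  then obtain a' b' where ab: "a' \<in> carrier R" "b' \<in> carrier R" "a = g \<otimes> a'" "b = g \<otimes> b'"
    by (auto simp: factor_def)
  have "g \<in> PIdl a <+>\<^bsub>R\<^esub> PIdl b" using g cgenideal_self by simp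
  then obtain u v where uv: "u \<in> PIdl a" "v \<in> PIdl b" "g = u \<oplus> v"
    unfolding set_add_def' by blast
  from uv(1) obtain r where r: "r \<in> carrier R" "u = r \<otimes> a" unfolding cgenideal_def by blast
  from uv(2) obtain s where s: "s \<in> carrier R" "v = s \<otimes> b" unfolding cgenideal_def by blast
  have rs: "r \<in> carrier R" "s \<in> carrier R" "g = r \<otimes> a \<oplus> s \<otimes> b" using r s uv(3) by simp_all
  show ?thesis
  proof (cases "g = \<zero>")
    case True
    then have "a = \<zero>" using ab by simp
    then have "b divides a" using b by (intro dividesI[of \<zero>]) auto
    then show ?thesis ..
  next
    case False
    have "g \<otimes> (r \<otimes> a' \<oplus> s \<otimes> b') = g \<otimes> \<one>"
    proof -
      have "g \<otimes> (r \<otimes> a' \<oplus> s \<otimes> b') = r \<otimes> (g \<otimes> a') \<oplus> s \<otimes> (g \<otimes> b')"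
        using g ab(1,2) rs(1,2) by algebra
      also have "\<dots> = r \<otimes> a \<oplus> s \<otimes> b" by (simp only: ab(3,4)[symmetric])
      also have "\<dots> = g \<otimes> \<one>" by (simp only: rs(3)[symmetric] r_one[OF g(1)])
      finally show ?thesis .
    qed
    then have one: "r \<otimes> a' \<oplus> s \<otimes> b' = \<one>" 
      using m_lcancel[OF False g(1), of "r \<otimes> a' \<oplus> s \<otimes> b'" \<one>] ab(1,2) rs(1,2) by blast
    have "a' \<in> Units R \<or> b' \<in> Units R"
    proof (rule ccontr)
      assume "\<not> ?thesis"
      then have "a' \<in> PIdl \<pi>" "b' \<in> PIdl \<pi>" using ab mem_maximal_if_not_unit by auto
      then have "r \<otimes> a' \<oplus> s \<otimes> b' \<in> PIdl \<pi>"
        using rs(1,2) by (intro J.a_closed J.I_l_closed)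
      then have "\<one> \<in> PIdl \<pi>" using one by simp
      then show False using J.one_imp_carrier J.I_notcarr by auto
    qed
    then show ?thesis
    proof
      assume u: "a' \<in> Units R"
      have "b = a \<otimes> (inv a' \<otimes> b')"
        using ab(1,2) g(1) u Units_r_inv[OF u] Units_inv_closed[OF u]
        by (metis ab(3,4) m_assoc m_closed r_one)
      then have "a divides b" using u ab by (intro dividesI[of "inv a' \<otimes> b'"]) auto
      then show ?thesis ..
    next
      assume u: "b' \<in> Units R"
      have "a = b \<otimes> (inv b' \<otimes> a')"
        using ab(1,2) g(1) u Units_r_inv[OF u] Units_inv_closed[OF u]
        by (metis ab(3,4) m_assoc m_closed r_one)
      then have "b divides a" using u ab by (intro dividesI[of "inv b' \<otimes> a'"]) auto
      then show ?thesis ..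
    qed
  qed
qed

lemma uniformizer_power_nonzero: "\<pi> [^] (n::nat) \<noteq> \<zero>"
proof -
  have "\<pi> \<noteq> \<zero>"
  proof
    assume "\<pi> = \<zero>"
    moreover have "PIdl \<zero> = {\<zero>}" unfolding cgenideal_def by (auto intro!: exI[of _ \<zero>])
    ultimately have "maximalideal {\<zero>} R" using uniformizer by simp
    then show False using not_field zeromaximalideal_fieldI by blast
  qed
  then show ?thesis using uniformizer_closed by (induct n) (auto simp: integral_iff)
qed

end

section \<open>Symmetric algebras and relative traces\<close>

lemma (in abelian_monoid) finsum_commute:
  assumes "finite A" "finite B" and f: "\<And>x y. \<lbrakk>x \<in> A; y \<in> B\<rbrakk> \<Longrightarrow> f x y \<in> carrier G"
  shows "(\<Oplus>x\<in>A. \<Oplus>y\<in>B. f x y) = (\<Oplus>y\<in>B. \<Oplus>x\<in>A. f x y)"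
  using assms(1) f
proof (induct A)
  case empty
  then show ?case by simp
next
  case (insert x A)
  have "(\<Oplus>y\<in>B. \<Oplus>x'\<in>insert x A. f x' y) = (\<Oplus>y\<in>B. f x y \<oplus> (\<Oplus>x'\<in>A. f x' y))"
    using insert by (intro finsum_cong') (auto simp: finsum_insert Pi_def intro!: finsum_closed)
  also have "\<dots> = (\<Oplus>y\<in>B. f x y) \<oplus> (\<Oplus>y\<in>B. \<Oplus>x'\<in>A. f x' y)"
    using insert by (intro finsum_addf) (auto intro!: finsum_closed)
  finally show ?case
    using insert by (subst finsum_insert) (auto intro!: finsum_closed)
qed

lemma restrict_scalars_simps [simp]:
  "carrier (restrict_scalars A U) = carrier U" "add (restrict_scalars A U) = add U"
  "zero (restrict_scalars A U) = \<zero>\<^bsub>U\<^esub>"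
  "r \<odot>\<^bsub>restrict_scalars A U\<^esub> u = (r \<odot>\<^bsub>A\<^esub> \<one>\<^bsub>A\<^esub>) \<odot>\<^bsub>U\<^esub> u"
  by (simp_all add: restrict_scalars_def)

lemma restrict_scalars_finsum [simp]: "finsum (restrict_scalars A U) = finsum U"
  by (rule finsum_cong_record) simp_all

text \<open>
  Restriction of scalars takes records without further fields, which fixes the type of \<open>A\<close> here.
\<close>

locale record_algebra = assoc_algebra R A
  for R :: "'r ring" and A :: "('r, 'a) module"
begin

lemma scalar_mult: "\<lbrakk>r \<in> carrier R; a \<in> carrier A\<rbrakk> \<Longrightarrow> (r \<odot>\<^bsub>A\<^esub> \<one>\<^bsub>A\<^esub>) \<otimes>\<^bsub>A\<^esub> a = r \<odot>\<^bsub>A\<^esub> a"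
  using smult_mult_left[of r "\<one>\<^bsub>A\<^esub>" a] by simp

lemma mult_scalar: "\<lbrakk>r \<in> carrier R; a \<in> carrier A\<rbrakk> \<Longrightarrow> a \<otimes>\<^bsub>A\<^esub> (r \<odot>\<^bsub>A\<^esub> \<one>\<^bsub>A\<^esub>) = r \<odot>\<^bsub>A\<^esub> a"
  using smult_mult_right[of r a "\<one>\<^bsub>A\<^esub>"] by simp

lemma module_restrict_scalars:
  assumes "left_module A U"
  shows "module R (restrict_scalars A U)"
proof -
  interpret U: left_module A U by fact
  have "abelian_group (restrict_scalars A U)"
    using U.M.abelian_group_axioms by (rule abelian_group_cong_record) simp_all
  then show ?thesis
    by (rule moduleI[OF R.is_cring])
      (simp_all add: U.smult_closed smult_l_distr U.smult_l_distr U.smult_r_distr U.smult_one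
        U.smult_assoc1[symmetric] scalar_mult smult_assoc1)
qed

lemma left_module_restrict_scalars:
  "left_module A U \<Longrightarrow> left_module R (restrict_scalars A U)"
  by (rule left_module_if_module[OF module_restrict_scalars])

lemma linear_map_restrict_scalars:
  assumes "linear_map A U V f"
  shows "linear_map R (restrict_scalars A U) (restrict_scalars A V) f"
proof -
  interpret f: linear_map A U V f by fact
  show ?thesis
    by (rule linear_mapI[OF left_module_restrict_scalars[OF f.M.left_module_axioms]
          left_module_restrict_scalars[OF f.N.left_module_axioms]])
      (simp_all add: f.closed f.map_add f.map_smult)
qed

lemma linear_map_action:
  assumes "left_module A U" and a: "a \<in> carrier A"
  shows "linear_map R (restrict_scalars A U) (restrict_scalars A U) (\<lambda>u. a \<odot>\<^bsub>U\<^esub> u)"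
proof -
  interpret U: left_module A U by fact
  show ?thesis
    by (rule linear_mapI[OF left_module_restrict_scalars left_module_restrict_scalars,
          OF U.left_module_axioms U.left_module_axioms])
      (simp_all add: a U.smult_closed U.smult_r_distr U.smult_assoc1[symmetric] mult_scalar scalar_mult)
qed

end

text \<open>
  Non-degeneracy is stated for the right factor of a product, as the expansion of elements in the dual
  basis uses it.
\<close>

locale dual_bases_algebra = record_algebra R A
  for R :: "'r ring" and A :: "('r, 'a) module" +
  fixes s :: "'a \<Rightarrow> 'r" and X :: "'a set" and d :: "'a \<Rightarrow> 'a"
  assumes basis: "is_basis R A X"
    and form_linear: "linear_map R A (regular_module R) s"
    and form_nondegenerate:
      "\<lbrakk>a \<in> carrier A; \<And>c. c \<in> carrier A \<Longrightarrow> s (c \<otimes>\<^bsub>A\<^esub> a) = \<zero>\<^bsub>R\<^esub>\<rbrakk> \<Longrightarrow> a = \<zero>\<^bsub>A\<^esub>"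
    and dual_closed: "x \<in> X \<Longrightarrow> d x \<in> carrier A"
    and dual: "\<lbrakk>x \<in> X; y \<in> X\<rbrakk> \<Longrightarrow> s (x \<otimes>\<^bsub>A\<^esub> d y) = (if x = y then \<one>\<^bsub>R\<^esub> else \<zero>\<^bsub>R\<^esub>)"
begin

sublocale form: linear_map R A "regular_module R" s
  by (rule form_linear)

lemma finite_basis: "finite X"
  and basis_closed: "x \<in> X \<Longrightarrow> x \<in> carrier A"
  using basis by (auto simp: is_basis_def)

lemma form_closed: "a \<in> carrier A \<Longrightarrow> s a \<in> carrier R"
  using form.closed by simp

lemma finsum_kronecker:
  assumes "y \<in> X" and f: "\<And>x. x \<in> X \<Longrightarrow> f x \<in> carrier R"
  shows "(\<Oplus>\<^bsub>R\<^esub>x\<in>X. f x \<otimes>\<^bsub>R\<^esub> (if x = y then \<one>\<^bsub>R\<^esub> else \<zero>\<^bsub>R\<^esub>)) = f y"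
proof -
  have "(\<Oplus>\<^bsub>R\<^esub>x\<in>X. f x \<otimes>\<^bsub>R\<^esub> (if x = y then \<one>\<^bsub>R\<^esub> else \<zero>\<^bsub>R\<^esub>)) = (\<Oplus>\<^bsub>R\<^esub>x\<in>X. if y = x then f x else \<zero>\<^bsub>R\<^esub>)"
    using f by (intro R.finsum_cong') auto
  also have "\<dots> = f y" using assms finite_basis by (intro R.add.finprod_singleton) auto
  finally show ?thesis .
qed

lemma expand_basis:
  assumes a: "a \<in> carrier A"
  shows "(\<Oplus>\<^bsub>A\<^esub>y\<in>X. s (a \<otimes>\<^bsub>A\<^esub> d y) \<odot>\<^bsub>A\<^esub> y) = a"
proof -
  let ?c = "coords R A X a"
  have c: "?c x \<in> carrier R" if "x \<in> X" for x using coords_basis(1)[OF basis a] that by auto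
  have "s (a \<otimes>\<^bsub>A\<^esub> d y) = ?c y" if y: "y \<in> X" for y
  proof -
    have "a \<otimes>\<^bsub>A\<^esub> d y = (\<Oplus>\<^bsub>A\<^esub>x\<in>X. ?c x \<odot>\<^bsub>A\<^esub> x) \<otimes>\<^bsub>A\<^esub> d y"
      by (simp only: coords_basis(2)[OF basis a])
    also have "\<dots> = (\<Oplus>\<^bsub>A\<^esub>x\<in>X. (?c x \<odot>\<^bsub>A\<^esub> x) \<otimes>\<^bsub>A\<^esub> d y)"
      using finite_basis c y by (intro A.finsum_ldistr) (auto simp: basis_closed dual_closed)
    finally have "s (a \<otimes>\<^bsub>A\<^esub> d y) = (\<Oplus>\<^bsub>R\<^esub>x\<in>X. s ((?c x \<odot>\<^bsub>A\<^esub> x) \<otimes>\<^bsub>A\<^esub> d y))"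
      using c y by (simp add: form.map_finsum basis_closed dual_closed)
    also have "\<dots> = (\<Oplus>\<^bsub>R\<^esub>x\<in>X. ?c x \<otimes>\<^bsub>R\<^esub> (if x = y then \<one>\<^bsub>R\<^esub> else \<zero>\<^bsub>R\<^esub>))"
      using c y by (intro R.finsum_cong')
        (auto simp: smult_mult_left basis_closed dual_closed form.map_smult dual)
    also have "\<dots> = ?c y" using y c by (rule finsum_kronecker)
    finally show ?thesis .
  qed
  then have "(\<Oplus>\<^bsub>A\<^esub>y\<in>X. s (a \<otimes>\<^bsub>A\<^esub> d y) \<odot>\<^bsub>A\<^esub> y) = (\<Oplus>\<^bsub>A\<^esub>y\<in>X. ?c y \<odot>\<^bsub>A\<^esub> y)"
    using c by (intro M.finsum_cong') (auto simp: basis_closed)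
  then show ?thesis by (simp only: coords_basis(2)[OF basis a])
qed

text \<open>
  Both sides have the same values under \<open>s (y \<otimes> _)\<close> for basis elements \<open>y\<close>, hence under \<open>s (c \<otimes> _)\<close> for
  all \<open>c\<close>, and the form is non-degenerate.
\<close>

lemma expand_dual_basis:
  assumes a: "a \<in> carrier A"
  shows "(\<Oplus>\<^bsub>A\<^esub>x\<in>X. s (x \<otimes>\<^bsub>A\<^esub> a) \<odot>\<^bsub>A\<^esub> d x) = a"
proof -
  let ?b = "\<Oplus>\<^bsub>A\<^esub>x\<in>X. s (x \<otimes>\<^bsub>A\<^esub> a) \<odot>\<^bsub>A\<^esub> d x"
  have cl: "s (x \<otimes>\<^bsub>A\<^esub> a) \<in> carrier R" if "x \<in> X" for x
    using that a by (simp add: form_closed basis_closed)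
  have b: "?b \<in> carrier A" using cl by (intro M.finsum_closed) (auto simp: dual_closed)
  have on_basis: "s (y \<otimes>\<^bsub>A\<^esub> ?b) = s (y \<otimes>\<^bsub>A\<^esub> a)" if y: "y \<in> X" for y
  proof -
    have "y \<otimes>\<^bsub>A\<^esub> ?b = (\<Oplus>\<^bsub>A\<^esub>x\<in>X. y \<otimes>\<^bsub>A\<^esub> (s (x \<otimes>\<^bsub>A\<^esub> a) \<odot>\<^bsub>A\<^esub> d x))"
      using finite_basis cl y by (intro A.finsum_rdistr) (auto simp: basis_closed dual_closed)
    then have "s (y \<otimes>\<^bsub>A\<^esub> ?b) = (\<Oplus>\<^bsub>R\<^esub>x\<in>X. s (y \<otimes>\<^bsub>A\<^esub> (s (x \<otimes>\<^bsub>A\<^esub> a) \<odot>\<^bsub>A\<^esub> d x)))"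
      using cl y by (simp add: form.map_finsum basis_closed dual_closed)
    also have "\<dots> = (\<Oplus>\<^bsub>R\<^esub>x\<in>X. s (x \<otimes>\<^bsub>A\<^esub> a) \<otimes>\<^bsub>R\<^esub> (if x = y then \<one>\<^bsub>R\<^esub> else \<zero>\<^bsub>R\<^esub>))"
      using cl y by (intro R.finsum_cong')
        (auto simp: smult_mult_right basis_closed dual_closed form.map_smult dual)
    also have "\<dots> = s (y \<otimes>\<^bsub>A\<^esub> a)" using y cl by (rule finsum_kronecker)
    finally show ?thesis .
  qed
  have "s (c \<otimes>\<^bsub>A\<^esub> (a \<ominus>\<^bsub>A\<^esub> ?b)) = \<zero>\<^bsub>R\<^esub>" if c: "c \<in> carrier A" for c
  proof -
    let ?e = "a \<ominus>\<^bsub>A\<^esub> ?b" and ?\<gamma> = "\<lambda>x. s (c \<otimes>\<^bsub>A\<^esub> d x)"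
    have e: "?e \<in> carrier A" using a b by simp
    have \<gamma>: "?\<gamma> x \<in> carrier R" if "x \<in> X" for x using that c by (simp add: form_closed dual_closed)
    have zero: "s (x \<otimes>\<^bsub>A\<^esub> ?e) = \<zero>\<^bsub>R\<^esub>" if "x \<in> X" for x
    proof -
      have "x \<otimes>\<^bsub>A\<^esub> ?e = x \<otimes>\<^bsub>A\<^esub> a \<ominus>\<^bsub>A\<^esub> x \<otimes>\<^bsub>A\<^esub> ?b"
        using that a b by (simp add: M.minus_eq A.r_distr A.r_minus basis_closed)
      then show ?thesis
        using that a b on_basis[OF that]
        by (simp add: form.map_diff basis_closed form_closed R.minus_eq R.r_neg)
    qed
    have "c \<otimes>\<^bsub>A\<^esub> ?e = (\<Oplus>\<^bsub>A\<^esub>x\<in>X. ?\<gamma> x \<odot>\<^bsub>A\<^esub> x) \<otimes>\<^bsub>A\<^esub> ?e"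
      by (simp only: expand_basis[OF c])
    also have "\<dots> = (\<Oplus>\<^bsub>A\<^esub>x\<in>X. (?\<gamma> x \<odot>\<^bsub>A\<^esub> x) \<otimes>\<^bsub>A\<^esub> ?e)"
      using finite_basis \<gamma> e by (intro A.finsum_ldistr) (auto simp: basis_closed)
    finally have "s (c \<otimes>\<^bsub>A\<^esub> ?e) = (\<Oplus>\<^bsub>R\<^esub>x\<in>X. s ((?\<gamma> x \<odot>\<^bsub>A\<^esub> x) \<otimes>\<^bsub>A\<^esub> ?e))"
      using \<gamma> e by (simp add: form.map_finsum basis_closed)
    also have "\<dots> = (\<Oplus>\<^bsub>R\<^esub>x\<in>X. \<zero>\<^bsub>R\<^esub>)"
      using \<gamma> e by (intro R.finsum_cong') (auto simp: smult_mult_left basis_closed form.map_smult zero)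
    finally show ?thesis by simp
  qed
  then have "a \<ominus>\<^bsub>A\<^esub> ?b = \<zero>\<^bsub>A\<^esub>" using a b by (intro form_nondegenerate) auto
  then show ?thesis using a b M.diff_eq_zero_iff by simp
qed

text \<open>
  The element \<open>\<Sum> d x \<otimes> x\<close> of the tensor square of \<open>A\<close> commutes with \<open>A\<close>: expanding \<open>x a\<close> in the basis and
  \<open>a (d y)\<close> in the dual basis produces the same coefficients \<open>s (x a (d y))\<close>. Stated for an arbitrary
  bilinear map, this makes relative traces \<open>A\<close>-linear.
\<close>

lemma casimir_central:
  assumes P: "module R P" and b: "bilinear_map R A A P b" and a: "a \<in> carrier A"
  shows "(\<Oplus>\<^bsub>P\<^esub>x\<in>X. b (d x) (x \<otimes>\<^bsub>A\<^esub> a)) = (\<Oplus>\<^bsub>P\<^esub>x\<in>X. b (a \<otimes>\<^bsub>A\<^esub> d x) x)"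
proof -
  interpret P: module R P by fact
  have A: "left_module R A" "left_module R P"
    using module_axioms P by (auto intro: left_module_if_module)
  have bc: "b u v \<in> carrier P" if "u \<in> carrier A" "v \<in> carrier A" for u v
    using b that by (simp add: bilinear_map_def)
  have bl: "linear_map R A P (\<lambda>u. b u v)" if "v \<in> carrier A" for v
    using b that by (intro linear_mapI[OF A]) (simp_all add: bilinear_map_def)
  have br: "linear_map R A P (\<lambda>v. b u v)" if "u \<in> carrier A" for u
    using b that by (intro linear_mapI[OF A]) (simp_all add: bilinear_map_def)
  let ?c = "\<lambda>x y. s (x \<otimes>\<^bsub>A\<^esub> (a \<otimes>\<^bsub>A\<^esub> d y))"
  have c: "?c x y \<in> carrier R" if "x \<in> X" "y \<in> X" for x y
    using that a by (simp add: form_closed basis_closed dual_closed)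
  have left: "b (d x) (x \<otimes>\<^bsub>A\<^esub> a) = (\<Oplus>\<^bsub>P\<^esub>y\<in>X. ?c x y \<odot>\<^bsub>P\<^esub> b (d x) y)" if x: "x \<in> X" for x
  proof -
    interpret br: linear_map R A P "\<lambda>v. b (d x) v" by (rule br[OF dual_closed[OF x]])
    have "x \<otimes>\<^bsub>A\<^esub> a = (\<Oplus>\<^bsub>A\<^esub>y\<in>X. s (x \<otimes>\<^bsub>A\<^esub> a \<otimes>\<^bsub>A\<^esub> d y) \<odot>\<^bsub>A\<^esub> y)"
      using x a by (intro expand_basis[symmetric]) (simp add: basis_closed)
    also have "\<dots> = (\<Oplus>\<^bsub>A\<^esub>y\<in>X. ?c x y \<odot>\<^bsub>A\<^esub> y)"
      using x a c by (intro M.finsum_cong') (auto simp: basis_closed dual_closed A.m_assoc)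
    finally have "b (d x) (x \<otimes>\<^bsub>A\<^esub> a) = (\<Oplus>\<^bsub>P\<^esub>y\<in>X. b (d x) (?c x y \<odot>\<^bsub>A\<^esub> y))"
      using x c by (simp add: br.map_finsum basis_closed)
    also have "\<dots> = (\<Oplus>\<^bsub>P\<^esub>y\<in>X. ?c x y \<odot>\<^bsub>P\<^esub> b (d x) y)"
      using x c by (intro P.finsum_cong') (auto simp: basis_closed dual_closed br.map_smult bc)
    finally show ?thesis .
  qed
  have right: "b (a \<otimes>\<^bsub>A\<^esub> d y) y = (\<Oplus>\<^bsub>P\<^esub>x\<in>X. ?c x y \<odot>\<^bsub>P\<^esub> b (d x) y)" if y: "y \<in> X" for y
  proof -
    interpret bl: linear_map R A P "\<lambda>u. b u y" by (rule bl[OF basis_closed[OF y]])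
    have "b (a \<otimes>\<^bsub>A\<^esub> d y) y = b (\<Oplus>\<^bsub>A\<^esub>x\<in>X. ?c x y \<odot>\<^bsub>A\<^esub> d x) y"
      using y a by (subst expand_dual_basis) (auto simp: dual_closed)
    also have "\<dots> = (\<Oplus>\<^bsub>P\<^esub>x\<in>X. b (?c x y \<odot>\<^bsub>A\<^esub> d x) y)"
      using y c by (intro bl.map_finsum) (auto simp: dual_closed)
    also have "\<dots> = (\<Oplus>\<^bsub>P\<^esub>x\<in>X. ?c x y \<odot>\<^bsub>P\<^esub> b (d x) y)"
      using y c by (intro P.finsum_cong') (auto simp: basis_closed dual_closed bl.map_smult bc)
    finally show ?thesis .
  qed
  have "(\<Oplus>\<^bsub>P\<^esub>x\<in>X. b (d x) (x \<otimes>\<^bsub>A\<^esub> a)) = (\<Oplus>\<^bsub>P\<^esub>x\<in>X. \<Oplus>\<^bsub>P\<^esub>y\<in>X. ?c x y \<odot>\<^bsub>P\<^esub> b (d x) y)"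
    using c by (intro P.finsum_cong' P.finsum_closed) (auto simp: left basis_closed dual_closed bc intro!: P.finsum_closed)
  also have "\<dots> = (\<Oplus>\<^bsub>P\<^esub>y\<in>X. \<Oplus>\<^bsub>P\<^esub>x\<in>X. ?c x y \<odot>\<^bsub>P\<^esub> b (d x) y)"
    using finite_basis c by (intro P.finsum_commute) (auto simp: basis_closed dual_closed bc)
  also have "\<dots> = (\<Oplus>\<^bsub>P\<^esub>y\<in>X. b (a \<otimes>\<^bsub>A\<^esub> d y) y)"
    using a by (intro P.finsum_cong') (auto simp: right[symmetric] basis_closed dual_closed bc)
  finally show ?thesis .
qed

definition rel_trace :: "('a, 'u, 'c) module_scheme \<Rightarrow> ('a, 'v, 'e) module_scheme \<Rightarrow> ('u \<Rightarrow> 'v) \<Rightarrow> 'u \<Rightarrow> 'v" where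
  "rel_trace U V \<tau> u = (\<Oplus>\<^bsub>V\<^esub>x\<in>X. d x \<odot>\<^bsub>V\<^esub> \<tau> (x \<odot>\<^bsub>U\<^esub> u))"

context
  fixes U :: "('a, 'u) module" and V :: "('a, 'v) module"
  assumes U: "left_module A U" and V: "left_module A V"
begin

interpretation U: left_module A U by (rule U)
interpretation V: left_module A V by (rule V)

lemma rel_trace_linear:
  assumes \<tau>: "linear_map R (restrict_scalars A U) (restrict_scalars A V) \<tau>"
  shows "linear_map A U V (rel_trace U V \<tau>)"
proof -
  interpret \<tau>: linear_map R "restrict_scalars A U" "restrict_scalars A V" \<tau> by fact
  have \<tau>c: "\<tau> u \<in> carrier V" if "u \<in> carrier U" for u using \<tau>.closed that by simp
  have \<tau>a: "\<tau> (u \<oplus>\<^bsub>U\<^esub> v) = \<tau> u \<oplus>\<^bsub>V\<^esub> \<tau> v" if "u \<in> carrier U" "v \<in> carrier U" for u v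
    using \<tau>.map_add that by simp
  have \<tau>s: "\<tau> ((r \<odot>\<^bsub>A\<^esub> a) \<odot>\<^bsub>U\<^esub> u) = (r \<odot>\<^bsub>A\<^esub> \<one>\<^bsub>A\<^esub>) \<odot>\<^bsub>V\<^esub> \<tau> (a \<odot>\<^bsub>U\<^esub> u)"
    if "r \<in> carrier R" "a \<in> carrier A" "u \<in> carrier U" for r a u
    using \<tau>.map_smult[of r "a \<odot>\<^bsub>U\<^esub> u"] that
    by (simp add: U.smult_closed U.smult_assoc1[symmetric] scalar_mult)
  note cl = basis_closed dual_closed U.smult_closed V.smult_closed \<tau>c
  show ?thesis
  proof (rule linear_mapI[OF U V])
    fix u assume u: "u \<in> carrier U"
    show "rel_trace U V \<tau> u \<in> carrier V"
      unfolding rel_trace_def using u by (intro V.M.finsum_closed) (auto simp: cl)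
    show "rel_trace U V \<tau> (u \<oplus>\<^bsub>U\<^esub> v) = rel_trace U V \<tau> u \<oplus>\<^bsub>V\<^esub> rel_trace U V \<tau> v"
      if v: "v \<in> carrier U" for v
    proof -
      have "(\<Oplus>\<^bsub>V\<^esub>x\<in>X. d x \<odot>\<^bsub>V\<^esub> \<tau> (x \<odot>\<^bsub>U\<^esub> (u \<oplus>\<^bsub>U\<^esub> v))) =
          (\<Oplus>\<^bsub>V\<^esub>x\<in>X. d x \<odot>\<^bsub>V\<^esub> \<tau> (x \<odot>\<^bsub>U\<^esub> u) \<oplus>\<^bsub>V\<^esub> d x \<odot>\<^bsub>V\<^esub> \<tau> (x \<odot>\<^bsub>U\<^esub> v))"
        using u v by (intro V.M.finsum_cong') (auto simp: cl \<tau>a U.smult_r_distr V.smult_r_distr)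
      also have "\<dots> = (\<Oplus>\<^bsub>V\<^esub>x\<in>X. d x \<odot>\<^bsub>V\<^esub> \<tau> (x \<odot>\<^bsub>U\<^esub> u)) \<oplus>\<^bsub>V\<^esub> (\<Oplus>\<^bsub>V\<^esub>x\<in>X. d x \<odot>\<^bsub>V\<^esub> \<tau> (x \<odot>\<^bsub>U\<^esub> v))"
        using u v by (intro V.M.finsum_addf) (auto simp: cl)
      finally show ?thesis by (simp add: rel_trace_def)
    qed
    show "rel_trace U V \<tau> (a \<odot>\<^bsub>U\<^esub> u) = a \<odot>\<^bsub>V\<^esub> rel_trace U V \<tau> u" if a: "a \<in> carrier A" for a
    proof -
      have "bilinear_map R A A (restrict_scalars A V) (\<lambda>c e. c \<odot>\<^bsub>V\<^esub> \<tau> (e \<odot>\<^bsub>U\<^esub> u))"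
        using u by (auto simp: bilinear_map_def cl U.smult_l_distr V.smult_l_distr V.smult_r_distr \<tau>a
            \<tau>s V.smult_assoc1[symmetric] scalar_mult mult_scalar)
      then have "(\<Oplus>\<^bsub>V\<^esub>x\<in>X. d x \<odot>\<^bsub>V\<^esub> \<tau> ((x \<otimes>\<^bsub>A\<^esub> a) \<odot>\<^bsub>U\<^esub> u)) =
          (\<Oplus>\<^bsub>V\<^esub>x\<in>X. (a \<otimes>\<^bsub>A\<^esub> d x) \<odot>\<^bsub>V\<^esub> \<tau> (x \<odot>\<^bsub>U\<^esub> u))"
        using casimir_central[OF module_restrict_scalars[OF V] _ a] by simp
      moreover have "rel_trace U V \<tau> (a \<odot>\<^bsub>U\<^esub> u) = (\<Oplus>\<^bsub>V\<^esub>x\<in>X. d x \<odot>\<^bsub>V\<^esub> \<tau> ((x \<otimes>\<^bsub>A\<^esub> a) \<odot>\<^bsub>U\<^esub> u))"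
        unfolding rel_trace_def using a u
        by (intro V.M.finsum_cong') (auto simp: cl U.smult_assoc1)
      moreover have "(\<Oplus>\<^bsub>V\<^esub>x\<in>X. (a \<otimes>\<^bsub>A\<^esub> d x) \<odot>\<^bsub>V\<^esub> \<tau> (x \<odot>\<^bsub>U\<^esub> u)) =
          (\<Oplus>\<^bsub>V\<^esub>x\<in>X. a \<odot>\<^bsub>V\<^esub> (d x \<odot>\<^bsub>V\<^esub> \<tau> (x \<odot>\<^bsub>U\<^esub> u)))"
        using a u by (intro V.M.finsum_cong') (auto simp: cl V.smult_assoc1)
      moreover have "\<dots> = a \<odot>\<^bsub>V\<^esub> rel_trace U V \<tau> u"
        unfolding rel_trace_def using a u by (intro V.finsum_smult[symmetric]) (auto simp: cl)
      ultimately show ?thesis by simp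
    qed
  qed
qed

lemma rel_trace_comp_left:
  assumes \<tau>: "linear_map R (restrict_scalars A U) (restrict_scalars A V) \<tau>" and \<beta>: "linear_map A V W \<beta>" and u: "u \<in> carrier U"
  shows "\<beta> (rel_trace U V \<tau> u) = rel_trace U W (\<lambda>u. \<beta> (\<tau> u)) u"
proof -
  interpret \<tau>: linear_map R "restrict_scalars A U" "restrict_scalars A V" \<tau> by fact
  interpret \<beta>: linear_map A V W \<beta> by fact
  have \<tau>c: "\<tau> u \<in> carrier V" if "u \<in> carrier U" for u using \<tau>.closed that by simp
  note cl = basis_closed dual_closed U.smult_closed V.smult_closed \<tau>c \<beta>.closed \<beta>.N.smult_closed
  have "\<beta> (rel_trace U V \<tau> u) = (\<Oplus>\<^bsub>W\<^esub>x\<in>X. \<beta> (d x \<odot>\<^bsub>V\<^esub> \<tau> (x \<odot>\<^bsub>U\<^esub> u)))"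
    unfolding rel_trace_def using u by (intro \<beta>.map_finsum) (auto simp: cl)
  also have "\<dots> = (\<Oplus>\<^bsub>W\<^esub>x\<in>X. d x \<odot>\<^bsub>W\<^esub> \<beta> (\<tau> (x \<odot>\<^bsub>U\<^esub> u)))"
    using u by (intro \<beta>.N.M.finsum_cong') (auto simp: cl \<beta>.map_smult)
  finally show ?thesis by (simp add: rel_trace_def)
qed

lemma rel_trace_comp_right:
  assumes \<tau>: "linear_map R (restrict_scalars A U) (restrict_scalars A V) \<tau>" and \<gamma>: "linear_map A W U \<gamma>" and w: "w \<in> carrier W"
  shows "rel_trace U V \<tau> (\<gamma> w) = rel_trace W V (\<lambda>w. \<tau> (\<gamma> w)) w"
proof -
  interpret \<tau>: linear_map R "restrict_scalars A U" "restrict_scalars A V" \<tau> by fact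
  interpret \<gamma>: linear_map A W U \<gamma> by fact
  have \<tau>c: "\<tau> u \<in> carrier V" if "u \<in> carrier U" for u using \<tau>.closed that by simp
  show ?thesis
    unfolding rel_trace_def using w
    by (intro V.M.finsum_cong')
      (auto simp: basis_closed dual_closed \<gamma>.M.smult_closed V.smult_closed U.smult_closed \<tau>c \<gamma>.closed \<gamma>.map_smult)
qed

end

text \<open>
  The linear trace of \<open>d x \<circ> \<rho> \<circ> x\<close> is that of \<open>\<rho> \<circ> (x d x)\<close>, so summing over the basis replaces the
  two families of basis elements by the relative projective element.
\<close>

lemma linear_trace_rel_trace:
  fixes U :: "('a, 'u) module"
  assumes U: "left_module A U" and free: "free_finite_rank R (restrict_scalars A U)"
    and \<rho>: "linear_map R (restrict_scalars A U) (restrict_scalars A U) \<rho>"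
    and z: "(\<Oplus>\<^bsub>A\<^esub>x\<in>X. x \<otimes>\<^bsub>A\<^esub> d x) = c \<odot>\<^bsub>A\<^esub> \<one>\<^bsub>A\<^esub>" and c: "c \<in> carrier R"
  shows "linear_trace R (restrict_scalars A U) (rel_trace U U \<rho>) =
    c \<otimes>\<^bsub>R\<^esub> linear_trace R (restrict_scalars A U) \<rho>"
proof -
  let ?U = "restrict_scalars A U" and ?tr = "linear_trace R (restrict_scalars A U)"
  interpret U: left_module A U by fact
  interpret U': module R ?U by (rule module_restrict_scalars[OF U])
  interpret \<rho>: linear_map R ?U ?U \<rho> by fact
  have \<rho>c: "\<rho> u \<in> carrier U" if "u \<in> carrier U" for u using \<rho>.closed that by simp
  note cl = basis_closed dual_closed U.smult_closed \<rho>c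
  have "?tr (rel_trace U U \<rho>) = ?tr (\<lambda>u. \<Oplus>\<^bsub>?U\<^esub>x\<in>X. d x \<odot>\<^bsub>U\<^esub> \<rho> (x \<odot>\<^bsub>U\<^esub> u))"
    by (rule arg_cong[where f = "?tr"]) (simp add: rel_trace_def fun_eq_iff)
  also have "\<dots> = (\<Oplus>\<^bsub>R\<^esub>x\<in>X. ?tr (\<lambda>u. d x \<odot>\<^bsub>U\<^esub> \<rho> (x \<odot>\<^bsub>U\<^esub> u)))"
    by (rule U'.linear_trace_finsum[OF free finite_basis]) (simp add: cl)
  also have "\<dots> = (\<Oplus>\<^bsub>R\<^esub>x\<in>X. ?tr (\<lambda>u. \<rho> ((x \<otimes>\<^bsub>A\<^esub> d x) \<odot>\<^bsub>U\<^esub> u)))"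
  proof (rule R.finsum_cong')
    show "(\<lambda>x. ?tr (\<lambda>u. \<rho> ((x \<otimes>\<^bsub>A\<^esub> d x) \<odot>\<^bsub>U\<^esub> u))) \<in> X \<rightarrow> carrier R"
      by (intro Pi_I U'.linear_trace_closed[OF free]) (simp add: cl)
    fix x assume x: "x \<in> X"
    have "?tr (\<lambda>u. d x \<odot>\<^bsub>U\<^esub> \<rho> (x \<odot>\<^bsub>U\<^esub> u)) = ?tr (\<lambda>u. \<rho> (x \<odot>\<^bsub>U\<^esub> (d x \<odot>\<^bsub>U\<^esub> u)))"
      by (rule linear_trace_commute[OF R.is_cring free free
          linear_map_comp[OF linear_map_action[OF U basis_closed[OF x]] \<rho>]
          linear_map_action[OF U dual_closed[OF x]]])
    also have "\<dots> = ?tr (\<lambda>u. \<rho> ((x \<otimes>\<^bsub>A\<^esub> d x) \<odot>\<^bsub>U\<^esub> u))"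
      using x by (intro U'.linear_trace_cong[OF free]) (simp_all add: cl U.smult_assoc1)
    finally show "?tr (\<lambda>u. d x \<odot>\<^bsub>U\<^esub> \<rho> (x \<odot>\<^bsub>U\<^esub> u)) = ?tr (\<lambda>u. \<rho> ((x \<otimes>\<^bsub>A\<^esub> d x) \<odot>\<^bsub>U\<^esub> u))" .
  qed simp
  also have "\<dots> = ?tr (\<lambda>u. \<Oplus>\<^bsub>?U\<^esub>x\<in>X. \<rho> ((x \<otimes>\<^bsub>A\<^esub> d x) \<odot>\<^bsub>U\<^esub> u))"
    by (rule U'.linear_trace_finsum[OF free finite_basis, symmetric]) (simp add: cl)
  also have "\<dots> = ?tr (\<lambda>u. c \<odot>\<^bsub>?U\<^esub> \<rho> u)"
  proof (rule U'.linear_trace_cong[OF free])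
    fix u assume "u \<in> carrier ?U"
    then have u: "u \<in> carrier U" by simp
    have "(\<Oplus>\<^bsub>?U\<^esub>x\<in>X. \<rho> ((x \<otimes>\<^bsub>A\<^esub> d x) \<odot>\<^bsub>U\<^esub> u)) = \<rho> (\<Oplus>\<^bsub>?U\<^esub>x\<in>X. (x \<otimes>\<^bsub>A\<^esub> d x) \<odot>\<^bsub>U\<^esub> u)"
      using u by (intro \<rho>.map_finsum[symmetric]) (auto simp: cl)
    also have "(\<Oplus>\<^bsub>?U\<^esub>x\<in>X. (x \<otimes>\<^bsub>A\<^esub> d x) \<odot>\<^bsub>U\<^esub> u) = (c \<odot>\<^bsub>A\<^esub> \<one>\<^bsub>A\<^esub>) \<odot>\<^bsub>U\<^esub> u"
      using u by (simp add: U.smult_finsum[symmetric] cl z Pi_def)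
    also have "\<rho> \<dots> = c \<odot>\<^bsub>?U\<^esub> \<rho> u" using \<rho>.map_smult[OF c, of u] u by simp
    finally show "(\<Oplus>\<^bsub>?U\<^esub>x\<in>X. \<rho> ((x \<otimes>\<^bsub>A\<^esub> d x) \<odot>\<^bsub>U\<^esub> u)) = c \<odot>\<^bsub>?U\<^esub> \<rho> u" .
    show "c \<odot>\<^bsub>?U\<^esub> \<rho> u \<in> carrier ?U" using u c by (simp add: cl)
  qed
  also have "\<dots> = c \<otimes>\<^bsub>R\<^esub> ?tr \<rho>"
    by (rule U'.linear_trace_smult[OF free c]) (simp add: \<rho>c)
  finally show ?thesis .
qed

end

text \<open>
  A bimodule isomorphism \<open>\<Phi>\<close> with \<open>\<Phi> 1 = s\<close> satisfies \<open>\<Phi> a c = s (c a)\<close>, so its injectivity is the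
  non-degeneracy of \<open>s\<close>.
\<close>

lemma dual_bases_algebra_if_symmetrising_form:
  assumes A: "assoc_algebra R A" and s: "symmetrising_form R A s"
    and basis: "is_basis R A X" and d: "d \<in> X \<rightarrow> carrier A"
    and dual: "\<forall>x\<in>X. \<forall>y\<in>X. s (x \<otimes>\<^bsub>A\<^esub> d y) = (if x = y then \<one>\<^bsub>R\<^esub> else \<zero>\<^bsub>R\<^esub>)"
  shows "dual_bases_algebra R A s X d"
proof -
  interpret A: assoc_algebra R A by fact
  obtain \<Phi> where \<Phi>: "\<Phi> \<in> dual_bimodule_isos R A" and s: "s = \<Phi> \<one>\<^bsub>A\<^esub>"
    using s by (auto simp: symmetrising_form_def)
  have bij: "bij_betw \<Phi> (carrier A) (algebra_dual R A)"
    and add: "\<And>x y c. \<lbrakk>x \<in> carrier A; y \<in> carrier A; c \<in> carrier A\<rbrakk> \<Longrightarrow> \<Phi> (x \<oplus>\<^bsub>A\<^esub> y) c = \<Phi> x c \<oplus>\<^bsub>R\<^esub> \<Phi> y c"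
    and bimod: "\<And>a x b c. \<lbrakk>a \<in> carrier A; x \<in> carrier A; b \<in> carrier A; c \<in> carrier A\<rbrakk> \<Longrightarrow>
        \<Phi> (a \<otimes>\<^bsub>A\<^esub> x \<otimes>\<^bsub>A\<^esub> b) c = \<Phi> x (b \<otimes>\<^bsub>A\<^esub> c \<otimes>\<^bsub>A\<^esub> a)"
    using \<Phi> unfolding dual_bimodule_isos_def by blast+
  have mods: "left_module R A" "left_module R (regular_module R)"
    using A.module_axioms module_regular[OF A.R.is_cring] by (auto intro: left_module_if_module)
  have img: "linear_map R A (regular_module R) (\<Phi> x)" "\<Phi> x \<in> extensional (carrier A)"
    if "x \<in> carrier A" for x
    using bij_betw_apply[OF bij that] by (simp_all add: algebra_dual_def module_homs_iff[OF mods])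
  have \<Phi>s: "\<Phi> a c = s (c \<otimes>\<^bsub>A\<^esub> a)" if "a \<in> carrier A" "c \<in> carrier A" for a c
    using bimod[of a "\<one>\<^bsub>A\<^esub>" "\<one>\<^bsub>A\<^esub>" c] that by (simp add: s)
  show ?thesis
  proof (intro dual_bases_algebra.intro record_algebra.intro dual_bases_algebra_axioms.intro A basis)
    show "linear_map R A (regular_module R) s" unfolding s by (rule img) simp
    show "a = \<zero>\<^bsub>A\<^esub>" if a: "a \<in> carrier A" and zero: "\<And>c. c \<in> carrier A \<Longrightarrow> s (c \<otimes>\<^bsub>A\<^esub> a) = \<zero>\<^bsub>R\<^esub>" for a
    proof -
      interpret s: linear_map R A "regular_module R" s unfolding s by (rule img) simp
      have "\<Phi> a = \<Phi> \<zero>\<^bsub>A\<^esub>"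
      proof (rule extensionalityI[OF img(2) img(2)])
        fix c assume c: "c \<in> carrier A"
        then show "\<Phi> a c = \<Phi> \<zero>\<^bsub>A\<^esub> c" using a zero s.map_zero by (simp add: \<Phi>s)
      qed (use a in auto)
      then show ?thesis using bij a by (auto simp: bij_betw_def inj_on_def)
    qed
  qed (use d dual in auto)
qed

section \<open>Homomorphisms factoring through relatively projective modules\<close>

locale scalar_induction = record_algebra R A + W: module R W
  for R :: "'r ring" and A :: "('r, 'a) module" and W :: "('r, 'w) module"
begin

sublocale tensor: tensor_product R A W ..

abbreviation T where "T \<equiv> tensor R A W"
abbreviation pure where "pure \<equiv> pure_tensor R A W"
abbreviation IM where "IM \<equiv> induced_module R A W"

lemma pure_closed: "\<lbrakk>a \<in> carrier A; w \<in> carrier W\<rbrakk> \<Longrightarrow> pure a w \<in> carrier T"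
  and pure_smult_left: "\<lbrakk>r \<in> carrier R; a \<in> carrier A; w \<in> carrier W\<rbrakk> \<Longrightarrow>
    pure (r \<odot>\<^bsub>A\<^esub> a) w = r \<odot>\<^bsub>T\<^esub> pure a w"
  and pure_smult_right: "\<lbrakk>r \<in> carrier R; a \<in> carrier A; w \<in> carrier W\<rbrakk> \<Longrightarrow>
    pure a (r \<odot>\<^bsub>W\<^esub> w) = r \<odot>\<^bsub>T\<^esub> pure a w"
  and pure_add_left: "\<lbrakk>a \<in> carrier A; a' \<in> carrier A; w \<in> carrier W\<rbrakk> \<Longrightarrow>
    pure (a \<oplus>\<^bsub>A\<^esub> a') w = pure a w \<oplus>\<^bsub>T\<^esub> pure a' w"
  and pure_add_right: "\<lbrakk>a \<in> carrier A; w \<in> carrier W; w' \<in> carrier W\<rbrakk> \<Longrightarrow>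
    pure a (w \<oplus>\<^bsub>W\<^esub> w') = pure a w \<oplus>\<^bsub>T\<^esub> pure a w'"
  using tensor.pure_bilinear by (simp_all add: bilinear_map_def)

lemma induced_simps [simp]:
  "carrier IM = carrier T" "add IM = add T" "zero IM = zero T"
  by (simp_all add: induced_module_def Let_def)

lemma left_module_T: "left_module R T"
  by (rule left_module_if_module[OF tensor.module_tensor])

lemma action_bilinear:
  "a \<in> carrier A \<Longrightarrow> bilinear_map R A W T (\<lambda>b w. pure (a \<otimes>\<^bsub>A\<^esub> b) w)"
  by (simp add: bilinear_map_def pure_closed pure_smult_left pure_smult_right pure_add_left
      pure_add_right A.r_distr smult_mult_right)

lemma induced_action: "a \<odot>\<^bsub>IM\<^esub> t = tensor_lift R T (\<lambda>b w. pure (a \<otimes>\<^bsub>A\<^esub> b) w) t"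
  by (simp add: induced_module_def Let_def)

lemma induced_action_linear: "a \<in> carrier A \<Longrightarrow> linear_map R T T (\<lambda>t. a \<odot>\<^bsub>IM\<^esub> t)"
  unfolding induced_action
  by (rule tensor.tensor_lift_linear[OF tensor.module_tensor action_bilinear])

lemma induced_action_pure:
  "\<lbrakk>a \<in> carrier A; b \<in> carrier A; w \<in> carrier W\<rbrakk> \<Longrightarrow> a \<odot>\<^bsub>IM\<^esub> pure b w = pure (a \<otimes>\<^bsub>A\<^esub> b) w"
  unfolding induced_action
  by (rule tensor.tensor_lift_pure[OF tensor.module_tensor action_bilinear])

lemma left_module_induced: "left_module A IM"
proof (intro left_module.intro left_module_axioms.intro)
  show "ring A" ..
  show "abelian_group IM"
    using tensor.T.M.abelian_group_axioms by (rule abelian_group_cong_record) simp_all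
next
  fix a t assume a: "a \<in> carrier A" and "t \<in> carrier IM"
  then have t: "t \<in> carrier T" by simp
  interpret a: linear_map R T T "\<lambda>t. a \<odot>\<^bsub>IM\<^esub> t" by (rule induced_action_linear[OF a])
  show "a \<odot>\<^bsub>IM\<^esub> t \<in> carrier IM" using a.closed[OF t] by simp
  show "a \<odot>\<^bsub>IM\<^esub> (t \<oplus>\<^bsub>IM\<^esub> t') = a \<odot>\<^bsub>IM\<^esub> t \<oplus>\<^bsub>IM\<^esub> a \<odot>\<^bsub>IM\<^esub> t'" if "t' \<in> carrier IM" for t'
    using a.map_add[OF t] that by simp
  fix b assume b: "b \<in> carrier A"
  interpret b: linear_map R T T "\<lambda>t. b \<odot>\<^bsub>IM\<^esub> t" by (rule induced_action_linear[OF b])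
  have "linear_map R T T (\<lambda>t. a \<odot>\<^bsub>IM\<^esub> t \<oplus>\<^bsub>T\<^esub> b \<odot>\<^bsub>IM\<^esub> t)"
    by (rule linear_mapI[OF left_module_T left_module_T])
      (simp_all add: a.closed b.closed a.map_add b.map_add a.map_smult b.map_smult
        tensor.T.smult_r_distr tensor.T.M.a_ac)
  from tensor.tensor_ext[OF induced_action_linear[OF M.a_closed[OF a b]] this _ t] a b
  show "(a \<oplus>\<^bsub>A\<^esub> b) \<odot>\<^bsub>IM\<^esub> t = a \<odot>\<^bsub>IM\<^esub> t \<oplus>\<^bsub>IM\<^esub> b \<odot>\<^bsub>IM\<^esub> t"
    by (simp add: induced_action_pure pure_add_left A.l_distr)
  from tensor.tensor_ext[OF induced_action_linear[OF A.m_closed[OF a b]]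
      linear_map_comp[OF induced_action_linear[OF b] induced_action_linear[OF a]] _ t] a b
  show "(a \<otimes>\<^bsub>A\<^esub> b) \<odot>\<^bsub>IM\<^esub> t = a \<odot>\<^bsub>IM\<^esub> (b \<odot>\<^bsub>IM\<^esub> t)"
    by (simp add: induced_action_pure A.m_assoc)
next
  fix t assume "t \<in> carrier IM"
  then have t: "t \<in> carrier T" by simp
  from tensor.tensor_ext[OF induced_action_linear[OF A.one_closed] linear_map_id[OF left_module_T] _ t]
  show "\<one>\<^bsub>A\<^esub> \<odot>\<^bsub>IM\<^esub> t = t" by (simp add: induced_action_pure)
qed

text \<open>
  The ring \<open>R\<close> acts on the induced module through the tensor product and through the scalars of \<open>A\<close>.
  As both actions agree, \<open>R\<close>-linear maps for the one are \<open>R\<close>-linear maps for the other.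
\<close>

lemma scalar_action:
  assumes r: "r \<in> carrier R" and t: "t \<in> carrier T"
  shows "(r \<odot>\<^bsub>A\<^esub> \<one>\<^bsub>A\<^esub>) \<odot>\<^bsub>IM\<^esub> t = r \<odot>\<^bsub>T\<^esub> t"
proof -
  have "linear_map R T T (\<lambda>t. r \<odot>\<^bsub>T\<^esub> t)"
    by (rule linear_map_smult[OF R.is_cring linear_map_id[OF left_module_T] r])
  from tensor.tensor_ext[OF induced_action_linear this _ t, of "r \<odot>\<^bsub>A\<^esub> \<one>\<^bsub>A\<^esub>"] r
  show ?thesis by (simp add: induced_action_pure scalar_mult pure_smult_left)
qed

lemma linear_map_from_T:
  assumes "linear_map R T P f"
  shows "linear_map R (restrict_scalars A IM) P f"
proof -
  interpret f: linear_map R T P f by fact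
  show ?thesis
    by (rule linear_mapI[OF left_module_restrict_scalars[OF left_module_induced] f.N.left_module_axioms])
      (simp_all add: f.closed f.map_add f.map_smult scalar_action)
qed

lemma linear_map_into_T:
  assumes "linear_map R M T f"
  shows "linear_map R M (restrict_scalars A IM) f"
proof -
  interpret f: linear_map R M T f by fact
  show ?thesis
    by (rule linear_mapI[OF f.M.left_module_axioms left_module_restrict_scalars[OF left_module_induced]])
      (simp_all add: f.closed f.map_add f.map_smult scalar_action)
qed

end

lemma (in left_module) direct_summand_carrier: "direct_summand A (carrier M) M"
proof -
  have "submodule (carrier M) A M"
    using group.subgroup_self[OF M.a_group] smult_closed
    by (intro submodule.intro submodule_axioms.intro) auto
  moreover have "a \<odot>\<^bsub>M\<^esub> \<zero>\<^bsub>M\<^esub> = \<zero>\<^bsub>M\<^esub>" if "a \<in> carrier A" for a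
    using finsum_smult[of a "\<lambda>_. \<zero>\<^bsub>M\<^esub>" "{}"] that by simp
  then have "submodule {\<zero>\<^bsub>M\<^esub>} A M"
    using group.triv_subgroup[OF M.a_group]
    by (intro submodule.intro submodule_axioms.intro) auto
  moreover have "carrier M <+>\<^bsub>M\<^esub> {\<zero>\<^bsub>M\<^esub>} = carrier M"
    by (auto simp: set_add_def')
  ultimately show ?thesis unfolding direct_summand_def by blast
qed

text \<open>
  Precomposing with the projection along a complement replaces maps on a summand by maps on the whole
  module, which reduces factorisations through summands to factorisations through induced modules.
\<close>

lemma extend_from_direct_summand:
  assumes M: "left_module A M" and P: "direct_summand A P M" and h: "h \<in> module_homs A (M\<lparr>carrier := P\<rparr>) V"
    and V: "left_module A V"
  obtains k where "linear_map A M V k" "\<And>p. p \<in> P \<Longrightarrow> k p = h p"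
proof -
  interpret M: left_module A M by fact
  obtain Q where PQ: "submodule P A M" "submodule Q A M" "P \<inter> Q = {\<zero>\<^bsub>M\<^esub>}" "P <+>\<^bsub>M\<^esub> Q = carrier M"
    using P by (auto simp: direct_summand_def)
  have sub: "S \<subseteq> carrier M" "\<And>x y. \<lbrakk>x \<in> S; y \<in> S\<rbrakk> \<Longrightarrow> x \<oplus>\<^bsub>M\<^esub> y \<in> S" "\<And>x. x \<in> S \<Longrightarrow> \<ominus>\<^bsub>M\<^esub> x \<in> S"
    "\<zero>\<^bsub>M\<^esub> \<in> S" "\<And>a x. \<lbrakk>a \<in> carrier A; x \<in> S\<rbrakk> \<Longrightarrow> a \<odot>\<^bsub>M\<^esub> x \<in> S" if "submodule S A M" for S
  proof -
    interpret S: submodule S A M by (rule that)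
    show "S \<subseteq> carrier M" using S.subset by simp
    show "x \<oplus>\<^bsub>M\<^esub> y \<in> S" if "x \<in> S" "y \<in> S" for x y using S.m_closed[OF that] by simp
    show "\<ominus>\<^bsub>M\<^esub> x \<in> S" if "x \<in> S" for x using S.m_inv_closed[OF that] by (simp add: a_inv_def)
    show "\<zero>\<^bsub>M\<^esub> \<in> S" using S.one_closed by simp
    show "a \<odot>\<^bsub>M\<^esub> x \<in> S" if "a \<in> carrier A" "x \<in> S" for a x using S.smult_closed[OF that] .
  qed
  note subP = sub[OF PQ(1)] and subQ = sub[OF PQ(2)]
  have unique: "p = p'" if "p \<in> P" "p' \<in> P" "q \<in> Q" "q' \<in> Q" "p \<oplus>\<^bsub>M\<^esub> q = p' \<oplus>\<^bsub>M\<^esub> q'" for p p' q q'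
  proof -
    have cl: "p \<in> carrier M" "p' \<in> carrier M" "q \<in> carrier M" "q' \<in> carrier M"
      using that subP(1) subQ(1) by auto
    have "p \<oplus>\<^bsub>M\<^esub> \<ominus>\<^bsub>M\<^esub> p' = (p \<oplus>\<^bsub>M\<^esub> q) \<oplus>\<^bsub>M\<^esub> \<ominus>\<^bsub>M\<^esub> q \<oplus>\<^bsub>M\<^esub> \<ominus>\<^bsub>M\<^esub> p'"
      using cl by (simp add: M.M.a_assoc M.M.r_neg)
    also have "\<dots> = p' \<oplus>\<^bsub>M\<^esub> (\<ominus>\<^bsub>M\<^esub> p' \<oplus>\<^bsub>M\<^esub> (q' \<oplus>\<^bsub>M\<^esub> \<ominus>\<^bsub>M\<^esub> q))"
      unfolding that(5) using cl by (simp add: M.M.a_ac)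
    also have "\<dots> = q' \<oplus>\<^bsub>M\<^esub> \<ominus>\<^bsub>M\<^esub> q"
      using cl by (simp add: M.M.r_neg2)
    finally have "p \<oplus>\<^bsub>M\<^esub> \<ominus>\<^bsub>M\<^esub> p' = q' \<oplus>\<^bsub>M\<^esub> \<ominus>\<^bsub>M\<^esub> q" .
    moreover have "p \<oplus>\<^bsub>M\<^esub> \<ominus>\<^bsub>M\<^esub> p' \<in> P" "q' \<oplus>\<^bsub>M\<^esub> \<ominus>\<^bsub>M\<^esub> q \<in> Q"
      using that subP(2,3) subQ(2,3) by auto
    ultimately have "p \<ominus>\<^bsub>M\<^esub> p' = \<zero>\<^bsub>M\<^esub>" using PQ(3) by (auto simp: M.M.minus_eq)
    then show ?thesis using cl M.M.diff_eq_zero_iff by simp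
  qed
  have "\<exists>p\<in>P. \<exists>q\<in>Q. m = p \<oplus>\<^bsub>M\<^esub> q" if "m \<in> carrier M" for m
    using that unfolding PQ(4)[symmetric] set_add_def' by auto
  then obtain pr where pr: "pr m \<in> P" "\<exists>q\<in>Q. m = pr m \<oplus>\<^bsub>M\<^esub> q" if "m \<in> carrier M" for m
    by metis
  have pr_eqI: "pr m = p" if "m = p \<oplus>\<^bsub>M\<^esub> q" "p \<in> P" "q \<in> Q" for m p q
  proof -
    have m: "m \<in> carrier M" using that subP(1) subQ(1) by auto
    obtain q' where q': "q' \<in> Q" "m = pr m \<oplus>\<^bsub>M\<^esub> q'" using pr(2)[OF m] by blast
    show ?thesis
      by (rule unique[OF pr(1)[OF m] that(2) q'(1) that(3) trans[OF q'(2)[symmetric] that(1)]])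
  qed
  have pr_add: "pr (m \<oplus>\<^bsub>M\<^esub> m') = pr m \<oplus>\<^bsub>M\<^esub> pr m'" if mm: "m \<in> carrier M" "m' \<in> carrier M" for m m'
  proof -
    obtain q where q: "q \<in> Q" "m = pr m \<oplus>\<^bsub>M\<^esub> q" using pr(2)[OF mm(1)] by blast
    obtain q' where q': "q' \<in> Q" "m' = pr m' \<oplus>\<^bsub>M\<^esub> q'" using pr(2)[OF mm(2)] by blast
    have cl: "pr m \<in> carrier M" "pr m' \<in> carrier M" "q \<in> carrier M" "q' \<in> carrier M"
      using pr(1)[OF mm(1)] pr(1)[OF mm(2)] subP(1) subQ(1) q(1) q'(1) by auto
    have "(pr m \<oplus>\<^bsub>M\<^esub> q) \<oplus>\<^bsub>M\<^esub> (pr m' \<oplus>\<^bsub>M\<^esub> q') = (pr m \<oplus>\<^bsub>M\<^esub> pr m') \<oplus>\<^bsub>M\<^esub> (q \<oplus>\<^bsub>M\<^esub> q')"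
      using cl by (simp add: M.M.a_ac)
    then have "m \<oplus>\<^bsub>M\<^esub> m' = (pr m \<oplus>\<^bsub>M\<^esub> pr m') \<oplus>\<^bsub>M\<^esub> (q \<oplus>\<^bsub>M\<^esub> q')"
      by (simp only: q(2)[symmetric] q'(2)[symmetric])
    then show ?thesis
      by (rule pr_eqI) (intro subP(2) subQ(2) pr(1) mm q(1) q'(1))+
  qed
  have pr_smult: "pr (a \<odot>\<^bsub>M\<^esub> m) = a \<odot>\<^bsub>M\<^esub> pr m" if am: "a \<in> carrier A" "m \<in> carrier M" for a m
  proof -
    obtain q where q: "q \<in> Q" "m = pr m \<oplus>\<^bsub>M\<^esub> q" using pr(2)[OF am(2)] by blast
    have cl: "pr m \<in> carrier M" "q \<in> carrier M"
      using pr(1)[OF am(2)] subP(1) subQ(1) q(1) by auto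
    have "a \<odot>\<^bsub>M\<^esub> (pr m \<oplus>\<^bsub>M\<^esub> q) = a \<odot>\<^bsub>M\<^esub> pr m \<oplus>\<^bsub>M\<^esub> a \<odot>\<^bsub>M\<^esub> q"
      using cl am by (simp add: M.smult_r_distr)
    then have "a \<odot>\<^bsub>M\<^esub> m = a \<odot>\<^bsub>M\<^esub> pr m \<oplus>\<^bsub>M\<^esub> a \<odot>\<^bsub>M\<^esub> q"
      by (simp only: q(2)[symmetric])
    then show ?thesis
      by (rule pr_eqI) (intro subP(5) subQ(5) pr(1) am q(1))+
  qed
  have h: "h p \<in> carrier V" "h (p \<oplus>\<^bsub>M\<^esub> p') = h p \<oplus>\<^bsub>V\<^esub> h p'" "h (a \<odot>\<^bsub>M\<^esub> p) = a \<odot>\<^bsub>V\<^esub> h p"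
    if "p \<in> P" "p' \<in> P" "a \<in> carrier A" for p p' a
    using h that by (auto simp: module_homs_def)
  show thesis
  proof
    show "linear_map A M V (\<lambda>m. h (pr m))"
      by (rule linear_mapI[OF M V]) (use pr(1) in \<open>auto simp: pr_add pr_smult intro: h\<close>)
    show "h (pr p) = h p" if "p \<in> P" for p
      using pr_eqI[of p p "\<zero>\<^bsub>M\<^esub>"] that subP(1) subQ(4) by auto
  qed
qed

text \<open>
  A copy of a module on the image of an injection, used to realise a module as a module on the type
  that the parameter of \<^const>\<open>projective_homs\<close> prescribes.
\<close>

definition module_copy :: "('m \<Rightarrow> 'w) \<Rightarrow> ('r, 'm) module \<Rightarrow> ('r, 'w) module" where
  "module_copy j M = (let i = the_inv_into (carrier M) j in
     \<lparr>carrier = j ` carrier M, mult = undefined, one = undefined, zero = j \<zero>\<^bsub>M\<^esub>,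
      add = (\<lambda>x y. j (i x \<oplus>\<^bsub>M\<^esub> i y)), smult = (\<lambda>r x. j (r \<odot>\<^bsub>M\<^esub> i x))\<rparr>)"

lemma module_copy:
  fixes M :: "('r, 'm) module"
  assumes M: "module R M" and j: "inj_on j (carrier M)"
  shows "module R (module_copy j M)"
    and "linear_map R M (module_copy j M) j"
    and "linear_map R (module_copy j M) M (the_inv_into (carrier M) j)"
proof -
  interpret M: module R M by fact
  let ?N = "module_copy j M" and ?i = "the_inv_into (carrier M) j"
  have i: "?i (j x) = x" if "x \<in> carrier M" for x using j that by (rule the_inv_into_f_f)
  have simps: "carrier ?N = j ` carrier M" "\<zero>\<^bsub>?N\<^esub> = j \<zero>\<^bsub>M\<^esub>" "x \<oplus>\<^bsub>?N\<^esub> y = j (?i x \<oplus>\<^bsub>M\<^esub> ?i y)"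
    "r \<odot>\<^bsub>?N\<^esub> x = j (r \<odot>\<^bsub>M\<^esub> ?i x)" for x y r
    by (simp_all add: module_copy_def Let_def)
  have "abelian_group ?N"
  proof (rule abelian_groupI)
    show "\<exists>y\<in>carrier ?N. y \<oplus>\<^bsub>?N\<^esub> x = \<zero>\<^bsub>?N\<^esub>" if "x \<in> carrier ?N" for x
    proof -
      from that obtain m where m: "m \<in> carrier M" "x = j m" by (auto simp: simps)
      then have "j (\<ominus>\<^bsub>M\<^esub> m) \<oplus>\<^bsub>?N\<^esub> x = \<zero>\<^bsub>?N\<^esub>" by (simp add: simps i M.M.l_neg)
      with m show ?thesis by (auto simp: simps)
    qed
  qed (auto simp: simps i M.M.a_ac)
  then show N: "module R ?N"
    by (intro moduleI)
      (auto simp: simps i M.R.is_cring M.smult_l_distr M.smult_r_distr M.smult_assoc1)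
  show "linear_map R M ?N j"
    by (rule linear_mapI[OF left_module_if_module[OF M] left_module_if_module[OF N]])
      (auto simp: simps i)
  show "linear_map R ?N M ?i"
    by (rule linear_mapI[OF left_module_if_module[OF N] left_module_if_module[OF M]])
      (auto simp: simps i)
qed

context dual_bases_algebra
begin

text \<open>
  The identity of the induced module is the relative trace of \<open>a \<otimes> w \<mapsto> s a 1 \<otimes> w\<close>, by the expansion
  \<open>a = \<Sum> s (x a) d x\<close>. Relative traces absorb homomorphisms composed on either side.
\<close>

lemma rel_trace_if_projective:
  fixes U :: "('a, 'u) module" and V :: "('a, 'v) module"
  assumes U: "left_module A U" and V: "left_module A V"
    and f: "f \<in> projective_homs (w :: 'w itself) R A U V"
  obtains \<tau> where "linear_map R (restrict_scalars A U) (restrict_scalars A V) \<tau>"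
    and "\<And>u. u \<in> carrier U \<Longrightarrow> f u = rel_trace U V \<tau> u"
proof -
  obtain W :: "('r, 'w) module" and P g h where W: "module R W" and P: "direct_summand A P (induced_module R A W)"
    and g: "g \<in> module_homs A U (induced_module R A W\<lparr>carrier := P\<rparr>)"
    and h: "h \<in> module_homs A (induced_module R A W\<lparr>carrier := P\<rparr>) V"
    and f: "f = compose (carrier U) h g"
    using f unfolding projective_homs_def by blast
  interpret scalar_induction R A W
    using W by (intro scalar_induction.intro record_algebra_axioms)
  \<comment> \<open>the linear endomorphism whose relative trace is the identity\<close>
  let ?\<theta> = "tensor_lift R T (\<lambda>b w. pure (s b \<odot>\<^bsub>A\<^esub> \<one>\<^bsub>A\<^esub>) w)"
  have b: "bilinear_map R A W T (\<lambda>b w. pure (s b \<odot>\<^bsub>A\<^esub> \<one>\<^bsub>A\<^esub>) w)"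
    using form.map_add form.map_smult
    by (simp add: bilinear_map_def pure_closed pure_smult_left pure_smult_right pure_add_left
        pure_add_right form_closed smult_l_distr smult_assoc1 tensor.T.smult_assoc1[symmetric] R.m_comm)
  note \<theta>_T = tensor.tensor_lift_linear[OF tensor.module_tensor b]
  note \<theta> = linear_map_into_T[OF linear_map_from_T[OF \<theta>_T]]
  note IM = left_module_induced
  have id: "rel_trace IM IM ?\<theta> t = t" if t: "t \<in> carrier T" for t
  proof -
    interpret tr: linear_map A IM IM "rel_trace IM IM ?\<theta>"
      by (rule rel_trace_linear[OF IM IM \<theta>])
    have lin: "linear_map R T T (rel_trace IM IM ?\<theta>)"
      using tr.closed tr.map_add tr.map_smult[of "r \<odot>\<^bsub>A\<^esub> \<one>\<^bsub>A\<^esub>" for r]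
      by (intro linear_mapI[OF left_module_T left_module_T])
        (auto simp: scalar_action[symmetric])
    show ?thesis
    proof (rule tensor.tensor_ext[OF lin linear_map_id[OF left_module_T] _ t])
      fix a w assume a: "a \<in> carrier A" and w: "w \<in> carrier W"
      interpret p: linear_map R A T "\<lambda>a. pure a w"
        using w by (intro linear_mapI[OF left_module_if_module[OF module_axioms] left_module_T])
          (simp_all add: pure_closed pure_add_left pure_smult_left)
      have "d x \<odot>\<^bsub>IM\<^esub> ?\<theta> (x \<odot>\<^bsub>IM\<^esub> pure a w) = pure (s (x \<otimes>\<^bsub>A\<^esub> a) \<odot>\<^bsub>A\<^esub> d x) w" if x: "x \<in> X" for x
        using x a w
        by (simp add: induced_action_pure tensor.tensor_lift_pure[OF tensor.module_tensor b] basis_closed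
            dual_closed form_closed mult_scalar)
      then have "rel_trace IM IM ?\<theta> (pure a w) = (\<Oplus>\<^bsub>IM\<^esub>x\<in>X. pure (s (x \<otimes>\<^bsub>A\<^esub> a) \<odot>\<^bsub>A\<^esub> d x) w)"
        unfolding rel_trace_def using a w
        by (intro abelian_monoid.finsum_cong' abelian_group.axioms(1) left_module.axioms(2)[OF IM])
          (auto simp: basis_closed dual_closed form_closed pure_closed)
      also have "\<dots> = (\<Oplus>\<^bsub>T\<^esub>x\<in>X. pure (s (x \<otimes>\<^bsub>A\<^esub> a) \<odot>\<^bsub>A\<^esub> d x) w)"
        by (rule fun_cong[OF fun_cong[OF finsum_cong_record]]) simp_all
      also have "\<dots> = pure (\<Oplus>\<^bsub>A\<^esub>x\<in>X. s (x \<otimes>\<^bsub>A\<^esub> a) \<odot>\<^bsub>A\<^esub> d x) w"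
        using a by (intro p.map_finsum[symmetric]) (auto simp: basis_closed dual_closed form_closed)
      also have "\<dots> = pure a w" using a by (simp only: expand_dual_basis)
      finally show "rel_trace IM IM ?\<theta> (pure a w) = pure a w" .
    qed
  qed
  obtain k where k: "linear_map A IM V k" "\<And>p. p \<in> P \<Longrightarrow> k p = h p"
    using extend_from_direct_summand[OF IM P h V] by blast
  have "submodule P A IM" using P by (simp add: direct_summand_def)
  then have P_sub: "P \<subseteq> carrier IM" using subgroup.subset[OF submodule.axioms(1)] by fastforce
  have g_lin: "linear_map A U IM g" and gP: "\<And>u. u \<in> carrier U \<Longrightarrow> g u \<in> P"
    using g P_sub by (auto simp: module_homs_def intro!: linear_mapI[OF U IM])
  have "linear_map R (restrict_scalars A U) (restrict_scalars A V) (\<lambda>u. k (?\<theta> (g u)))"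
    by (rule linear_map_comp[OF linear_map_comp[OF linear_map_restrict_scalars[OF g_lin] \<theta>]
          linear_map_restrict_scalars[OF k(1)]])
  moreover have "f u = rel_trace U V (\<lambda>u. k (?\<theta> (g u))) u" if u: "u \<in> carrier U" for u
  proof -
    have gu: "g u \<in> carrier T" using linear_map.closed[OF g_lin u] by simp
    have "f u = k (g u)" using u by (simp add: f compose_def k(2) gP)
    also have "\<dots> = k (rel_trace IM IM ?\<theta> (g u))" by (simp only: id[OF gu])
    also have "\<dots> = k (rel_trace U IM (\<lambda>u. ?\<theta> (g u)) u)"
      by (simp only: rel_trace_comp_right[OF IM IM \<theta> g_lin u])
    also have "\<dots> = rel_trace U V (\<lambda>u. k (?\<theta> (g u))) u"
      by (rule rel_trace_comp_left[OF U IM linear_map_comp[OF linear_map_restrict_scalars[OF g_lin] \<theta>] k(1) u])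
    finally show ?thesis .
  qed
  ultimately show thesis by (rule that)
qed

text \<open>
  The relative trace of \<open>\<tau>\<close> is the composite of \<open>u \<mapsto> \<Sum> d x \<otimes> \<tau> (x u)\<close>, which is itself the relative trace
  of \<open>u \<mapsto> 1 \<otimes> \<tau> u\<close> and hence \<open>A\<close>-linear, with the action map \<open>a \<otimes> v \<mapsto> a v\<close>. The module \<open>V\<close> is moved
  along \<open>j\<close> to the type in which \<^const>\<open>projective_homs\<close> looks for it.
\<close>

lemma projective_if_rel_trace:
  fixes U :: "('a, 'u) module" and V :: "('a, 'v) module" and j :: "'v \<Rightarrow> 'w"
  assumes U: "left_module A U" and V: "left_module A V"
    and \<tau>: "linear_map R (restrict_scalars A U) (restrict_scalars A V) \<tau>"
    and j: "inj_on j (carrier V)"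
  shows "restrict (rel_trace U V \<tau>) (carrier U) \<in> projective_homs TYPE('w) R A U V"
proof -
  let ?V = "restrict_scalars A V"
  define W where "W = module_copy j ?V"
  define i where "i = the_inv_into (carrier ?V) j"
  have j': "inj_on j (carrier ?V)" using j by simp
  note VR = module_restrict_scalars[OF V]
  note copy = module_copy[OF VR j', folded W_def i_def]
  interpret V: left_module A V by fact
  interpret scalar_induction R A W
    using copy(1) by (intro scalar_induction.intro record_algebra_axioms)
  interpret \<tau>: linear_map R "restrict_scalars A U" ?V \<tau> by fact
  interpret j: linear_map R ?V W j by (rule copy(2))
  interpret i: linear_map R W ?V i by (rule copy(3))
  have ij: "i (j v) = v" if "v \<in> carrier V" for v
    using the_inv_into_f_f[OF j'] that by (simp add: i_def)
  have ic: "i w \<in> carrier V" if "w \<in> carrier W" for w using i.closed[OF that] by simp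
  note IM = left_module_induced
  let ?\<tau>' = "\<lambda>u. pure \<one>\<^bsub>A\<^esub> (j (\<tau> u))"
  have "linear_map R W T (\<lambda>w. pure \<one>\<^bsub>A\<^esub> w)"
    by (rule linear_mapI[OF left_module_if_module[OF W.module_axioms] left_module_T])
      (simp_all add: pure_closed pure_add_right pure_smult_right)
  then have \<tau>': "linear_map R (restrict_scalars A U) (restrict_scalars A IM) ?\<tau>'"
    by (rule linear_map_into_T[OF linear_map_comp[OF linear_map_comp[OF \<tau> copy(2)]]])
  let ?h = "tensor_lift R ?V (\<lambda>a w. a \<odot>\<^bsub>V\<^esub> i w)"
  have b: "bilinear_map R A W ?V (\<lambda>a w. a \<odot>\<^bsub>V\<^esub> i w)"
    using i.map_add i.map_smult
    by (simp add: bilinear_map_def ic V.smult_closed V.smult_l_distr V.smult_r_distr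
        V.smult_assoc1[symmetric] scalar_mult mult_scalar)
  interpret h: linear_map R T ?V ?h by (rule tensor.tensor_lift_linear[OF VR b])
  have h_pure: "?h (pure a w) = a \<odot>\<^bsub>V\<^esub> i w" if "a \<in> carrier A" "w \<in> carrier W" for a w
    by (rule tensor.tensor_lift_pure[OF VR b that])
  have h_lin: "linear_map A IM V ?h"
  proof (rule linear_mapI[OF IM V])
    fix t assume "t \<in> carrier IM"
    then have t: "t \<in> carrier T" by simp
    show "?h t \<in> carrier V" using h.closed[OF t] by simp
    show "?h (t \<oplus>\<^bsub>IM\<^esub> t') = ?h t \<oplus>\<^bsub>V\<^esub> ?h t'" if "t' \<in> carrier IM" for t'
      using h.map_add[OF t] that by simp
    fix a assume a: "a \<in> carrier A"
    show "?h (a \<odot>\<^bsub>IM\<^esub> t) = a \<odot>\<^bsub>V\<^esub> ?h t"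
    proof (rule tensor.tensor_ext[OF _ _ _ t])
      show "linear_map R T ?V (\<lambda>t. ?h (a \<odot>\<^bsub>IM\<^esub> t))"
        by (rule linear_map_comp[OF induced_action_linear[OF a] h.linear_map_axioms])
      show "linear_map R T ?V (\<lambda>t. a \<odot>\<^bsub>V\<^esub> ?h t)"
        by (rule linear_map_comp[OF h.linear_map_axioms linear_map_action[OF V a]])
      show "?h (a \<odot>\<^bsub>IM\<^esub> pure c w) = a \<odot>\<^bsub>V\<^esub> ?h (pure c w)"
        if "c \<in> carrier A" "w \<in> carrier W" for c w
        using a that by (simp add: induced_action_pure h_pure V.smult_assoc1 ic)
    qed
  qed
  let ?g = "restrict (rel_trace U IM ?\<tau>') (carrier U)"
  have g: "?g \<in> module_homs A U IM"
    by (rule module_homs_restrict[OF rel_trace_linear[OF U IM \<tau>']])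
  have h: "restrict ?h (carrier IM) \<in> module_homs A IM V"
    by (rule module_homs_restrict[OF h_lin])
  have IM_upd: "IM\<lparr>carrier := carrier T\<rparr> = IM" by (simp add: induced_module_def Let_def)
  have sum: "direct_summand A (carrier T) IM"
    using left_module.direct_summand_carrier[OF IM] by simp
  have eq: "restrict (rel_trace U V \<tau>) (carrier U) = compose (carrier U) (restrict ?h (carrier IM)) ?g"
  proof (rule extensionalityI[where A = "carrier U"])
    fix u assume u: "u \<in> carrier U"
    have "?h (rel_trace U IM ?\<tau>' u) = rel_trace U V (\<lambda>u. ?h (?\<tau>' u)) u"
      by (rule rel_trace_comp_left[OF U IM \<tau>' h_lin u])
    also have "\<dots> = rel_trace U V \<tau> u"
    proof -
      interpret U: left_module A U by fact
      have "?h (?\<tau>' u) = \<tau> u" if "u \<in> carrier U" for u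
        using \<tau>.closed[of u] j.closed[of "\<tau> u"] that by (simp add: h_pure ij V.smult_one)
      then show ?thesis
        unfolding rel_trace_def using u \<tau>.closed
        by (intro V.M.finsum_cong') (auto simp: basis_closed dual_closed U.smult_closed V.smult_closed)
    qed
    finally show "restrict (rel_trace U V \<tau>) (carrier U) u = compose (carrier U) (restrict ?h (carrier IM)) ?g u"
      using u g by (simp add: compose_def linear_map.closed[OF rel_trace_linear[OF U IM \<tau>'], simplified])
  qed (auto simp: compose_def)
  show ?thesis
    unfolding projective_homs_def
  proof (intro CollectI conjI exI)
    show "restrict (rel_trace U V \<tau>) (carrier U) \<in> module_homs A U V"
      by (rule module_homs_restrict[OF rel_trace_linear[OF U V \<tau>]])
    show "module R W" by (rule copy(1))
    show "direct_summand A (carrier T) IM" by (rule sum)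
    show "?g \<in> module_homs A U (IM\<lparr>carrier := carrier T\<rparr>)" unfolding IM_upd by (rule g)
    show "restrict ?h (carrier IM) \<in> module_homs A (IM\<lparr>carrier := carrier T\<rparr>) V"
      unfolding IM_upd by (rule h)
  qed (rule eq)
qed

end

section \<open>The trace pairing on stable homomorphisms\<close>

text \<open>
  A bilinear map that takes values in \<open>SP\<close> as soon as one argument lies in its submodule is constant
  modulo \<open>SP\<close> on pairs of cosets, so it may be evaluated at any representatives.
\<close>

lemma pairing_on_quotients:
  assumes M: "module R M" and N: "module R N" and P: "module R P"
    and SM: "submodule SM R M" and SN: "submodule SN R N" and SP: "submodule SP R P"
    and t: "bilinear_map R M N P t"
    and left: "\<And>x y. \<lbrakk>x \<in> SM; y \<in> carrier N\<rbrakk> \<Longrightarrow> t x y \<in> SP"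
    and right: "\<And>x y. \<lbrakk>x \<in> carrier M; y \<in> SN\<rbrakk> \<Longrightarrow> t x y \<in> SP"
    and nd_left: "\<And>x. \<lbrakk>x \<in> carrier M; \<And>y. y \<in> carrier N \<Longrightarrow> t x y \<in> SP\<rbrakk> \<Longrightarrow> x \<in> SM"
    and nd_right: "\<And>y. \<lbrakk>y \<in> carrier N; \<And>x. x \<in> carrier M \<Longrightarrow> t x y \<in> SP\<rbrakk> \<Longrightarrow> y \<in> SN"
  shows "\<exists>b. bilinear_map R (quotient_module M SM) (quotient_module N SN) (quotient_module P SP) b \<and>
     (\<forall>x\<in>carrier M. \<forall>y\<in>carrier N. b (SM +>\<^bsub>M\<^esub> x) (SN +>\<^bsub>N\<^esub> y) = SP +>\<^bsub>P\<^esub> t x y) \<and>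
     nondegenerate (quotient_module M SM) (quotient_module N SN) (quotient_module P SP) b"
proof -
  interpret M: module R M by fact
  interpret N: module R N by fact
  interpret P: module R P by fact
  interpret SM: abelian_subgroup SM M by (rule M.abelian_subgroup_submodule[OF SM])
  interpret SN: abelian_subgroup SN N by (rule N.abelian_subgroup_submodule[OF SN])
  interpret SP: abelian_subgroup SP P by (rule P.abelian_subgroup_submodule[OF SP])
  have mods: "left_module R M" "left_module R N" "left_module R P"
    using M N P by (auto intro: left_module_if_module)
  have tc: "t x y \<in> carrier P" if "x \<in> carrier M" "y \<in> carrier N" for x y
    using t that by (simp add: bilinear_map_def)
  have tl: "linear_map R M P (\<lambda>x. t x y)" if "y \<in> carrier N" for y
    using t that by (intro linear_mapI[OF mods(1,3)]) (simp_all add: bilinear_map_def)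
  have tr: "linear_map R N P (\<lambda>y. t x y)" if "x \<in> carrier M" for x
    using t that by (intro linear_mapI[OF mods(2,3)]) (simp_all add: bilinear_map_def)
  have t_add_left: "t (x \<oplus>\<^bsub>M\<^esub> x') y = t x y \<oplus>\<^bsub>P\<^esub> t x' y" if "x \<in> carrier M" "x' \<in> carrier M" "y \<in> carrier N" for x x' y
    using t that by (simp add: bilinear_map_def)
  have t_add_right: "t x (y \<oplus>\<^bsub>N\<^esub> y') = t x y \<oplus>\<^bsub>P\<^esub> t x y'" if "x \<in> carrier M" "y \<in> carrier N" "y' \<in> carrier N" for x y y'
    using t that by (simp add: bilinear_map_def)
  have t_smult_left: "t (r \<odot>\<^bsub>M\<^esub> x) y = r \<odot>\<^bsub>P\<^esub> t x y" if "r \<in> carrier R" "x \<in> carrier M" "y \<in> carrier N" for r x y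
    using t that by (simp add: bilinear_map_def)
  have t_smult_right: "t x (r \<odot>\<^bsub>N\<^esub> y) = r \<odot>\<^bsub>P\<^esub> t x y" if "r \<in> carrier R" "x \<in> carrier M" "y \<in> carrier N" for r x y
    using t that by (simp add: bilinear_map_def)
  let ?b = "\<lambda>C D. SP +>\<^bsub>P\<^esub> t (SOME x. x \<in> C) (SOME y. y \<in> D)"
  have b: "?b (SM +>\<^bsub>M\<^esub> x) (SN +>\<^bsub>N\<^esub> y) = SP +>\<^bsub>P\<^esub> t x y" if x: "x \<in> carrier M" and y: "y \<in> carrier N" for x y
  proof -
    define x' where "x' = (SOME x'. x' \<in> SM +>\<^bsub>M\<^esub> x)"
    define y' where "y' = (SOME y'. y' \<in> SN +>\<^bsub>N\<^esub> y)"
    have x': "x' \<in> SM +>\<^bsub>M\<^esub> x" unfolding x'_def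
      by (rule someI[where P = "\<lambda>x'. x' \<in> SM +>\<^bsub>M\<^esub> x"]) (rule SM.a_rcos_self[OF x])
    have y': "y' \<in> SN +>\<^bsub>N\<^esub> y" unfolding y'_def
      by (rule someI[where P = "\<lambda>y'. y' \<in> SN +>\<^bsub>N\<^esub> y"]) (rule SN.a_rcos_self[OF y])
    have x'M: "x' \<in> carrier M" using x' x SM.a_elemrcos_carrier by blast
    have y'N: "y' \<in> carrier N" using y' y SN.a_elemrcos_carrier by blast
    have "x' \<ominus>\<^bsub>M\<^esub> x \<in> SM" using SM.a_rcos_module_imp[OF x x'] by (simp add: M.M.minus_eq)
    from left[OF this y'N] have "t x' y' \<ominus>\<^bsub>P\<^esub> t x y' \<in> SP"
      by (simp add: linear_map.map_diff[OF tl[OF y'N] x'M x])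
    then have 1: "SP +>\<^bsub>P\<^esub> t x' y' = SP +>\<^bsub>P\<^esub> t x y'"
      using P.coset_eq_iff[OF SP tc[OF x'M y'N] tc[OF x y'N]] by blast
    have "y' \<ominus>\<^bsub>N\<^esub> y \<in> SN" using SN.a_rcos_module_imp[OF y y'] by (simp add: N.M.minus_eq)
    from right[OF x this] have "t x y' \<ominus>\<^bsub>P\<^esub> t x y \<in> SP"
      by (simp add: linear_map.map_diff[OF tr[OF x] y'N y])
    then have "SP +>\<^bsub>P\<^esub> t x y' = SP +>\<^bsub>P\<^esub> t x y"
      using P.coset_eq_iff[OF SP tc[OF x y'N] tc[OF x y]] by blast
    with 1 show ?thesis by (simp add: x'_def y'_def)
  qed
  have zero: "t x y \<in> SP" if "x \<in> carrier M" "y \<in> carrier N" "SP +>\<^bsub>P\<^esub> t x y = SP" for x y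
    using SP.a_rcos_self[OF tc[OF that(1,2)]] that(3) by simp
  have bil: "bilinear_map R (quotient_module M SM) (quotient_module N SN) (quotient_module P SP) ?b"
    unfolding bilinear_map_def M.quotient_module_simps N.quotient_module_simps P.quotient_module_simps
    by (intro conjI ballI; elim imageE)
      (simp_all add: M.quotient_module_add[OF SM] M.quotient_module_smult[OF SM]
        N.quotient_module_add[OF SN] N.quotient_module_smult[OF SN]
        P.quotient_module_add[OF SP] P.quotient_module_smult[OF SP]
        b tc t_add_left t_add_right t_smult_left t_smult_right)
  have nondeg: "nondegenerate (quotient_module M SM) (quotient_module N SN) (quotient_module P SP) ?b"
    unfolding nondegenerate_def M.quotient_module_simps N.quotient_module_simps P.quotient_module_simps
  proof (intro conjI ballI impI; elim imageE; hypsubst)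
    fix x assume x: "x \<in> carrier M" and all: "\<forall>D\<in>(\<lambda>y. SN +>\<^bsub>N\<^esub> y) ` carrier N. ?b (SM +>\<^bsub>M\<^esub> x) D = SP"
    have "t x y \<in> SP" if y: "y \<in> carrier N" for y
      using all y b[OF x y] by (intro zero[OF x y]) auto
    then show "SM +>\<^bsub>M\<^esub> x = SM" using nd_left[OF x] SM.a_rcos_const by blast
  next
    fix y assume y: "y \<in> carrier N" and all: "\<forall>C\<in>(\<lambda>x. SM +>\<^bsub>M\<^esub> x) ` carrier M. ?b C (SN +>\<^bsub>N\<^esub> y) = SP"
    have "t x y \<in> SP" if x: "x \<in> carrier M" for x
      using all x b[OF x y] by (intro zero[OF x y]) auto
    then show "SN +>\<^bsub>N\<^esub> y = SN" using nd_right[OF y] SN.a_rcos_const by blast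
  qed
  from bil b nondeg show ?thesis by blast
qed

lemma hom_module_simps:
  "carrier (hom_module A U V) = module_homs A U V"
  "\<zero>\<^bsub>hom_module A U V\<^esub> = (\<lambda>u\<in>carrier U. \<zero>\<^bsub>V\<^esub>)"
  "f \<oplus>\<^bsub>hom_module A U V\<^esub> g = (\<lambda>u\<in>carrier U. f u \<oplus>\<^bsub>V\<^esub> g u)"
  "r \<odot>\<^bsub>hom_module A U V\<^esub> f = (\<lambda>u\<in>carrier U. (r \<odot>\<^bsub>A\<^esub> \<one>\<^bsub>A\<^esub>) \<odot>\<^bsub>V\<^esub> f u)"
  by (simp_all add: hom_module_def)

context record_algebra
begin

lemma linear_map_add:
  assumes "linear_map A U V f" "linear_map A U V g"
  shows "linear_map A U V (\<lambda>u. f u \<oplus>\<^bsub>V\<^esub> g u)"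
proof -
  interpret f: linear_map A U V f by fact
  interpret g: linear_map A U V g by fact
  show ?thesis
    by (rule linear_mapI[OF f.M.left_module_axioms f.N.left_module_axioms])
      (simp_all add: f.closed g.closed f.map_add g.map_add f.map_smult g.map_smult f.N.smult_r_distr
        f.N.M.a_ac)
qed

lemma linear_map_scalar:
  assumes "linear_map A U V f" and r: "r \<in> carrier R"
  shows "linear_map A U V (\<lambda>u. (r \<odot>\<^bsub>A\<^esub> \<one>\<^bsub>A\<^esub>) \<odot>\<^bsub>V\<^esub> f u)"
proof -
  interpret f: linear_map A U V f by fact
  show ?thesis using r
    by (intro linear_mapI[OF f.M.left_module_axioms f.N.left_module_axioms])
      (simp_all add: f.closed f.map_add f.map_smult f.N.smult_closed f.N.smult_r_distr
        f.N.smult_assoc1[symmetric] scalar_mult mult_scalar)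
qed

lemma module_hom_module:
  fixes U :: "('a, 'u) module" and V :: "('a, 'v) module"
  assumes U: "left_module A U" and V: "left_module A V"
  shows "module R (hom_module A U V)"
proof -
  interpret V: left_module A V by (rule V)
  let ?H = "hom_module A U V"
  have homs: "f \<in> module_homs A U V \<longleftrightarrow> linear_map A U V f \<and> f \<in> extensional (carrier U)" for f
    by (rule module_homs_iff[OF U V])
  have ext: "f = g" if "f \<in> module_homs A U V" "g \<in> extensional (carrier U)"
    "\<And>u. u \<in> carrier U \<Longrightarrow> f u = g u" for f g
    using that by (auto simp: homs intro: extensionalityI)
  have c: "f u \<in> carrier V" if "f \<in> module_homs A U V" "u \<in> carrier U" for f u
    using that by (auto simp: homs intro: linear_map.closed)
  have add: "(\<lambda>u\<in>carrier U. f u \<oplus>\<^bsub>V\<^esub> g u) \<in> module_homs A U V"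
    if "f \<in> module_homs A U V" "g \<in> module_homs A U V" for f g
    using that by (intro module_homs_restrict linear_map_add) (simp_all add: homs)
  have smult: "(\<lambda>u\<in>carrier U. (r \<odot>\<^bsub>A\<^esub> \<one>\<^bsub>A\<^esub>) \<odot>\<^bsub>V\<^esub> f u) \<in> module_homs A U V"
    if "r \<in> carrier R" "f \<in> module_homs A U V" for r f
    using that by (intro module_homs_restrict linear_map_scalar) (simp_all add: homs)
  have scalar0: "(\<zero>\<^bsub>R\<^esub> \<odot>\<^bsub>A\<^esub> \<one>\<^bsub>A\<^esub>) \<odot>\<^bsub>V\<^esub> v = \<zero>\<^bsub>V\<^esub>" if "v \<in> carrier V" for v
    using module.smult_l_null[OF module_restrict_scalars[OF V], of v] that by simp
  have a0: "a \<odot>\<^bsub>V\<^esub> \<zero>\<^bsub>V\<^esub> = \<zero>\<^bsub>V\<^esub>" if "a \<in> carrier A" for a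
    using linear_map.map_zero[OF linear_map_action[OF V that]] by simp
  have zero: "(\<lambda>u\<in>carrier U. \<zero>\<^bsub>V\<^esub>) \<in> module_homs A U V"
    by (rule module_homs_restrict, rule linear_mapI[OF U V]) (simp_all add: a0)
  have "abelian_group ?H"
  proof (rule abelian_groupI)
    fix f assume "f \<in> carrier ?H"
    then have f: "f \<in> module_homs A U V" by (simp add: hom_module_simps)
    let ?g = "\<lambda>u\<in>carrier U. ((\<ominus>\<^bsub>R\<^esub> \<one>\<^bsub>R\<^esub>) \<odot>\<^bsub>A\<^esub> \<one>\<^bsub>A\<^esub>) \<odot>\<^bsub>V\<^esub> f u"
    have g: "?g \<in> module_homs A U V" using f by (intro smult) auto
    have neg: "((\<ominus>\<^bsub>R\<^esub> \<one>\<^bsub>R\<^esub>) \<odot>\<^bsub>A\<^esub> \<one>\<^bsub>A\<^esub>) \<odot>\<^bsub>V\<^esub> v \<oplus>\<^bsub>V\<^esub> v = \<zero>\<^bsub>V\<^esub>" if v: "v \<in> carrier V" for v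
    proof -
      interpret VR: module R "restrict_scalars A V" by (rule module_restrict_scalars[OF V])
      have "((\<ominus>\<^bsub>R\<^esub> \<one>\<^bsub>R\<^esub>) \<oplus>\<^bsub>R\<^esub> \<one>\<^bsub>R\<^esub>) \<odot>\<^bsub>restrict_scalars A V\<^esub> v = \<zero>\<^bsub>V\<^esub>"
        using v scalar0 by (simp add: R.l_neg)
      then show ?thesis
        using VR.smult_l_distr[of "\<ominus>\<^bsub>R\<^esub> \<one>\<^bsub>R\<^esub>" "\<one>\<^bsub>R\<^esub>" v] v by (simp add: V.smult_one)
    qed
    have "?g \<oplus>\<^bsub>?H\<^esub> f = \<zero>\<^bsub>?H\<^esub>"
      unfolding hom_module_simps by (rule ext[OF add[OF g f]]) (simp_all add: neg c[OF f])
    with g show "\<exists>g\<in>carrier ?H. g \<oplus>\<^bsub>?H\<^esub> f = \<zero>\<^bsub>?H\<^esub>" unfolding hom_module_simps(1) by blast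
    show "\<zero>\<^bsub>?H\<^esub> \<oplus>\<^bsub>?H\<^esub> f = f"
      unfolding hom_module_simps using f[unfolded homs] c[OF f]
      by (intro ext[OF add[OF zero f]]) simp_all
  next
    fix f g assume "f \<in> carrier ?H" "g \<in> carrier ?H"
    then have fg: "f \<in> module_homs A U V" "g \<in> module_homs A U V" by (simp_all add: hom_module_simps)
    then show "f \<oplus>\<^bsub>?H\<^esub> g \<in> carrier ?H" unfolding hom_module_simps by (rule add)
    show "f \<oplus>\<^bsub>?H\<^esub> g = g \<oplus>\<^bsub>?H\<^esub> f"
      unfolding hom_module_simps using fg by (intro ext[OF add]) (simp_all add: c V.M.a_comm)
    fix h assume "h \<in> carrier ?H"
    then have h: "h \<in> module_homs A U V" by (simp add: hom_module_simps)
    show "f \<oplus>\<^bsub>?H\<^esub> g \<oplus>\<^bsub>?H\<^esub> h = f \<oplus>\<^bsub>?H\<^esub> (g \<oplus>\<^bsub>?H\<^esub> h)"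
      unfolding hom_module_simps using fg h
      by (intro ext[OF add[OF add]]) (simp_all add: c V.M.a_assoc)
  qed (unfold hom_module_simps, rule zero)
  then show ?thesis
  proof (rule moduleI[OF R.is_cring])
    fix r f assume r: "r \<in> carrier R" and "f \<in> carrier ?H"
    then have f: "f \<in> module_homs A U V" by (simp add: hom_module_simps)
    show "r \<odot>\<^bsub>?H\<^esub> f \<in> carrier ?H" unfolding hom_module_simps using r f by (rule smult)
    show "(r \<oplus>\<^bsub>R\<^esub> q) \<odot>\<^bsub>?H\<^esub> f = r \<odot>\<^bsub>?H\<^esub> f \<oplus>\<^bsub>?H\<^esub> q \<odot>\<^bsub>?H\<^esub> f" if q: "q \<in> carrier R" for q
      unfolding hom_module_simps using r q f
      by (intro ext[OF smult]) (simp_all add: c smult_l_distr V.smult_l_distr)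
    show "(r \<otimes>\<^bsub>R\<^esub> q) \<odot>\<^bsub>?H\<^esub> f = r \<odot>\<^bsub>?H\<^esub> (q \<odot>\<^bsub>?H\<^esub> f)" if q: "q \<in> carrier R" for q
      unfolding hom_module_simps using r q f
      by (intro ext[OF smult]) (simp_all add: c smult_assoc1 V.smult_assoc1[symmetric] scalar_mult)
    show "r \<odot>\<^bsub>?H\<^esub> (f \<oplus>\<^bsub>?H\<^esub> g) = r \<odot>\<^bsub>?H\<^esub> f \<oplus>\<^bsub>?H\<^esub> r \<odot>\<^bsub>?H\<^esub> g" if "g \<in> carrier ?H" for g
    proof -
      have g: "g \<in> module_homs A U V" using that by (simp add: hom_module_simps)
      show ?thesis unfolding hom_module_simps using r f g
        by (intro ext[OF smult[OF _ add]]) (simp_all add: c V.smult_r_distr)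
    qed
  next
    fix f assume "f \<in> carrier ?H"
    then have f: "f \<in> module_homs A U V" by (simp add: hom_module_simps)
    show "\<one>\<^bsub>R\<^esub> \<odot>\<^bsub>?H\<^esub> f = f"
      unfolding hom_module_simps using f[unfolded homs] c[OF f]
      by (intro ext[OF smult[OF R.one_closed f]]) (simp_all add: V.smult_one)
  qed
qed

lemma trace_pairing_bilinear:
  fixes U :: "('a, 'u) module" and V :: "('a, 'v) module"
  assumes U: "left_module A U" "free_finite_rank R (restrict_scalars A U)" and V: "left_module A V"
  shows "bilinear_map R (hom_module A U V) (hom_module A V U) (regular_module R)
    (\<lambda>\<alpha> \<beta>. linear_trace R (restrict_scalars A U) (\<lambda>u. \<beta> (\<alpha> u)))"
  unfolding bilinear_map_def
proof (intro conjI ballI)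
  let ?U = "restrict_scalars A U"
  interpret U: left_module A U by (rule U(1))
  interpret V: left_module A V by (rule V(1))
  interpret U': module R ?U by (rule module_restrict_scalars[OF U(1)])
  fix \<alpha> \<beta> assume \<alpha>: "\<alpha> \<in> carrier (hom_module A U V)" and \<beta>: "\<beta> \<in> carrier (hom_module A V U)"
  note homs = hom_module_simps(1) module_homs_iff[OF U(1) V(1)] module_homs_iff[OF V(1) U(1)]
  have \<alpha>c: "\<alpha> u \<in> carrier V" if "\<alpha> \<in> carrier (hom_module A U V)" "u \<in> carrier U" for \<alpha> u
    using linear_map.closed[of A U V \<alpha> u] that by (simp add: homs)
  have \<beta>\<alpha>: "\<beta> (\<alpha> u) \<in> carrier ?U"
    if "\<alpha> \<in> carrier (hom_module A U V)" "\<beta> \<in> carrier (hom_module A V U)" "u \<in> carrier ?U" for \<alpha> \<beta> u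
    using linear_map.closed[of A V U \<beta> "\<alpha> u"] \<alpha>c that by (simp add: homs)
  interpret \<beta>: linear_map A V U \<beta> using \<beta> by (simp add: homs)
  let ?t = "\<lambda>\<alpha> \<beta>. linear_trace R ?U (\<lambda>u. \<beta> (\<alpha> u))"
  note cong = U'.linear_trace_cong[OF U(2)]
  show "?t \<alpha> \<beta> \<in> carrier (regular_module R)"
    using U'.linear_trace_closed[OF U(2) \<beta>\<alpha>[OF \<alpha> \<beta>]] by simp
  show "?t (\<alpha> \<oplus>\<^bsub>hom_module A U V\<^esub> \<alpha>') \<beta> = ?t \<alpha> \<beta> \<oplus>\<^bsub>regular_module R\<^esub> ?t \<alpha>' \<beta>"
    if \<alpha>': "\<alpha>' \<in> carrier (hom_module A U V)" for \<alpha>'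
  proof -
    have "?t (\<alpha> \<oplus>\<^bsub>hom_module A U V\<^esub> \<alpha>') \<beta> = linear_trace R ?U (\<lambda>u. \<beta> (\<alpha> u) \<oplus>\<^bsub>?U\<^esub> \<beta> (\<alpha>' u))"
      using \<alpha>c[OF \<alpha>] \<alpha>c[OF \<alpha>'] \<beta>.closed
      by (intro cong) (simp_all add: hom_module_simps(3) \<beta>.map_add)
    then show ?thesis
      using U'.linear_trace_add[OF U(2) \<beta>\<alpha>[OF \<alpha> \<beta>] \<beta>\<alpha>[OF \<alpha>' \<beta>]] by simp
  qed
  show "?t \<alpha> (\<beta> \<oplus>\<^bsub>hom_module A V U\<^esub> \<beta>') = ?t \<alpha> \<beta> \<oplus>\<^bsub>regular_module R\<^esub> ?t \<alpha> \<beta>'"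
    if \<beta>': "\<beta>' \<in> carrier (hom_module A V U)" for \<beta>'
  proof -
    have "?t \<alpha> (\<beta> \<oplus>\<^bsub>hom_module A V U\<^esub> \<beta>') = linear_trace R ?U (\<lambda>u. \<beta> (\<alpha> u) \<oplus>\<^bsub>?U\<^esub> \<beta>' (\<alpha> u))"
      using \<alpha>c[OF \<alpha>] \<beta>\<alpha>[OF \<alpha> \<beta>] \<beta>\<alpha>[OF \<alpha> \<beta>']
      by (intro cong) (simp_all add: hom_module_simps(3))
    then show ?thesis
      using U'.linear_trace_add[OF U(2) \<beta>\<alpha>[OF \<alpha> \<beta>] \<beta>\<alpha>[OF \<alpha> \<beta>']] by simp
  qed
  fix r assume r: "r \<in> carrier R"
  have smult: "linear_trace R ?U (\<lambda>u. r \<odot>\<^bsub>?U\<^esub> \<beta> (\<alpha> u)) = r \<odot>\<^bsub>regular_module R\<^esub> ?t \<alpha> \<beta>"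
    using U'.linear_trace_smult[OF U(2) r \<beta>\<alpha>[OF \<alpha> \<beta>]] by simp
  have "?t (r \<odot>\<^bsub>hom_module A U V\<^esub> \<alpha>) \<beta> = linear_trace R ?U (\<lambda>u. r \<odot>\<^bsub>?U\<^esub> \<beta> (\<alpha> u))"
    using \<alpha>c[OF \<alpha>] \<beta>.closed r
    by (intro cong) (simp_all add: hom_module_simps(4) \<beta>.map_smult U.smult_closed)
  then show "?t (r \<odot>\<^bsub>hom_module A U V\<^esub> \<alpha>) \<beta> = r \<odot>\<^bsub>regular_module R\<^esub> ?t \<alpha> \<beta>"
    by (rule trans[OF _ smult])
  have "?t \<alpha> (r \<odot>\<^bsub>hom_module A V U\<^esub> \<beta>) = linear_trace R ?U (\<lambda>u. r \<odot>\<^bsub>?U\<^esub> \<beta> (\<alpha> u))"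
    using \<alpha>c[OF \<alpha>] \<beta>.closed r
    by (intro cong) (simp_all add: hom_module_simps(4) U.smult_closed)
  then show "?t \<alpha> (r \<odot>\<^bsub>hom_module A V U\<^esub> \<beta>) = r \<odot>\<^bsub>regular_module R\<^esub> ?t \<alpha> \<beta>"
    by (rule trans[OF _ smult])
qed

end

context dual_bases_algebra
begin

text \<open>
  Relative traces are additive and homogeneous in the linear map, which is how sums and multiples of
  projective homomorphisms are seen to be projective.
\<close>

lemma submodule_projective_homs:
  fixes U :: "('a, 'u) module" and V :: "('a, 'v) module" and j :: "'v \<Rightarrow> 'w"
  assumes U: "left_module A U" and V: "left_module A V" and j: "inj_on j (carrier V)"
  shows "submodule (projective_homs TYPE('w) R A U V) R (hom_module A U V)"
proof -
  interpret H: module R "hom_module A U V" by (rule module_hom_module[OF U V])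
  let ?P = "projective_homs TYPE('w) R A U V"
  let ?U = "restrict_scalars A U" and ?V = "restrict_scalars A V"
  interpret V: left_module A V by (rule V)
  interpret U: left_module A U by (rule U)
  note UR = left_module_restrict_scalars[OF U] and VR = left_module_restrict_scalars[OF V]
  interpret V': module R ?V by (rule module_restrict_scalars[OF V])
  have P: "f \<in> ?P" if "f \<in> module_homs A U V" "linear_map R ?U ?V \<tau>"
    "\<And>u. u \<in> carrier U \<Longrightarrow> f u = rel_trace U V \<tau> u" for f \<tau>
  proof -
    have "f = restrict (rel_trace U V \<tau>) (carrier U)"
      using that(1,3) by (auto simp: module_homs_iff[OF U V] intro: extensionalityI)
    then show ?thesis using projective_if_rel_trace[OF U V that(2) j] by simp
  qed
  have sub: "?P \<subseteq> module_homs A U V" by (auto simp: projective_homs_def)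
  note trace = rel_trace_if_projective[OF U V]
  show ?thesis
  proof (rule H.submoduleI_nonempty)
    show "?P \<subseteq> carrier (hom_module A U V)" using sub by (simp add: hom_module_simps)
    have "linear_map R ?U ?V (\<lambda>_. \<zero>\<^bsub>V\<^esub>)"
      using linear_map_finsum[OF UR VR, of "{}" "\<lambda>_ _. \<zero>\<^bsub>V\<^esub>"] by simp
    from projective_if_rel_trace[OF U V this j] show "?P \<noteq> {}" by blast
    fix f assume f: "f \<in> ?P"
    obtain \<tau> where \<tau>: "linear_map R ?U ?V \<tau>" "\<And>u. u \<in> carrier U \<Longrightarrow> f u = rel_trace U V \<tau> u"
      using trace[OF f] by blast
    interpret \<tau>: linear_map R ?U ?V \<tau> by (rule \<tau>(1))
    have \<tau>c: "\<tau> u \<in> carrier V" if "u \<in> carrier U" for u using \<tau>.closed that by simp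
    note cl = basis_closed dual_closed U.smult_closed V.smult_closed
    show "f \<oplus>\<^bsub>hom_module A U V\<^esub> g \<in> ?P" if g: "g \<in> ?P" for g
    proof -
      obtain \<sigma> where \<sigma>: "linear_map R ?U ?V \<sigma>" "\<And>u. u \<in> carrier U \<Longrightarrow> g u = rel_trace U V \<sigma> u"
        using trace[OF g] by blast
      interpret \<sigma>: linear_map R ?U ?V \<sigma> by (rule \<sigma>(1))
      have \<sigma>c: "\<sigma> u \<in> carrier V" if "u \<in> carrier U" for u using \<sigma>.closed that by simp
      show ?thesis
      proof (rule P)
        show "f \<oplus>\<^bsub>hom_module A U V\<^esub> g \<in> module_homs A U V"
          using H.M.a_closed f g sub by (auto simp: hom_module_simps(1))
        show "linear_map R ?U ?V (\<lambda>u. \<tau> u \<oplus>\<^bsub>V\<^esub> \<sigma> u)"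
          using \<tau>.map_add \<sigma>.map_add \<tau>.map_smult \<sigma>.map_smult V'.smult_r_distr V'.M.a_ac
          by (intro linear_mapI[OF UR VR]) (simp_all add: \<tau>c \<sigma>c V.smult_closed)
        fix u assume u: "u \<in> carrier U"
        have "rel_trace U V (\<lambda>u. \<tau> u \<oplus>\<^bsub>V\<^esub> \<sigma> u) u =
            (\<Oplus>\<^bsub>V\<^esub>x\<in>X. d x \<odot>\<^bsub>V\<^esub> \<tau> (x \<odot>\<^bsub>U\<^esub> u) \<oplus>\<^bsub>V\<^esub> d x \<odot>\<^bsub>V\<^esub> \<sigma> (x \<odot>\<^bsub>U\<^esub> u))"
          unfolding rel_trace_def using u
          by (intro V.M.finsum_cong') (auto simp: cl \<tau>c \<sigma>c V.smult_r_distr)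
        also have "\<dots> = rel_trace U V \<tau> u \<oplus>\<^bsub>V\<^esub> rel_trace U V \<sigma> u"
          unfolding rel_trace_def using u
          by (intro V.M.finsum_addf) (auto simp: cl \<tau>c \<sigma>c)
        finally show "(f \<oplus>\<^bsub>hom_module A U V\<^esub> g) u = rel_trace U V (\<lambda>u. \<tau> u \<oplus>\<^bsub>V\<^esub> \<sigma> u) u"
          using u by (simp add: hom_module_simps \<tau>(2) \<sigma>(2))
      qed
    qed
    show "r \<odot>\<^bsub>hom_module A U V\<^esub> f \<in> ?P" if r: "r \<in> carrier R" for r
    proof (rule P)
      show "r \<odot>\<^bsub>hom_module A U V\<^esub> f \<in> module_homs A U V"
        using H.smult_closed[OF r, of f] f sub by (auto simp: hom_module_simps(1))
      note r\<tau> = linear_map_smult[OF R.is_cring \<tau>(1) r]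
      show "linear_map R ?U ?V (\<lambda>u. r \<odot>\<^bsub>?V\<^esub> \<tau> u)" by (rule r\<tau>)
      fix u assume u: "u \<in> carrier U"
      have "rel_trace U V (\<lambda>u. r \<odot>\<^bsub>?V\<^esub> \<tau> u) u = (\<Oplus>\<^bsub>V\<^esub>x\<in>X. (r \<odot>\<^bsub>A\<^esub> \<one>\<^bsub>A\<^esub>) \<odot>\<^bsub>V\<^esub> (d x \<odot>\<^bsub>V\<^esub> \<tau> (x \<odot>\<^bsub>U\<^esub> u)))"
        unfolding rel_trace_def using u r
        by (intro V.M.finsum_cong')
          (auto simp: cl \<tau>c V.smult_assoc1[symmetric] scalar_mult mult_scalar)
      also have "\<dots> = (r \<odot>\<^bsub>A\<^esub> \<one>\<^bsub>A\<^esub>) \<odot>\<^bsub>V\<^esub> rel_trace U V \<tau> u"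
        unfolding rel_trace_def using u r
        by (intro V.finsum_smult[symmetric]) (auto simp: cl \<tau>c)
      finally show "(r \<odot>\<^bsub>hom_module A U V\<^esub> f) u = rel_trace U V (\<lambda>u. r \<odot>\<^bsub>?V\<^esub> \<tau> u) u"
        using u by (simp add: hom_module_simps \<tau>(2))
    qed
  qed
qed

text \<open>
  This is the purity of the homomorphisms among the linear maps: the pointwise quotient \<open>\<gamma>\<close> exists
  because it does so on a basis, and it commutes with \<open>A\<close> because \<open>r\<close> can be cancelled in \<open>U\<close>.
\<close>

lemma hom_divisible_if_coords_divisible:
  fixes U :: "('a, 'u) module" and V :: "('a, 'v) module"
  assumes R: "domain R" and U: "left_module A U" and V: "left_module A V"
    and Y: "is_basis R (restrict_scalars A U) Y" and Z: "is_basis R (restrict_scalars A V) Z"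
    and \<beta>: "\<beta> \<in> module_homs A V U" and r: "r \<in> carrier R" "r \<noteq> \<zero>\<^bsub>R\<^esub>"
    and div: "\<And>y z. \<lbrakk>y \<in> Y; z \<in> Z\<rbrakk> \<Longrightarrow> r divides\<^bsub>R\<^esub> coords R (restrict_scalars A U) Y (\<beta> z) y"
  shows "\<exists>\<gamma>\<in>module_homs A V U. \<beta> = r \<odot>\<^bsub>hom_module A V U\<^esub> \<gamma>"
proof -
  let ?U = "restrict_scalars A U" and ?V = "restrict_scalars A V"
  interpret R: domain R by (rule R)
  interpret U: left_module A U by (rule U)
  interpret V: left_module A V by (rule V)
  interpret U': module R ?U by (rule module_restrict_scalars[OF U])
  interpret V': module R ?V by (rule module_restrict_scalars[OF V])
  have \<beta>': "linear_map A V U \<beta>" "\<beta> \<in> extensional (carrier V)"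
    using \<beta> by (simp_all add: module_homs_iff[OF V U])
  interpret \<beta>: linear_map A V U \<beta> by (rule \<beta>'(1))
  have YZ: "Y \<subseteq> carrier U" "Z \<subseteq> carrier V" using Y Z by (simp_all add: is_basis_def)
  let ?c = "coords R ?V Z"
  have c: "?c v z \<in> carrier R" if "v \<in> carrier V" "z \<in> Z" for v z
    using V'.coords_basis(1)[OF Z, of v] that by auto
  define q where "q z y = (SOME q. q \<in> carrier R \<and> coords R ?U Y (\<beta> z) y = r \<otimes>\<^bsub>R\<^esub> q)" for z y
  have q: "q z y \<in> carrier R" "coords R ?U Y (\<beta> z) y = r \<otimes>\<^bsub>R\<^esub> q z y" if "y \<in> Y" "z \<in> Z" for y z
  proof -
    have "\<exists>q. q \<in> carrier R \<and> coords R ?U Y (\<beta> z) y = r \<otimes>\<^bsub>R\<^esub> q"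
      using div[OF that] unfolding factor_def by blast
    from someI_ex[OF this]
    show "q z y \<in> carrier R" "coords R ?U Y (\<beta> z) y = r \<otimes>\<^bsub>R\<^esub> q z y"
      by (simp_all only: q_def)
  qed
  have basis_value: "\<exists>w\<in>carrier U. \<beta> z = r \<odot>\<^bsub>?U\<^esub> w" if z: "z \<in> Z" for z
  proof
    have zV: "\<beta> z \<in> carrier ?U" using z YZ \<beta>.closed by auto
    have qc: "(\<lambda>y. q z y \<odot>\<^bsub>?U\<^esub> y) \<in> Y \<rightarrow> carrier ?U"
      using q(1) z YZ U'.smult_closed by auto
    show "(\<Oplus>\<^bsub>?U\<^esub>y\<in>Y. q z y \<odot>\<^bsub>?U\<^esub> y) \<in> carrier U"
      using U'.M.finsum_closed[OF qc] by simp
    have "\<beta> z = (\<Oplus>\<^bsub>?U\<^esub>y\<in>Y. coords R ?U Y (\<beta> z) y \<odot>\<^bsub>?U\<^esub> y)"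
      by (rule U'.coords_basis(2)[OF Y zV, symmetric])
    also have "\<dots> = (\<Oplus>\<^bsub>?U\<^esub>y\<in>Y. r \<odot>\<^bsub>?U\<^esub> (q z y \<odot>\<^bsub>?U\<^esub> y))"
    proof (rule U'.M.finsum_cong')
      show "(\<lambda>y. r \<odot>\<^bsub>?U\<^esub> (q z y \<odot>\<^bsub>?U\<^esub> y)) \<in> Y \<rightarrow> carrier ?U"
        using qc r(1) U'.smult_closed by blast
      fix y assume y: "y \<in> Y"
      show "coords R ?U Y (\<beta> z) y \<odot>\<^bsub>?U\<^esub> y = r \<odot>\<^bsub>?U\<^esub> (q z y \<odot>\<^bsub>?U\<^esub> y)"
        unfolding q(2)[OF y z] using y z q(1) YZ r(1) by (intro U'.smult_assoc1) auto
    qed simp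
    also have "\<dots> = r \<odot>\<^bsub>?U\<^esub> (\<Oplus>\<^bsub>?U\<^esub>y\<in>Y. q z y \<odot>\<^bsub>?U\<^esub> y)"
      using Y by (intro U'.finsum_smult_ldistr[symmetric] r(1) qc) (simp add: is_basis_def)
    finally show "\<beta> z = r \<odot>\<^bsub>?U\<^esub> (\<Oplus>\<^bsub>?U\<^esub>y\<in>Y. q z y \<odot>\<^bsub>?U\<^esub> y)" .
  qed
  then obtain w where w: "w z \<in> carrier U" "\<beta> z = r \<odot>\<^bsub>?U\<^esub> w z" if "z \<in> Z" for z by metis
  define \<gamma> where "\<gamma> v = (\<Oplus>\<^bsub>?U\<^esub>z\<in>Z. ?c v z \<odot>\<^bsub>?U\<^esub> w z)" for v
  have wc: "(\<lambda>z. ?c v z \<odot>\<^bsub>?U\<^esub> w z) \<in> Z \<rightarrow> carrier ?U" if "v \<in> carrier V" for v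
    using c[OF that] w(1) U'.smult_closed by auto
  have \<gamma>c: "\<gamma> v \<in> carrier U" if "v \<in> carrier V" for v
    using U'.M.finsum_closed[OF wc[OF that]] by (simp add: \<gamma>_def)
  have \<beta>\<gamma>: "\<beta> v = r \<odot>\<^bsub>?U\<^esub> \<gamma> v" if v: "v \<in> carrier V" for v
  proof -
    have "\<beta> v = (\<Oplus>\<^bsub>?U\<^esub>z\<in>Z. ?c v z \<odot>\<^bsub>?U\<^esub> \<beta> z)"
      using v by (intro linear_map_expand[OF R.is_cring linear_map_restrict_scalars[OF \<beta>'(1)] Z]) simp
    also have "\<dots> = (\<Oplus>\<^bsub>?U\<^esub>z\<in>Z. r \<odot>\<^bsub>?U\<^esub> (?c v z \<odot>\<^bsub>?U\<^esub> w z))"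
    proof (rule U'.M.finsum_cong')
      show "(\<lambda>z. r \<odot>\<^bsub>?U\<^esub> (?c v z \<odot>\<^bsub>?U\<^esub> w z)) \<in> Z \<rightarrow> carrier ?U"
        using wc[OF v] r(1) U'.smult_closed by blast
      fix z assume z: "z \<in> Z"
      have wz: "w z \<in> carrier ?U" using w(1)[OF z] by simp
      show "?c v z \<odot>\<^bsub>?U\<^esub> \<beta> z = r \<odot>\<^bsub>?U\<^esub> (?c v z \<odot>\<^bsub>?U\<^esub> w z)"
        unfolding w(2)[OF z] U'.smult_assoc1[OF c[OF v z] r(1) wz, symmetric]
          U'.smult_assoc1[OF r(1) c[OF v z] wz, symmetric] R.m_comm[OF r(1) c[OF v z]] ..
    qed simp
    also have "\<dots> = r \<odot>\<^bsub>?U\<^esub> \<gamma> v"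
      unfolding \<gamma>_def using Z
      by (intro U'.finsum_smult_ldistr[symmetric] r(1) wc[OF v]) (simp add: is_basis_def)
    finally show ?thesis .
  qed
  have cancel: "u = u'" if "r \<odot>\<^bsub>?U\<^esub> u = r \<odot>\<^bsub>?U\<^esub> u'" "u \<in> carrier U" "u' \<in> carrier U" for u u'
  proof -
    interpret s: linear_map R ?U ?U "\<lambda>u. r \<odot>\<^bsub>?U\<^esub> u"
      by (rule linear_map_smult[OF R.is_cring linear_map_id[OF left_module_restrict_scalars[OF U]] r(1)])
    have u: "u \<in> carrier ?U" "u' \<in> carrier ?U" using that by simp_all
    have "r \<odot>\<^bsub>?U\<^esub> (u \<ominus>\<^bsub>?U\<^esub> u') = r \<odot>\<^bsub>?U\<^esub> u \<ominus>\<^bsub>?U\<^esub> r \<odot>\<^bsub>?U\<^esub> u'" by (rule s.map_diff[OF u])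
    also have "\<dots> = \<zero>\<^bsub>?U\<^esub>"
      unfolding that(1) using s.closed[OF u(2)] U'.M.diff_eq_zero_iff by blast
    finally have "u \<ominus>\<^bsub>?U\<^esub> u' = \<zero>\<^bsub>?U\<^esub>"
      using U'.basis_torsion_free[OF Y R r] u by blast
    then show ?thesis using u U'.M.diff_eq_zero_iff by blast
  qed
  have \<gamma>: "linear_map A V U \<gamma>"
  proof (rule linear_mapI[OF V U])
    fix v assume v: "v \<in> carrier V"
    show "\<gamma> v \<in> carrier U" by (rule \<gamma>c[OF v])
    show "\<gamma> (v \<oplus>\<^bsub>V\<^esub> v') = \<gamma> v \<oplus>\<^bsub>U\<^esub> \<gamma> v'" if v': "v' \<in> carrier V" for v'
      using \<beta>.map_add[OF v v'] \<beta>\<gamma>[OF v] \<beta>\<gamma>[OF v'] \<beta>\<gamma>[of "v \<oplus>\<^bsub>V\<^esub> v'"] v v' r(1)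
      by - (rule cancel, simp_all add: \<gamma>c U.smult_r_distr)
    show "\<gamma> (a \<odot>\<^bsub>V\<^esub> v) = a \<odot>\<^bsub>U\<^esub> \<gamma> v" if a: "a \<in> carrier A" for a
      using \<beta>.map_smult[OF a v] \<beta>\<gamma>[OF v] \<beta>\<gamma>[of "a \<odot>\<^bsub>V\<^esub> v"] v a r(1)
      by - (rule cancel,
        simp_all add: \<gamma>c U.smult_closed V.smult_closed U.smult_assoc1[symmetric] scalar_mult mult_scalar)
  qed
  show ?thesis
  proof (rule bexI[OF _ module_homs_restrict[OF \<gamma>]])
    show "\<beta> = r \<odot>\<^bsub>hom_module A V U\<^esub> restrict \<gamma> (carrier V)"
      unfolding hom_module_simps using \<beta>\<gamma>
      by (intro extensionalityI[OF \<beta>'(2)]) auto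
  qed
qed

text \<open>
  A functional on the homomorphisms is a combination of the matrix coefficients of \<open>\<beta>\<close>. The coefficient of
  \<open>\<beta>\<close> at basis elements \<open>z\<close> and \<open>y\<close> is the trace of \<open>\<beta>\<close> composed with \<open>u \<mapsto> c y u z\<close>, where \<open>c y u\<close> is the
  coordinate of \<open>u\<close> at \<open>y\<close>, so the combination is the trace of \<open>\<beta> \<circ> \<tau>\<close> for one linear map \<open>\<tau>\<close>.
\<close>

lemma functional_on_homs_eq_trace:
  fixes U :: "('a, 'u) module" and V :: "('a, 'v) module"
  assumes R: "domain R"
    and total: "\<And>a b. \<lbrakk>a \<in> carrier R; b \<in> carrier R\<rbrakk> \<Longrightarrow> a divides\<^bsub>R\<^esub> b \<or> b divides\<^bsub>R\<^esub> a"
    and U: "left_module A U" "free_finite_rank R (restrict_scalars A U)"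
    and V: "left_module A V" "free_finite_rank R (restrict_scalars A V)"
    and \<phi>: "linear_map R (hom_module A V U) (regular_module R) \<phi>"
  shows "\<exists>\<tau>. linear_map R (restrict_scalars A U) (restrict_scalars A V) \<tau> \<and>
    (\<forall>\<beta>\<in>module_homs A V U. \<phi> \<beta> = linear_trace R (restrict_scalars A U) (\<lambda>u. \<beta> (\<tau> u)))"
proof -
  let ?U = "restrict_scalars A U" and ?V = "restrict_scalars A V" and ?H = "hom_module A V U"
  let ?tr = "linear_trace R ?U" and ?R = "regular_module R"
  interpret R: domain R by (rule R)
  interpret U: left_module A U by (rule U(1))
  interpret U': module R ?U by (rule module_restrict_scalars[OF U(1)])
  interpret V': module R ?V by (rule module_restrict_scalars[OF V(1)])
  interpret H: module R ?H by (rule module_hom_module[OF V(1) U(1)])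
  note UR = left_module_restrict_scalars[OF U(1)] and VR = left_module_restrict_scalars[OF V(1)]
  note RR = left_module_if_module[OF module_regular[OF R.is_cring]]
  note HR = left_module_if_module[OF H.module_axioms]
  have homs: "\<beta> \<in> carrier ?H \<longleftrightarrow> linear_map A V U \<beta> \<and> \<beta> \<in> extensional (carrier V)" for \<beta>
    by (simp add: hom_module_simps module_homs_iff[OF V(1) U(1)])
  have \<beta>c: "\<beta> v \<in> carrier U" if "\<beta> \<in> carrier ?H" "v \<in> carrier V" for \<beta> v
    using linear_map.closed[of A V U \<beta> v] that by (simp add: homs)
  obtain Y Z where Y: "is_basis R ?U Y" and Z: "is_basis R ?V Z"
    using U(2) V(2) by (auto simp: free_finite_rank_def)
  have YZ: "finite Y" "finite Z" "Y \<subseteq> carrier U" "Z \<subseteq> carrier V"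
    using Y Z by (simp_all add: is_basis_def)
  have cU: "coords R ?U Y u y \<in> carrier R" if "u \<in> carrier U" "y \<in> Y" for u y
    using U'.coords_basis(1)[OF Y, of u] that by auto
  \<comment> \<open>the matrix coefficients of a homomorphism in the two bases\<close>
  let ?e = "\<lambda>(z, y) \<beta>. coords R ?U Y (\<beta> z) y"
  have e: "linear_map R ?H ?R (?e i)" if i: "i \<in> Z \<times> Y" for i
  proof -
    obtain z y where i: "i = (z, y)" "z \<in> Z" "y \<in> Y" using i by blast
    have zV: "z \<in> carrier V" using i YZ by blast
    have "linear_map R ?H ?U (\<lambda>\<beta>. \<beta> z)"
      by (rule linear_mapI[OF HR UR]) (simp_all add: \<beta>c zV hom_module_simps(3,4))
    from linear_map_comp[OF this U'.linear_map_coords[OF Y i(3)]] show ?thesis by (simp add: i)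
  qed
  have "\<exists>k\<in>Z \<times> Y \<rightarrow> carrier R. \<forall>\<beta>\<in>carrier ?H. \<phi> \<beta> = (\<Oplus>\<^bsub>R\<^esub>i\<in>Z \<times> Y. k i \<otimes>\<^bsub>R\<^esub> ?e i \<beta>)"
  proof (rule H.functional_eq_combination_of_coordinates[OF R total \<phi> _ e H.carrier_is_submodule])
    show "finite (Z \<times> Y)" using YZ by simp
    show "\<beta> = \<zero>\<^bsub>?H\<^esub>" if \<beta>: "\<beta> \<in> carrier ?H" and zero: "\<And>i. i \<in> Z \<times> Y \<Longrightarrow> ?e i \<beta> = \<zero>\<^bsub>R\<^esub>" for \<beta>
    proof -
      have "\<beta> z = \<zero>\<^bsub>U\<^esub>" if z: "z \<in> Z" for z
      proof -
        have \<beta>z: "\<beta> z \<in> carrier ?U" using \<beta>c[OF \<beta>] YZ z by auto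
        have "(\<Oplus>\<^bsub>?U\<^esub>y\<in>Y. coords R ?U Y (\<beta> z) y \<odot>\<^bsub>?U\<^esub> y) = (\<Oplus>\<^bsub>?U\<^esub>y\<in>Y. \<zero>\<^bsub>?U\<^esub>)"
        proof (rule U'.M.finsum_cong')
          fix y assume y: "y \<in> Y"
          then have "y \<in> carrier ?U" using YZ by auto
          then show "coords R ?U Y (\<beta> z) y \<odot>\<^bsub>?U\<^esub> y = \<zero>\<^bsub>?U\<^esub>"
            using zero[of "(z, y)"] y z U'.smult_l_null[of y] by simp
        qed auto
        then show ?thesis using U'.coords_basis(2)[OF Y \<beta>z] by simp
      qed
      then have "\<beta> v = \<zero>\<^bsub>U\<^esub>" if v: "v \<in> carrier V" for v
      proof -
        assume \<beta>0: "\<And>z. z \<in> Z \<Longrightarrow> \<beta> z = \<zero>\<^bsub>U\<^esub>"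
        have cV: "coords R ?V Z v z \<in> carrier R" if "z \<in> Z" for z
          using V'.coords_basis(1)[OF Z, of v] v that by auto
        have "\<beta> v = (\<Oplus>\<^bsub>?U\<^esub>z\<in>Z. coords R ?V Z v z \<odot>\<^bsub>?U\<^esub> \<beta> z)"
          using \<beta> v by (intro linear_map_expand[OF R.is_cring linear_map_restrict_scalars Z]) (simp_all add: homs)
        also have "\<dots> = (\<Oplus>\<^bsub>?U\<^esub>z\<in>Z. \<zero>\<^bsub>?U\<^esub>)"
        proof (rule U'.M.finsum_cong')
          fix z assume "z \<in> Z"
          then show "coords R ?V Z v z \<odot>\<^bsub>?U\<^esub> \<beta> z = \<zero>\<^bsub>?U\<^esub>"
            using U'.smult_r_null[OF cV] \<beta>0 by simp
        qed auto
        finally show ?thesis by simp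
      qed
      moreover have "\<beta> \<in> extensional (carrier V)" using \<beta> by (simp add: homs)
      ultimately show ?thesis
        unfolding hom_module_simps by (intro extensionalityI[where A = "carrier V"]) auto
    qed
    show "\<exists>\<gamma>\<in>carrier ?H. \<beta> = r \<odot>\<^bsub>?H\<^esub> \<gamma>"
      if "r \<in> carrier R" "r \<noteq> \<zero>\<^bsub>R\<^esub>" "\<beta> \<in> carrier ?H" "\<And>i. i \<in> Z \<times> Y \<Longrightarrow> r divides\<^bsub>R\<^esub> ?e i \<beta>" for r \<beta>
      using hom_divisible_if_coords_divisible[OF R U(1) V(1) Y Z _ that(1,2), of \<beta>] that(3,4) by (force simp: hom_module_simps(1))
  qed
  then obtain k where k: "k \<in> Z \<times> Y \<rightarrow> carrier R"
    and \<phi>k: "\<And>\<beta>. \<beta> \<in> carrier ?H \<Longrightarrow> \<phi> \<beta> = (\<Oplus>\<^bsub>R\<^esub>i\<in>Z \<times> Y. k i \<otimes>\<^bsub>R\<^esub> ?e i \<beta>)" by blast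
  have kc: "k i \<in> carrier R" if "i \<in> Z \<times> Y" for i using k that by blast
  define \<tau> where "\<tau> u = (\<Oplus>\<^bsub>?V\<^esub>i\<in>Z \<times> Y. (k i \<otimes>\<^bsub>R\<^esub> coords R ?U Y u (snd i)) \<odot>\<^bsub>?V\<^esub> fst i)" for u
  have k_coord: "linear_map R ?U ?R (\<lambda>u. k i \<otimes>\<^bsub>R\<^esub> coords R ?U Y u (snd i))" if "i \<in> Z \<times> Y" for i
    using linear_map_smult[OF R.is_cring U'.linear_map_coords[OF Y, of "snd i"] kc[OF that]] that by auto
  have fst_V: "fst i \<in> carrier V" if "i \<in> Z \<times> Y" for i using that YZ by auto
  have \<tau>: "linear_map R ?U ?V \<tau>"
    unfolding \<tau>_def
    by (rule linear_map_finsum[OF UR VR], rule linear_map_rank_one[OF R.is_cring k_coord VR])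
      (simp_all only: restrict_scalars_simps(1) fst_V)
  have trace_\<tau>: "?tr (\<lambda>u. \<beta> (\<tau> u)) = \<phi> \<beta>" if \<beta>: "\<beta> \<in> carrier ?H" for \<beta>
  proof -
    interpret \<beta>: linear_map R ?V ?U \<beta>
      using \<beta> by (intro linear_map_restrict_scalars) (simp add: homs)
    have \<beta>f: "\<beta> (fst i) \<in> carrier ?U" if "i \<in> Z \<times> Y" for i using \<beta>c[OF \<beta> fst_V[OF that]] by simp
    have kcl: "k i \<otimes>\<^bsub>R\<^esub> coords R ?U Y u (snd i) \<in> carrier R" if "i \<in> Z \<times> Y" "u \<in> carrier ?U" for i u
      using linear_map.closed[OF k_coord[OF that(1)] that(2)] by simp
    have "?tr (\<lambda>u. \<beta> (\<tau> u)) =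
        ?tr (\<lambda>u. \<Oplus>\<^bsub>?U\<^esub>i\<in>Z \<times> Y. (k i \<otimes>\<^bsub>R\<^esub> coords R ?U Y u (snd i)) \<odot>\<^bsub>?U\<^esub> \<beta> (fst i))"
    proof (rule U'.linear_trace_cong[OF U(2)])
      fix u assume u: "u \<in> carrier ?U"
      have "\<beta> (\<tau> u) = (\<Oplus>\<^bsub>?U\<^esub>i\<in>Z \<times> Y. \<beta> ((k i \<otimes>\<^bsub>R\<^esub> coords R ?U Y u (snd i)) \<odot>\<^bsub>?V\<^esub> fst i))"
        unfolding \<tau>_def
        by (rule \<beta>.map_finsum, rule Pi_I, rule V'.smult_closed, erule kcl[OF _ u]) (simp add: fst_V)
      also have "\<dots> = (\<Oplus>\<^bsub>?U\<^esub>i\<in>Z \<times> Y. (k i \<otimes>\<^bsub>R\<^esub> coords R ?U Y u (snd i)) \<odot>\<^bsub>?U\<^esub> \<beta> (fst i))"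
      proof (rule U'.M.finsum_cong')
        show "(\<lambda>i. (k i \<otimes>\<^bsub>R\<^esub> coords R ?U Y u (snd i)) \<odot>\<^bsub>?U\<^esub> \<beta> (fst i)) \<in> Z \<times> Y \<rightarrow> carrier ?U"
          by (intro Pi_I U'.smult_closed kcl \<beta>f u)
        show "\<beta> ((k i \<otimes>\<^bsub>R\<^esub> coords R ?U Y u (snd i)) \<odot>\<^bsub>?V\<^esub> fst i) =
            (k i \<otimes>\<^bsub>R\<^esub> coords R ?U Y u (snd i)) \<odot>\<^bsub>?U\<^esub> \<beta> (fst i)" if "i \<in> Z \<times> Y" for i
          using kcl[OF that u] fst_V[OF that] by (intro \<beta>.map_smult) simp_all
      qed simp
      finally show "\<beta> (\<tau> u) = (\<Oplus>\<^bsub>?U\<^esub>i\<in>Z \<times> Y. (k i \<otimes>\<^bsub>R\<^esub> coords R ?U Y u (snd i)) \<odot>\<^bsub>?U\<^esub> \<beta> (fst i))" .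
      show "(\<Oplus>\<^bsub>?U\<^esub>i\<in>Z \<times> Y. (k i \<otimes>\<^bsub>R\<^esub> coords R ?U Y u (snd i)) \<odot>\<^bsub>?U\<^esub> \<beta> (fst i)) \<in> carrier ?U"
        by (intro U'.M.finsum_closed Pi_I U'.smult_closed kcl \<beta>f u)
    qed
    also have "\<dots> = (\<Oplus>\<^bsub>R\<^esub>i\<in>Z \<times> Y. ?tr (\<lambda>u. (k i \<otimes>\<^bsub>R\<^esub> coords R ?U Y u (snd i)) \<odot>\<^bsub>?U\<^esub> \<beta> (fst i)))"
      by (rule U'.linear_trace_finsum[OF U(2)]) (use YZ in simp, intro U'.smult_closed kcl \<beta>f)
    also have "\<dots> = (\<Oplus>\<^bsub>R\<^esub>i\<in>Z \<times> Y. k i \<otimes>\<^bsub>R\<^esub> ?e i \<beta>)"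
    proof (rule R.finsum_cong')
      show "(\<lambda>i. k i \<otimes>\<^bsub>R\<^esub> ?e i \<beta>) \<in> Z \<times> Y \<rightarrow> carrier R"
        using kcl[OF _ \<beta>f] by (fastforce simp: case_prod_beta)
      show "?tr (\<lambda>u. (k i \<otimes>\<^bsub>R\<^esub> coords R ?U Y u (snd i)) \<odot>\<^bsub>?U\<^esub> \<beta> (fst i)) = k i \<otimes>\<^bsub>R\<^esub> ?e i \<beta>"
        if "i \<in> Z \<times> Y" for i
        unfolding case_prod_beta by (rule U'.linear_trace_rank_one[OF U(2) k_coord[OF that] \<beta>f[OF that]])
    qed simp
    finally show ?thesis by (simp only: \<phi>k[OF \<beta>])
  qed
  with \<tau> show ?thesis unfolding hom_module_simps(1)[symmetric] by metis
qed

text \<open>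
  The trace against a linear map of rank one is a coordinate of the value at \<open>u\<^sub>0\<close>. Passing to its
  relative trace turns the map into a homomorphism, at the cost of the factor \<open>c\<close>.
\<close>

lemma trace_detects_coordinate:
  fixes U :: "('a, 'u) module" and V :: "('a, 'v) module"
  assumes c: "c \<in> carrier R"
    and rpe: "(\<Oplus>\<^bsub>A\<^esub>x\<in>X. x \<otimes>\<^bsub>A\<^esub> d x) = c \<odot>\<^bsub>A\<^esub> \<one>\<^bsub>A\<^esub>"
    and U: "left_module A U" "free_finite_rank R (restrict_scalars A U)" and V: "left_module A V"
    and Z: "is_basis R (restrict_scalars A V) Z" and z: "z \<in> Z" and u\<^sub>0: "u\<^sub>0 \<in> carrier U"
  shows "\<exists>\<beta>\<in>module_homs A V U. \<forall>f. linear_map A U V f \<longrightarrow>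
    linear_trace R (restrict_scalars A U) (\<lambda>u. \<beta> (f u)) = c \<otimes>\<^bsub>R\<^esub> coords R (restrict_scalars A V) Z (f u\<^sub>0) z"
proof -
  let ?U = "restrict_scalars A U" and ?V = "restrict_scalars A V"
  let ?tr = "linear_trace R ?U"
  interpret U': module R ?U by (rule module_restrict_scalars[OF U(1)])
  interpret V': module R ?V by (rule module_restrict_scalars[OF V])
  define \<sigma> where "\<sigma> v = coords R ?V Z v z \<odot>\<^bsub>?U\<^esub> u\<^sub>0" for v
  have \<sigma>: "linear_map R ?V ?U \<sigma>"
    unfolding \<sigma>_def using u\<^sub>0
    by (intro linear_map_rank_one[OF R.is_cring V'.linear_map_coords[OF Z z] left_module_restrict_scalars[OF U(1)]]) simp
  define \<beta> where "\<beta> = restrict (rel_trace V U \<sigma>) (carrier V)"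
  have rel_\<sigma>: "linear_map A V U (rel_trace V U \<sigma>)" by (rule rel_trace_linear[OF V U(1) \<sigma>])
  have \<beta>: "\<beta> \<in> module_homs A V U"
    unfolding \<beta>_def by (rule module_homs_restrict[OF rel_\<sigma>])
  have detect: "?tr (\<lambda>u. \<beta> (f u)) = c \<otimes>\<^bsub>R\<^esub> coords R ?V Z (f u\<^sub>0) z" if f: "linear_map A U V f" for f
  proof -
    interpret f: linear_map A U V f by (rule f)
    note fR = linear_map_restrict_scalars[OF f]
    have "?tr (\<lambda>u. \<beta> (f u)) = ?tr (rel_trace U U (\<lambda>u. \<sigma> (f u)))"
    proof (rule U'.linear_trace_cong[OF U(2)])
      fix u assume "u \<in> carrier ?U"
      then have u: "u \<in> carrier U" by simp
      show "\<beta> (f u) = rel_trace U U (\<lambda>u. \<sigma> (f u)) u"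
        using f.closed[OF u] rel_trace_comp_right[OF V U(1) \<sigma> f u] by (simp add: \<beta>_def)
      show "rel_trace U U (\<lambda>u. \<sigma> (f u)) u \<in> carrier ?U"
        using linear_map.closed[OF rel_trace_linear[OF U(1) U(1) linear_map_comp[OF fR \<sigma>]] u] by simp
    qed
    also have "\<dots> = c \<otimes>\<^bsub>R\<^esub> ?tr (\<lambda>u. \<sigma> (f u))"
      by (rule linear_trace_rel_trace[OF U linear_map_comp[OF fR \<sigma>] rpe c])
    also have "?tr (\<lambda>u. \<sigma> (f u)) = coords R ?V Z (f u\<^sub>0) z"
      unfolding \<sigma>_def using u\<^sub>0
      by (intro U'.linear_trace_rank_one[OF U(2) linear_map_comp[OF fR V'.linear_map_coords[OF Z z]]]) simp
    finally show ?thesis .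
  qed
  from \<beta> detect show ?thesis by blast
qed

text \<open>
  This is the non-degeneracy of the pairing. The functional \<open>\<beta> \<mapsto> tr (\<beta> \<circ> \<alpha>) / c\<close> on the homomorphisms is
  \<open>\<beta> \<mapsto> tr (\<beta> \<circ> \<tau>)\<close> for a linear map \<open>\<tau>\<close>. Then \<open>\<alpha>\<close> and the relative trace of \<open>\<tau>\<close> pair equally with all
  homomorphisms, and these detect all coordinates up to the factor \<open>c\<close>.
\<close>

lemma rel_trace_if_traces_divisible:
  fixes U :: "('a, 'u) module" and V :: "('a, 'v) module"
  assumes R: "domain R"
    and total: "\<And>a b. \<lbrakk>a \<in> carrier R; b \<in> carrier R\<rbrakk> \<Longrightarrow> a divides\<^bsub>R\<^esub> b \<or> b divides\<^bsub>R\<^esub> a"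
    and c: "c \<in> carrier R" "c \<noteq> \<zero>\<^bsub>R\<^esub>"
    and rpe: "(\<Oplus>\<^bsub>A\<^esub>x\<in>X. x \<otimes>\<^bsub>A\<^esub> d x) = c \<odot>\<^bsub>A\<^esub> \<one>\<^bsub>A\<^esub>"
    and U: "left_module A U" "free_finite_rank R (restrict_scalars A U)"
    and V: "left_module A V" "free_finite_rank R (restrict_scalars A V)"
    and \<alpha>: "\<alpha> \<in> module_homs A U V"
    and div: "\<And>\<beta>. \<beta> \<in> module_homs A V U \<Longrightarrow>
      c divides\<^bsub>R\<^esub> linear_trace R (restrict_scalars A U) (\<lambda>u. \<beta> (\<alpha> u))"
  obtains \<tau> where "linear_map R (restrict_scalars A U) (restrict_scalars A V) \<tau>"
    and "\<alpha> = restrict (rel_trace U V \<tau>) (carrier U)"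
proof -
  let ?U = "restrict_scalars A U" and ?V = "restrict_scalars A V" and ?H = "hom_module A V U"
  let ?tr = "linear_trace R ?U" and ?R = "regular_module R"
  interpret R: domain R by (rule R)
  interpret U': module R ?U by (rule module_restrict_scalars[OF U(1)])
  interpret V': module R ?V by (rule module_restrict_scalars[OF V(1)])
  interpret H: module R ?H by (rule module_hom_module[OF V(1) U(1)])
  have \<alpha>': "linear_map A U V \<alpha>" "\<alpha> \<in> extensional (carrier U)"
    using \<alpha> by (simp_all add: module_homs_iff[OF U(1) V(1)])
  interpret \<alpha>: linear_map A U V \<alpha> by (rule \<alpha>'(1))
  have \<beta>_linear: "linear_map A V U \<beta>" if "\<beta> \<in> carrier ?H" for \<beta>
    using that by (simp add: hom_module_simps(1) module_homs_iff[OF V(1) U(1)])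
  have cancel: "a = b" if "c \<otimes>\<^bsub>R\<^esub> a = c \<otimes>\<^bsub>R\<^esub> b" "a \<in> carrier R" "b \<in> carrier R" for a b
    using R.m_lcancel[OF c(2,1) that(2,3)] that(1) by blast
  have "\<forall>\<beta>\<in>carrier ?H. \<exists>q. q \<in> carrier R \<and> ?tr (\<lambda>u. \<beta> (\<alpha> u)) = c \<otimes>\<^bsub>R\<^esub> q"
    using div by (auto simp: hom_module_simps(1) factor_def)
  then obtain \<phi> where "\<forall>\<beta>\<in>carrier ?H. \<phi> \<beta> \<in> carrier R \<and> ?tr (\<lambda>u. \<beta> (\<alpha> u)) = c \<otimes>\<^bsub>R\<^esub> \<phi> \<beta>"
    by (rule bchoice[THEN exE])
  then have \<phi>: "\<phi> \<beta> \<in> carrier R" "?tr (\<lambda>u. \<beta> (\<alpha> u)) = c \<otimes>\<^bsub>R\<^esub> \<phi> \<beta>" if "\<beta> \<in> carrier ?H" for \<beta>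
    using that by blast+
  have t: "?tr (\<lambda>u. (\<beta> \<oplus>\<^bsub>?H\<^esub> \<gamma>) (\<alpha> u)) = ?tr (\<lambda>u. \<beta> (\<alpha> u)) \<oplus>\<^bsub>R\<^esub> ?tr (\<lambda>u. \<gamma> (\<alpha> u))"
    "?tr (\<lambda>u. (r \<odot>\<^bsub>?H\<^esub> \<beta>) (\<alpha> u)) = r \<otimes>\<^bsub>R\<^esub> ?tr (\<lambda>u. \<beta> (\<alpha> u))"
    if "\<beta> \<in> carrier ?H" "\<gamma> \<in> carrier ?H" "r \<in> carrier R" for \<beta> \<gamma> r
    using trace_pairing_bilinear[OF U V(1)] \<alpha> that by (simp_all add: bilinear_map_def hom_module_simps(1))
  have "linear_map R ?H ?R \<phi>"
  proof (rule linear_mapI[OF left_module_if_module[OF H.module_axioms]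
        left_module_if_module[OF module_regular[OF R.is_cring]]])
    fix \<beta> assume \<beta>: "\<beta> \<in> carrier ?H"
    show "\<phi> \<beta> \<in> carrier ?R" using \<phi>(1)[OF \<beta>] by simp
    show "\<phi> (\<beta> \<oplus>\<^bsub>?H\<^esub> \<gamma>) = \<phi> \<beta> \<oplus>\<^bsub>?R\<^esub> \<phi> \<gamma>" if \<gamma>: "\<gamma> \<in> carrier ?H" for \<gamma>
      using t(1)[OF \<beta> \<gamma> c(1)] \<phi>[OF \<beta>] \<phi>[OF \<gamma>] \<phi>[OF H.M.a_closed[OF \<beta> \<gamma>]] c(1)
      by - (rule cancel, simp_all add: R.r_distr)
    show "\<phi> (r \<odot>\<^bsub>?H\<^esub> \<beta>) = r \<odot>\<^bsub>?R\<^esub> \<phi> \<beta>" if r: "r \<in> carrier R" for r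
      using t(2)[OF \<beta> \<beta> r] \<phi>[OF \<beta>] \<phi>[OF H.smult_closed[OF r \<beta>]] c(1) r
      by - (rule cancel, simp_all add: R.m_lcomm)
  qed
  from functional_on_homs_eq_trace[OF R total U V this] obtain \<tau> where \<tau>: "linear_map R ?U ?V \<tau>"
    and \<phi>\<tau>: "\<And>\<beta>. \<beta> \<in> carrier ?H \<Longrightarrow> \<phi> \<beta> = ?tr (\<lambda>u. \<beta> (\<tau> u))"
    by (auto simp: hom_module_simps(1))
  note rel_\<tau> = rel_trace_linear[OF U(1) V(1) \<tau>]
  have same_pairing: "?tr (\<lambda>u. \<beta> (\<alpha> u)) = ?tr (\<lambda>u. \<beta> (rel_trace U V \<tau> u))" if \<beta>: "\<beta> \<in> carrier ?H" for \<beta>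
  proof -
    note \<beta>l = \<beta>_linear[OF \<beta>]
    have "?tr (\<lambda>u. \<beta> (\<alpha> u)) = c \<otimes>\<^bsub>R\<^esub> ?tr (\<lambda>u. \<beta> (\<tau> u))" by (simp only: \<phi>(2)[OF \<beta>] \<phi>\<tau>[OF \<beta>])
    also have "\<dots> = ?tr (rel_trace U U (\<lambda>u. \<beta> (\<tau> u)))"
      by (rule linear_trace_rel_trace[OF U linear_map_comp[OF \<tau> linear_map_restrict_scalars[OF \<beta>l]] rpe c(1), symmetric])
    also have "\<dots> = ?tr (\<lambda>u. \<beta> (rel_trace U V \<tau> u))"
      using linear_map.closed[OF \<beta>l linear_map.closed[OF rel_\<tau>]]
      by (intro U'.linear_trace_cong[OF U(2)]) (simp_all add: rel_trace_comp_left[OF U(1) V(1) \<tau> \<beta>l])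
    finally show ?thesis .
  qed
  obtain Z where Z: "is_basis R ?V Z" using V(2) by (auto simp: free_finite_rank_def)
  have "\<alpha> u\<^sub>0 = rel_trace U V \<tau> u\<^sub>0" if u\<^sub>0: "u\<^sub>0 \<in> carrier U" for u\<^sub>0
  proof -
    have cl: "\<alpha> u\<^sub>0 \<in> carrier ?V" "rel_trace U V \<tau> u\<^sub>0 \<in> carrier ?V"
      using \<alpha>.closed[OF u\<^sub>0] linear_map.closed[OF rel_\<tau> u\<^sub>0] by simp_all
    have "coords R ?V Z (\<alpha> u\<^sub>0) z = coords R ?V Z (rel_trace U V \<tau> u\<^sub>0) z" if z: "z \<in> Z" for z
    proof -
      obtain \<beta> where \<beta>: "\<beta> \<in> carrier ?H" and detect: "\<And>f. linear_map A U V f \<Longrightarrow>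
          ?tr (\<lambda>u. \<beta> (f u)) = c \<otimes>\<^bsub>R\<^esub> coords R ?V Z (f u\<^sub>0) z"
        using trace_detects_coordinate[OF c(1) rpe U V(1) Z z u\<^sub>0] unfolding hom_module_simps(1) by blast
      have "c \<otimes>\<^bsub>R\<^esub> coords R ?V Z (\<alpha> u\<^sub>0) z = c \<otimes>\<^bsub>R\<^esub> coords R ?V Z (rel_trace U V \<tau> u\<^sub>0) z"
        using same_pairing[OF \<beta>] by (simp only: detect[OF \<alpha>'(1)] detect[OF rel_\<tau>])
      then show ?thesis
        using linear_map.closed[OF V'.linear_map_coords[OF Z z]] cl by - (rule cancel, simp_all)
    qed
    then have "coords R ?V Z (\<alpha> u\<^sub>0) = coords R ?V Z (rel_trace U V \<tau> u\<^sub>0)"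
      using V'.coords_basis(1)[OF Z cl(1)] V'.coords_basis(1)[OF Z cl(2)]
      by (intro extensionalityI[where A = Z]) (auto simp: PiE_def)
    then show ?thesis
      using V'.coords_basis(2)[OF Z cl(1)] V'.coords_basis(2)[OF Z cl(2)] by metis
  qed
  then have "\<alpha> = restrict (rel_trace U V \<tau>) (carrier U)"
    by (intro extensionalityI[OF \<alpha>'(2)]) simp_all
  with \<tau> show thesis by (rule that)
qed

text \<open>
  The factor \<open>c\<close> by which relative traces multiply the linear trace makes the pairing well defined
  modulo the ideal generated by \<open>c\<close>. Non-degeneracy in the second argument
  is the first case with \<open>U\<close> and \<open>V\<close> exchanged, after commuting the two maps under the trace.
\<close>

lemma stable_trace_pairing:
  fixes U :: "('a, 'u) module" and V :: "('a, 'v) module"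
    and jU :: "'u \<Rightarrow> 'w" and jV :: "'v \<Rightarrow> 'w"
  assumes R: "domain R"
    and total: "\<And>a b. \<lbrakk>a \<in> carrier R; b \<in> carrier R\<rbrakk> \<Longrightarrow> a divides\<^bsub>R\<^esub> b \<or> b divides\<^bsub>R\<^esub> a"
    and c: "c \<in> carrier R" "c \<noteq> \<zero>\<^bsub>R\<^esub>"
    and rpe: "(\<Oplus>\<^bsub>A\<^esub>x\<in>X. x \<otimes>\<^bsub>A\<^esub> d x) = c \<odot>\<^bsub>A\<^esub> \<one>\<^bsub>A\<^esub>"
    and U: "left_module A U" "free_finite_rank R (restrict_scalars A U)"
    and V: "left_module A V" "free_finite_rank R (restrict_scalars A V)"
    and jU: "inj_on jU (carrier U)" and jV: "inj_on jV (carrier V)"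
  defines "PUV \<equiv> projective_homs TYPE('w) R A U V" and "PVU \<equiv> projective_homs TYPE('w) R A V U"
    and "I \<equiv> PIdl\<^bsub>R\<^esub> c"
  shows "\<exists>b. bilinear_map R (quotient_module (hom_module A U V) PUV) (quotient_module (hom_module A V U) PVU)
        (quotient_module (regular_module R) I) b \<and>
      (\<forall>\<alpha>\<in>module_homs A U V. \<forall>\<beta>\<in>module_homs A V U.
        b (PUV +>\<^bsub>hom_module A U V\<^esub> \<alpha>) (PVU +>\<^bsub>hom_module A V U\<^esub> \<beta>)
          = I +>\<^bsub>R\<^esub> linear_trace R (restrict_scalars A U) (compose (carrier U) \<beta> \<alpha>)) \<and>
      nondegenerate (quotient_module (hom_module A U V) PUV) (quotient_module (hom_module A V U) PVU)
        (quotient_module (regular_module R) I) b"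
proof -
  let ?U = "restrict_scalars A U" and ?V = "restrict_scalars A V"
  let ?t = "\<lambda>\<alpha> \<beta>. linear_trace R ?U (\<lambda>u. \<beta> (\<alpha> u))"
  interpret R: domain R by (rule R)
  interpret U: left_module A U by (rule U(1))
  interpret V: left_module A V by (rule V(1))
  interpret U': module R ?U by (rule module_restrict_scalars[OF U(1)])
  interpret V': module R ?V by (rule module_restrict_scalars[OF V(1)])
  have homsUV: "\<alpha> \<in> module_homs A U V \<longleftrightarrow> linear_map A U V \<alpha> \<and> \<alpha> \<in> extensional (carrier U)" for \<alpha>
    by (rule module_homs_iff[OF U(1) V(1)])
  have homsVU: "\<beta> \<in> module_homs A V U \<longleftrightarrow> linear_map A V U \<beta> \<and> \<beta> \<in> extensional (carrier V)" for \<beta>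
    by (rule module_homs_iff[OF V(1) U(1)])
  have \<alpha>c: "\<alpha> u \<in> carrier V" if "\<alpha> \<in> module_homs A U V" "u \<in> carrier U" for \<alpha> u
    using linear_map.closed[of A U V \<alpha> u] that by (simp add: homsUV)
  have \<beta>c: "\<beta> v \<in> carrier U" if "\<beta> \<in> module_homs A V U" "v \<in> carrier V" for \<beta> v
    using linear_map.closed[of A V U \<beta> v] that by (simp add: homsVU)
  have I_iff: "a \<in> I \<longleftrightarrow> c divides\<^bsub>R\<^esub> a" if "a \<in> carrier R" for a
    using c(1) that by (auto simp: I_def cgenideal_def factor_def R.m_comm)
  have I: "submodule I R (regular_module R)"
    unfolding I_def by (rule submodule_ideal[OF R.is_cring R.cgenideal_ideal[OF c(1)]])
  have tc: "?t \<alpha> \<beta> \<in> carrier R" if "\<alpha> \<in> module_homs A U V" "\<beta> \<in> module_homs A V U" for \<alpha> \<beta>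
    using \<alpha>c[OF that(1)] \<beta>c[OF that(2)] by (intro U'.linear_trace_closed[OF U(2)]) simp
  have PUV: "submodule PUV R (hom_module A U V)" and PVU: "submodule PVU R (hom_module A V U)"
    unfolding PUV_def PVU_def
    by (rule submodule_projective_homs[OF U(1) V(1) jV], rule submodule_projective_homs[OF V(1) U(1) jU])
  have divisible: "linear_trace R ?U f \<in> I"
    if \<rho>: "linear_map R ?U ?U \<rho>" and f: "\<And>u. u \<in> carrier U \<Longrightarrow> f u = rel_trace U U \<rho> u" for f \<rho>
  proof -
    have "linear_trace R ?U f = linear_trace R ?U (rel_trace U U \<rho>)"
      using linear_map.closed[OF rel_trace_linear[OF U(1) U(1) \<rho>]] f
      by (intro U'.linear_trace_cong[OF U(2)]) simp_all
    also have "\<dots> = c \<otimes>\<^bsub>R\<^esub> linear_trace R ?U \<rho>"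
      by (rule linear_trace_rel_trace[OF U \<rho> rpe c(1)])
    finally have eq: "linear_trace R ?U f = c \<otimes>\<^bsub>R\<^esub> linear_trace R ?U \<rho>" .
    have "linear_trace R ?U \<rho> \<in> carrier R"
      by (rule U'.linear_trace_closed[OF U(2) linear_map.closed[OF \<rho>]])
    then show ?thesis
      unfolding eq using I_iff[OF R.m_closed[OF c(1)]] by (auto simp: factor_def)
  qed
  have left: "?t \<alpha> \<beta> \<in> I" if \<alpha>: "\<alpha> \<in> PUV" and "\<beta> \<in> carrier (hom_module A V U)" for \<alpha> \<beta>
  proof -
    have \<beta>: "\<beta> \<in> module_homs A V U" "linear_map A V U \<beta>" using that(2) by (simp_all add: hom_module_simps(1) homsVU)
    obtain \<tau> where \<tau>: "linear_map R ?U ?V \<tau>" "\<And>u. u \<in> carrier U \<Longrightarrow> \<alpha> u = rel_trace U V \<tau> u"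
      using rel_trace_if_projective[OF U(1) V(1) \<alpha>[unfolded PUV_def]] by blast
    show ?thesis
      by (rule divisible[OF linear_map_comp[OF \<tau>(1) linear_map_restrict_scalars[OF \<beta>(2)]]])
        (simp add: \<tau>(2) rel_trace_comp_left[OF U(1) V(1) \<tau>(1) \<beta>(2)])
  qed
  have right: "?t \<alpha> \<beta> \<in> I" if "\<alpha> \<in> carrier (hom_module A U V)" and \<beta>: "\<beta> \<in> PVU" for \<alpha> \<beta>
  proof -
    have \<alpha>: "\<alpha> \<in> module_homs A U V" "linear_map A U V \<alpha>" using that(1) by (simp_all add: hom_module_simps(1) homsUV)
    obtain \<tau> where \<tau>: "linear_map R ?V ?U \<tau>" "\<And>v. v \<in> carrier V \<Longrightarrow> \<beta> v = rel_trace V U \<tau> v"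
      using rel_trace_if_projective[OF V(1) U(1) \<beta>[unfolded PVU_def]] by blast
    show ?thesis
      by (rule divisible[OF linear_map_comp[OF linear_map_restrict_scalars[OF \<alpha>(2)] \<tau>(1)]])
        (simp add: \<tau>(2) \<alpha>c[OF \<alpha>(1)] rel_trace_comp_right[OF V(1) U(1) \<tau>(1) \<alpha>(2)])
  qed
  have nd_left: "\<alpha> \<in> PUV" if "\<alpha> \<in> carrier (hom_module A U V)"
    and div: "\<And>\<beta>. \<beta> \<in> carrier (hom_module A V U) \<Longrightarrow> ?t \<alpha> \<beta> \<in> I" for \<alpha>
  proof -
    have \<alpha>: "\<alpha> \<in> module_homs A U V" using that(1) by (simp add: hom_module_simps(1))
    have "c divides\<^bsub>R\<^esub> ?t \<alpha> \<beta>" if "\<beta> \<in> module_homs A V U" for \<beta>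
      using div[of \<beta>] I_iff[OF tc[OF \<alpha> that]] that by (simp add: hom_module_simps(1))
    then obtain \<tau> where "linear_map R ?U ?V \<tau>" "\<alpha> = restrict (rel_trace U V \<tau>) (carrier U)"
      using rel_trace_if_traces_divisible[OF R total c rpe U V \<alpha>] by blast
    then show ?thesis
      using projective_if_rel_trace[OF U(1) V(1) _ jV] by (simp add: PUV_def)
  qed
  have nd_right: "\<beta> \<in> PVU" if "\<beta> \<in> carrier (hom_module A V U)"
    and div: "\<And>\<alpha>. \<alpha> \<in> carrier (hom_module A U V) \<Longrightarrow> ?t \<alpha> \<beta> \<in> I" for \<beta>
  proof -
    have \<beta>: "\<beta> \<in> module_homs A V U" "linear_map A V U \<beta>" using that(1) by (simp_all add: hom_module_simps(1) homsVU)
    have "c divides\<^bsub>R\<^esub> linear_trace R ?V (\<lambda>v. \<alpha> (\<beta> v))" if \<alpha>: "\<alpha> \<in> module_homs A U V" for \<alpha>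
    proof -
      have "linear_map A U V \<alpha>" using \<alpha> by (simp add: homsUV)
      then have "linear_trace R ?V (\<lambda>v. \<alpha> (\<beta> v)) = ?t \<alpha> \<beta>"
        by (intro linear_trace_commute[OF R.is_cring V(2) U(2)] linear_map_restrict_scalars \<beta>(2))
      then show ?thesis
        using div[of \<alpha>] I_iff[OF tc[OF \<alpha> \<beta>(1)]] \<alpha> by (simp add: hom_module_simps(1))
    qed
    then obtain \<tau> where "linear_map R ?V ?U \<tau>" "\<beta> = restrict (rel_trace V U \<tau>) (carrier V)"
      using rel_trace_if_traces_divisible[OF R total c rpe V U \<beta>(1)] by blast
    then show ?thesis
      using projective_if_rel_trace[OF V(1) U(1) _ jU] by (simp add: PVU_def)
  qed
  have t_eq: "linear_trace R ?U (compose (carrier U) \<beta> \<alpha>) = ?t \<alpha> \<beta>"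
    if "\<alpha> \<in> module_homs A U V" "\<beta> \<in> module_homs A V U" for \<alpha> \<beta>
    using \<alpha>c[OF that(1)] \<beta>c[OF that(2)]
    by (intro U'.linear_trace_cong[OF U(2)]) (simp_all add: compose_def)
  let ?HUV = "quotient_module (hom_module A U V) PUV" and ?HVU = "quotient_module (hom_module A V U) PVU"
  let ?Q = "quotient_module (regular_module R) I"
  have "\<exists>b. bilinear_map R ?HUV ?HVU ?Q b \<and>
      (\<forall>\<alpha>\<in>carrier (hom_module A U V). \<forall>\<beta>\<in>carrier (hom_module A V U).
        b (PUV +>\<^bsub>hom_module A U V\<^esub> \<alpha>) (PVU +>\<^bsub>hom_module A V U\<^esub> \<beta>) = I +>\<^bsub>regular_module R\<^esub> ?t \<alpha> \<beta>) \<and>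
      nondegenerate ?HUV ?HVU ?Q b"
    by (rule pairing_on_quotients[OF module_hom_module[OF U(1) V(1)] module_hom_module[OF V(1) U(1)]
      module_regular[OF R.is_cring] PUV PVU I trace_pairing_bilinear[OF U V(1)] left right nd_left nd_right])
  then show ?thesis by (simp only: hom_module_simps(1) regular_module_coset t_eq cong: ball_cong)
qed

end

theorem corollary1p4:
  fixes \<O> :: "'o ring" and K :: "'k ring" and \<iota> :: "'o \<Rightarrow> 'k"
    and A :: "('o, 'a) module" and U :: "('a, 'u) module" and V :: "('a, 'v) module"
    and \<pi> :: 'o and p n :: nat and s :: "'a \<Rightarrow> 'o"
  assumes "Factorial_Ring.prime p"
    and "complete_dvr \<O> \<pi>"
    and "has_characteristic (\<O> Quot (PIdl\<^bsub>\<O>\<^esub> \<pi>)) p"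
    and "fraction_field \<O> K \<iota>" and "has_characteristic K 0"
    and "symmetric_algebra \<O> A"
    and "separable_algebra K (scalar_extension \<O> K \<iota> A)"
    and "symmetrising_form \<O> A s" and "n > 0"
    and "is_relative_projective_element \<O> A s ((\<pi> [^]\<^bsub>\<O>\<^esub> n) \<odot>\<^bsub>A\<^esub> \<one>\<^bsub>A\<^esub>)"
    and "lattice_over \<O> A U" and "lattice_over \<O> A V"
  shows
    "let w = TYPE('u + 'v + 'w); I = PIdl\<^bsub>\<O>\<^esub> (\<pi> [^]\<^bsub>\<O>\<^esub> n);
         HUV = stable_hom_module w \<O> A U V;
         HVU = stable_hom_module w \<O> A V U;
         Q = quotient_module (regular_module \<O>) I
     in \<exists>b. bilinear_map \<O> HUV HVU Q b \<and>
          (\<forall>\<alpha>\<in>module_homs A U V. \<forall>\<beta>\<in>module_homs A V U.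
             b (stable_class w \<O> A U V \<alpha>) (stable_class w \<O> A V U \<beta>)
               = I +>\<^bsub>\<O>\<^esub> linear_trace \<O> (restrict_scalars A U) (compose (carrier U) \<beta> \<alpha>)) \<and>
          nondegenerate HUV HVU Q b"
proof -
  interpret R: complete_dvr \<O> \<pi> by fact
  obtain X d where X: "is_basis \<O> A X" and d: "d \<in> X \<rightarrow> carrier A"
    and dual: "\<forall>x\<in>X. \<forall>y\<in>X. s (x \<otimes>\<^bsub>A\<^esub> d y) = (if x = y then \<one>\<^bsub>\<O>\<^esub> else \<zero>\<^bsub>\<O>\<^esub>)"
    and rpe: "(\<pi> [^]\<^bsub>\<O>\<^esub> n) \<odot>\<^bsub>A\<^esub> \<one>\<^bsub>A\<^esub> = (\<Oplus>\<^bsub>A\<^esub>x\<in>X. x \<otimes>\<^bsub>A\<^esub> d x)"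
    using assms(10) unfolding is_relative_projective_element_def by blast
  have "assoc_algebra \<O> A" using assms(6) by (simp add: symmetric_algebra_def)
  then interpret dual_bases_algebra \<O> A s X d
    using assms(8) X d dual by (rule dual_bases_algebra_if_symmetrising_form)
  have U: "left_module A U" "free_finite_rank \<O> (restrict_scalars A U)"
    and V: "left_module A V" "free_finite_rank \<O> (restrict_scalars A V)"
    using assms(11,12) by (simp_all add: lattice_over_def)
  \<comment> \<open>both lattices embed into the type over which the relatively projective modules range\<close>
  have "inj_on (Inl :: 'u \<Rightarrow> 'u + 'v + 'w) (carrier U)"
    and "inj_on (\<lambda>v. Inr (Inl v) :: 'u + 'v + 'w) (carrier V)"
    by (simp_all add: inj_on_def)
  from stable_trace_pairing[OF R.domain_axioms R.divides_total R.nat_pow_closed[OF R.uniformizer_closed]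
      R.uniformizer_power_nonzero rpe[symmetric] U V this]
  show ?thesis
    unfolding Let_def stable_hom_module_def stable_class_def .
qed

end
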